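(* Let $n\ge2$ and let $\alpha=(\alpha_1,\dots,\alpha_n)$ be real numbers with $\sum_{i=1}^n\alpha_i=0$, $\alpha_1\in\,]0,1[$ and $\alpha_i\in\,]-1,0[$ for $i=2,\dots,n$. For $(\tau,z)\in\mathcal T\!or_{1,n}$ set (with $z_1=0$) $$a_0(\tau,z)=-\frac{\operatorname{Im}\big(\sum_{i=1}^n\alpha_iz_i\big)}{\operatorname{Im}(\tau)},\qquad a_\infty(\tau,z)=a_0(\tau,z)\,\tau+\sum_{i=1}^n\alpha_iz_i\in\mathbb R .$$ 1. The map $\xi^\alpha:\mathcal T\!or_{1,n}\to\mathbb R^2$, $(\tau,z)\mapsto(a_0(\tau,z),a_\infty(\tau,z))$ is a primitive first integral of Veech's foliation $\mathcal F^\alpha$ (that is, the nonempty level sets of $\xi^\alpha$ are connected and are exactly the leaves of $\mathcal F^\alpha$). 2. One has $\mathrm{Im}(\xi^\alpha)=\mathbb R^2$ if $n\ge3$ and $\mathrm{Im}(\xi^\alpha)=\mathbb R^2\setminus\alpha_1\mathbb Z^2$ if $n=2$. 3. For $a=(a_0,a_\infty)\in\mathrm{Im}(\xi^\alpha)$, the leaf $\mathcal F^\alpha_a=(\xi^\alpha)^{-1}(a)$ in $\mathcal T\!or_{1,n}$ is cut out by the equation $$a_0\tau+\sum_{i=1}^n\alpha_iz_i=a_\infty .$$ 4. Veech's foliation $\mathcal F^\alpha$ on $\mathcal T\!or_{1,n}$ depends only on the class $[\alpha]\in\mathbb P(\mathbb R^n)$.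
   Context: For $\tau\in\mathbb H$ write $\mathbb Z_\tau=\mathbb Z+\mathbb Z\tau$ and $E_\tau=\mathbb C/\mathbb Z_\tau$. The Torelli space of $n$-marked elliptic curves is (Nag) $\mathcal T\!or_{1,n}=\{(\tau,z)=(\tau,z_2,\dots,z_n)\in\mathbb H\times\mathbb C^{n-1}: z_i-z_j\notin\mathbb Z_\tau\text{ for }1\le i<j\le n\}$ with the normalization $z_1=0$. By a theorem of Troyanov, for $(\tau,z)\in\mathcal T\!or_{1,n}$ there is a flat metric $m^\alpha_{\tau,z}$ on $E_\tau$, unique up to scaling, compatible with the conformal structure and with a conical singularity of angle $2\pi(1+\alpha_i)$ at $[z_i]$ for $i=1,\dots,n$. The linear holonomy map is $h^\alpha:\mathcal T\!or_{1,n}\to\mathbb U^2$ ($\mathbb U$ the unit circle), sending $(\tau,z)$ to the linear (rotational) holonomies of $m^\alpha_{\tau,z}$ along the loops $\gamma_0,\gamma_\infty$ of $E_\tau\setminus\{[z_i]\}$ that are images of $t\mapsto\star+t$ and $t\mapsto\star+t\tau$, $t\in[0,1]$, with $\star$ a base point very close to $0$ of the form $-\epsilon(1+i)$. Here the linear holonomy along a loop is the $\rho\in\mathbb U$ such that continuation of a developing map $D$ along it gives $\rho D+\text{const}$. Veech's foliation $\mathcal F^\alpha$ is the real-analytic foliation of $\mathcal T\!or_{1,n}$ whose leaves are the connected components of the level sets of $h^\alpha$.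
   Formalization: The loops γ_0, γ_∞ are the straight ones only when all z_i lie in the parallelogram [0,1)+[0,1)τ and Re τ < Im τ; elsewhere they are transported continuously along paths in Torelli space, since the straight loops meet 0 when Re τ = Im τ and make h^α discontinuous. *)

theory Defs
  imports "HOL-Analysis.Analysis"
begin

section \<open>The Torelli space\<close>

text \<open>
  The $n$ marked points are indexed by a finite type \<open>'n\<close> with $n = $ \<open>CARD('n)\<close>; the index
  \<open>o1\<close> plays the role of $1$. A point $(\tau, z_2, \dots, z_n)$ of $H \times C^{n-1}$ is
  represented by the pair \<open>(\<tau>, z)\<close> with \<open>z :: complex ^ 'n\<close> and \<open>z $ o1 = 0\<close>.
\<close>

type_synonym 'n config = "complex \<times> (complex ^ 'n)"

definition lattice :: "complex \<Rightarrow> complex set" where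
  "lattice \<tau> = {of_int a + of_int b * \<tau> | a b. True}"

definition torelli :: "'n::finite \<Rightarrow> 'n config set" where
  "torelli o1 = {(\<tau>, z). Im \<tau> > 0 \<and> z $ o1 = 0 \<and>
     (\<forall>i j. i \<noteq> j \<longrightarrow> z $ i - z $ j \<notin> lattice \<tau>)}"

text \<open>The preimage in the complex plane of the set of marked points of $E_\tau$.\<close>

definition punctures :: "'n::finite config \<Rightarrow> complex set" where
  "punctures x = {snd x $ i + l | i l. l \<in> lattice (fst x)}"


section \<open>Flat metrics with conical singularities\<close>

text \<open>
  A conformal metric on the punctured torus is written $\lambda(u)^2 |du|^2$ with a positive
  lattice-periodic function $\lambda$ on the complement of \<open>punctures\<close> (values of $\lambda$ at the
  punctures are irrelevant). It is flat iff it is locally the pull-back $|dD|^2$ of the Euclidean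
  metric under a holomorphic function $D$, a (local) developing map.
\<close>

definition local_developing_map :: "(complex \<Rightarrow> real) \<Rightarrow> complex \<Rightarrow> (complex \<Rightarrow> complex) \<Rightarrow> bool" where
  "local_developing_map lam u D \<longleftrightarrow>
     (\<exists>r>0. D holomorphic_on ball u r \<and> (\<forall>v\<in>ball u r. lam v = norm (deriv D v)))"

text \<open>
  The Euclidean cone of angle $2\pi(1+a)$, $a > -1$, is the plane with the metric
  $|w^a dw|^2$; the metric has a conical singularity of this angle at \<open>u\<close> if it has this form
  in some local holomorphic coordinate $w$ centred at \<open>u\<close>.
\<close>

definition conical_singularity :: "real \<Rightarrow> (complex \<Rightarrow> real) \<Rightarrow> complex \<Rightarrow> bool" where
  "conical_singularity a lam u \<longleftrightarrow>
     (\<exists>w. \<exists>r>0. w holomorphic_on ball u r \<and> inj_on w (ball u r) \<and> w u = 0 \<and>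
        (\<forall>v\<in>ball u r - {u}. lam v = norm (w v) powr a * norm (deriv w v)))"

definition flat_cone_metric :: "real ^ 'n::finite \<Rightarrow> 'n config \<Rightarrow> (complex \<Rightarrow> real) \<Rightarrow> bool" where
  "flat_cone_metric \<alpha> x lam \<longleftrightarrow>
     (\<forall>u. u \<notin> punctures x \<longrightarrow>
        lam u > 0 \<and> (\<forall>l\<in>lattice (fst x). lam (u + l) = lam u) \<and>
        (\<exists>D. local_developing_map lam u D)) \<and>
     (\<forall>i. conical_singularity (\<alpha> $ i) lam (snd x $ i))"


section \<open>Linear holonomy\<close>

text \<open>
  A loop in $E_\tau$ of class \<open>p\<close> in the lattice is given by a lift \<open>\<Gamma>\<close> to the plane with
  \<open>\<Gamma> 1 = \<Gamma> 0 + p\<close>. The germs \<open>D t\<close> at \<open>\<Gamma> t\<close> are the continuation along \<open>\<Gamma>\<close> of the developing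
  map \<open>D 0\<close>; the germ \<open>D 1\<close> is compared with \<open>D 0\<close> through the translation by \<open>p\<close>.
\<close>

definition linear_holonomy :: "(complex \<Rightarrow> real) \<Rightarrow> (real \<Rightarrow> complex) \<Rightarrow> complex \<Rightarrow> complex \<Rightarrow> bool" where
  "linear_holonomy lam \<Gamma> p \<rho> \<longleftrightarrow> norm \<rho> = 1 \<and>
     (\<exists>D. (\<forall>t\<in>{0..1}. local_developing_map lam (\<Gamma> t) (D t)) \<and>
          (\<forall>t\<in>{0..1}. \<exists>\<delta>>0. \<forall>s\<in>{0..1}. \<bar>s - t\<bar> < \<delta> \<longrightarrow>
             eventually (\<lambda>v. D s v = D t v) (nhds (\<Gamma> s))) \<and>
          (\<exists>c. eventually (\<lambda>v. D 1 (v + p) = \<rho> * D 0 v + c) (nhds (\<Gamma> 0))))"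


section \<open>The loops $\gamma_0$, $\gamma_\infty$ and the linear holonomy map\<close>

text \<open>
  The loops are the images of \<open>\<lambda>t. base_point \<epsilon> + t * p\<close> with \<open>p = 1\<close>, resp. \<open>p = \<tau>\<close>. Taken
  literally for all points of the Torelli space they would only depend on the classes of the
  $z_i$ in $E_\tau$, and they would jump over a marked point when some $z_i$ crosses the boundary
  of the fundamental parallelogram. A point of the Torelli space however carries a marking of
  the homology of the punctured torus, and the loops have to vary continuously with the point:
  they are the straight loops if the $z_i$ lie in the fundamental parallelogram spanned by
  $1, \tau$ (and \<open>base_point \<epsilon>\<close> is to the lower left of $0$ with respect to the basis $1, \tau$,
  which means $Re\,\tau < Im\,\tau$), and they are transported along paths in the Torelli space
  otherwise. Since the linear holonomy takes values in a commutative group and since transport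
  around loops of the Torelli space acts trivially on the homology of the punctured torus,
  the choice of the path does not matter.
\<close>

definition base_point :: "real \<Rightarrow> complex" where
  "base_point \<epsilon> = - of_real \<epsilon> * (1 + \<i>)"

definition straight_loop :: "real \<Rightarrow> complex \<Rightarrow> real \<Rightarrow> complex" where
  "straight_loop \<epsilon> p t = base_point \<epsilon> + of_real t * p"

definition normalized_configs :: "'n::finite \<Rightarrow> 'n config set" where
  "normalized_configs o1 = {(\<tau>, z) \<in> torelli o1. Re \<tau> < Im \<tau> \<and>
     (\<forall>i. \<exists>s\<in>{0..<1}. \<exists>t\<in>{0..<1}. z $ i = of_real s + of_real t * \<tau>)}"

text \<open>``Very close to $0$'': the loop can be moved to $0$ without meeting the punctures before.\<close>

definition small_for :: "'n::finite config \<Rightarrow> complex \<Rightarrow> real \<Rightarrow> bool" where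
  "small_for x p \<epsilon> \<longleftrightarrow> \<epsilon> > 0 \<and>
     (\<forall>e\<in>{0<..\<epsilon>}. \<forall>t\<in>{0..1}. straight_loop e p t \<notin> punctures x)"

text \<open>
  The parameter \<open>per\<close> is the period as a function of $\tau$: constantly $1$ for $\gamma_0$ and
  the identity for $\gamma_\infty$. In \<open>marked_loop\<close>, \<open>c\<close> is a path in the Torelli space from a
  normalized configuration to \<open>x\<close>, and \<open>G (s, _)\<close> is a lifted loop in the punctured torus of \<open>c s\<close>.
\<close>

definition marked_loop ::
    "'n::finite \<Rightarrow> (complex \<Rightarrow> complex) \<Rightarrow> 'n config \<Rightarrow> (real \<Rightarrow> complex) \<Rightarrow> bool" where
  "marked_loop o1 per x \<Gamma> \<longleftrightarrow>
     (\<exists>c (G :: real \<times> real \<Rightarrow> complex) \<epsilon>.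
        path c \<and> path_image c \<subseteq> torelli o1 \<and>
        pathstart c \<in> normalized_configs o1 \<and> pathfinish c = x \<and>
        continuous_on ({0..1} \<times> {0..1}) G \<and>
        (\<forall>s\<in>{0..1}. \<forall>t\<in>{0..1}. G (s, t) \<notin> punctures (c s)) \<and>
        (\<forall>s\<in>{0..1}. G (s, 1) = G (s, 0) + per (fst (c s))) \<and>
        small_for (c 0) (per (fst (c 0))) \<epsilon> \<and>
        (\<forall>t\<in>{0..1}. G (0, t) = straight_loop \<epsilon> (per (fst (c 0))) t) \<and>
        (\<forall>t\<in>{0..1}. G (1, t) = \<Gamma> t))"

definition holonomy_along ::
    "real ^ 'n::finite \<Rightarrow> 'n \<Rightarrow> (complex \<Rightarrow> complex) \<Rightarrow> 'n config \<Rightarrow> complex" where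
  "holonomy_along \<alpha> o1 per x =
     (THE \<rho>. \<exists>lam \<Gamma>. flat_cone_metric \<alpha> x lam \<and> marked_loop o1 per x \<Gamma> \<and>
        linear_holonomy lam \<Gamma> (per (fst x)) \<rho>)"

definition holonomy_map :: "real ^ 'n::finite \<Rightarrow> 'n \<Rightarrow> 'n config \<Rightarrow> complex \<times> complex" where
  "holonomy_map \<alpha> o1 x = (holonomy_along \<alpha> o1 (\<lambda>_. 1) x, holonomy_along \<alpha> o1 (\<lambda>\<tau>. \<tau>) x)"


section \<open>Veech's foliation\<close>

text \<open>The foliation is given by its set of leaves.\<close>

definition veech_foliation :: "real ^ 'n::finite \<Rightarrow> 'n \<Rightarrow> 'n config set set" where
  "veech_foliation \<alpha> o1 =
     (\<Union>h. components {x \<in> torelli o1. holonomy_map \<alpha> o1 x = h})"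

definition primitive_first_integral ::
    "('a::topological_space \<Rightarrow> 'b) \<Rightarrow> 'a set \<Rightarrow> 'a set set \<Rightarrow> bool" where
  "primitive_first_integral f M leaves \<longleftrightarrow>
     (\<forall>a\<in>f ` M. connected {x \<in> M. f x = a}) \<and>
     leaves = (\<lambda>a. {x \<in> M. f x = a}) ` (f ` M)"

definition admissible :: "real ^ 'n::finite \<Rightarrow> 'n \<Rightarrow> bool" where
  "admissible \<alpha> o1 \<longleftrightarrow> (\<Sum>i\<in>UNIV. \<alpha> $ i) = 0 \<and> \<alpha> $ o1 \<in> {0<..<1} \<and>
     (\<forall>i. i \<noteq> o1 \<longrightarrow> \<alpha> $ i \<in> {-1<..<0})"

definition same_projective_class :: "real ^ 'n::finite \<Rightarrow> real ^ 'n \<Rightarrow> bool" where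
  "same_projective_class \<alpha> \<beta> \<longleftrightarrow> (\<exists>c::real. c \<noteq> 0 \<and> \<beta> = c *\<^sub>R \<alpha>)"

definition weighted_sum :: "real ^ 'n::finite \<Rightarrow> complex ^ 'n \<Rightarrow> complex" where
  "weighted_sum \<alpha> z = (\<Sum>i\<in>UNIV. of_real (\<alpha> $ i) * z $ i)"

definition a_zero :: "real ^ 'n::finite \<Rightarrow> 'n config \<Rightarrow> real" where
  "a_zero \<alpha> x = - Im (weighted_sum \<alpha> (snd x)) / Im (fst x)"

definition a_infty :: "real ^ 'n::finite \<Rightarrow> 'n config \<Rightarrow> complex" where
  "a_infty \<alpha> x = of_real (a_zero \<alpha> x) * fst x + weighted_sum \<alpha> (snd x)"

text \<open>\<open>a_infty\<close> is a complex expression with real value; the latter is part of the theorem.\<close>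

definition xi :: "real ^ 'n::finite \<Rightarrow> 'n config \<Rightarrow> real \<times> real" where
  "xi \<alpha> x = (a_zero \<alpha> x, Re (a_infty \<alpha> x))"

end

theory Submission
  imports Defs "HOL-Complex_Analysis.Conformal_Mappings"
begin

text \<open>
  Troyanov's metric is explicit: with a theta function \<open>\<theta>\<close> of the lattice it is, up to scaling,
  $|\exp(2 \pi i a_0 u) \prod_i \theta(u - z_i)^{\alpha_i}|^2 |du|^2$, and $a_0$ is forced by periodicity.
  The linear holonomy along a loop is therefore the increment of the logarithm of this multivalued
  function. The quasi-periodicity of \<open>\<theta>\<close> and $\sum_i \alpha_i = 0$ give the holonomies
  $\exp(2 \pi i a_0)$ and $\exp(2 \pi i a_\infty)$, provided that the logarithms of the factors have the
  same winding for all $i$; this is evident for straight loops and is preserved by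
  homotopy. So a level set of the holonomy map is the union of the level sets of \<open>\<xi>\<close> over a coset
  of $Z^2$, and a connected subset of it lies in a single one. In real coordinates
  $z_i = p_i + q_i \tau$ a level set of \<open>\<xi>\<close> is the product of the upper half plane with the complement of
  countably many subspaces of codimension two in an affine space, hence connected.
\<close>

section \<open>Real coordinates with respect to the basis $1, \tau$\<close>

text \<open>\<open>holonomy_along\<close> is a \<open>THE\<close> over all metrics, marked loops and
  continuations, so the formula has to hold for every choice and at least one choice has to exist.
  The first half rests on the uniqueness of the metric up to scaling: near a marked point the
  singular powers cancel in the quotient of two metrics. The second half requires conical charts for
  the theta metric, analytic continuation, and loops that follow a moving configuration; these are
  dragged along by periodic isotopies of the plane. The other obstacle is that the lattice moves
  with \<tau>. In real coordinates every lattice becomes the Gaussian integers, so a homotopy over a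
  path of configurations can be redrawn in the plane of one fixed \<tau>, where one theta function
  and one multiplier serve throughout. The bound \<alpha>_i > -1 enters through the cone charts,
  whose construction integrates v^a with a > -1.\<close>

definition from_coords :: "complex \<Rightarrow> complex \<Rightarrow> complex" where
  "from_coords \<tau> w = of_real (Re w) + of_real (Im w) * \<tau>"

text \<open>The two real coordinates are packed into one complex number. The coordinate lattice is
  then itself an instance of \<open>lattice\<close>, with \<i> in the role of \<tau>, and the
  topology of the plane is kept.\<close>

definition coords :: "complex \<Rightarrow> complex \<Rightarrow> complex" where
  "coords \<tau> u = Complex (Re u - Im u / Im \<tau> * Re \<tau>) (Im u / Im \<tau>)"

lemma coords_from_coords [simp]: "Im \<tau> \<noteq> 0 \<Longrightarrow> coords \<tau> (from_coords \<tau> w) = w"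
  by (simp add: coords_def from_coords_def complex_eq_iff)

lemma from_coords_coords [simp]: "Im \<tau> \<noteq> 0 \<Longrightarrow> from_coords \<tau> (coords \<tau> u) = u"
  by (simp add: coords_def from_coords_def complex_eq_iff)

lemma from_coords_add: "from_coords \<tau> (v + w) = from_coords \<tau> v + from_coords \<tau> w"
  and from_coords_diff: "from_coords \<tau> (v - w) = from_coords \<tau> v - from_coords \<tau> w"
  and from_coords_scaleR: "from_coords \<tau> (r *\<^sub>R w) = r *\<^sub>R from_coords \<tau> w"
  by (simp_all add: from_coords_def algebra_simps complex_eq_iff)

lemma from_coords_sum: "from_coords \<tau> (\<Sum>i\<in>A. f i) = (\<Sum>i\<in>A. from_coords \<tau> (f i))"
  by (simp add: from_coords_def sum.distrib sum_distrib_right)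

lemma coords_add: "coords \<tau> (u + v) = coords \<tau> u + coords \<tau> v"
  and coords_diff: "coords \<tau> (u - v) = coords \<tau> u - coords \<tau> v"
  by (simp_all add: coords_def complex_eq_iff add_divide_distrib diff_divide_distrib algebra_simps)

lemma from_coords_0 [simp]: "from_coords \<tau> 0 = 0"
  and coords_0 [simp]: "coords \<tau> 0 = 0"
  by (simp_all add: from_coords_def coords_def complex_eq_iff)

lemma continuous_on_from_coords [continuous_intros]:
  assumes "continuous_on S f" "continuous_on S g"
  shows "continuous_on S (\<lambda>x. from_coords (f x) (g x))"
  unfolding from_coords_def by (intro continuous_intros assms)

lemma continuous_on_coords [continuous_intros]:
  assumes "continuous_on S f" "continuous_on S g" "\<And>x. x \<in> S \<Longrightarrow> Im (f x) \<noteq> 0"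
  shows "continuous_on S (\<lambda>x. coords (f x) (g x))"
  using assms(3) unfolding coords_def
  by (intro continuous_on_Complex continuous_on_diff continuous_on_mult continuous_on_divide
      continuous_on_Re continuous_on_Im assms(1,2)) auto

abbreviation gauss_ints :: "complex set" where
  "gauss_ints \<equiv> lattice \<i>"

lemma gauss_ints_iff: "w \<in> gauss_ints \<longleftrightarrow> Re w \<in> \<int> \<and> Im w \<in> \<int>"
proof
  assume "Re w \<in> \<int> \<and> Im w \<in> \<int>"
  then obtain a b :: int where "Re w = of_int a" "Im w = of_int b"
    by (auto elim!: Ints_cases)
  then have "w = of_int a + of_int b * \<i>"
    by (simp add: complex_eq_iff)
  then show "w \<in> gauss_ints"
    unfolding lattice_def by blast
qed (auto simp: lattice_def)

lemma lattice_from_coords: "lattice \<tau> = from_coords \<tau> ` gauss_ints"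
  by (force simp: lattice_def from_coords_def)

lemma from_coords_in_lattice_iff [simp]:
  "Im \<tau> \<noteq> 0 \<Longrightarrow> from_coords \<tau> w \<in> lattice \<tau> \<longleftrightarrow> w \<in> gauss_ints"
  unfolding lattice_from_coords[of \<tau>] by (metis coords_from_coords image_iff)

lemma coords_in_gauss_ints_iff: "Im \<tau> \<noteq> 0 \<Longrightarrow> coords \<tau> u \<in> gauss_ints \<longleftrightarrow> u \<in> lattice \<tau>"
  by (metis from_coords_coords from_coords_in_lattice_iff)

lemma lattice_0 [simp]: "0 \<in> lattice \<tau>"
  unfolding lattice_def by (auto intro!: exI[of _ "0::int"])

lemma lattice_add: "u \<in> lattice \<tau> \<Longrightarrow> v \<in> lattice \<tau> \<Longrightarrow> u + v \<in> lattice \<tau>"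
proof -
  assume "u \<in> lattice \<tau>" "v \<in> lattice \<tau>"
  then obtain a b c d :: int where "u = of_int a + of_int b * \<tau>" "v = of_int c + of_int d * \<tau>"
    by (auto simp: lattice_def)
  then have "u + v = of_int (a + c) + of_int (b + d) * \<tau>"
    by (simp add: algebra_simps)
  then show ?thesis
    unfolding lattice_def by blast
qed

lemma lattice_minus: "u \<in> lattice \<tau> \<Longrightarrow> - u \<in> lattice \<tau>"
proof -
  assume "u \<in> lattice \<tau>"
  then obtain a b :: int where "u = of_int a + of_int b * \<tau>"
    by (auto simp: lattice_def)
  then have "- u = of_int (- a) + of_int (- b) * \<tau>"
    by simp
  then show ?thesis
    unfolding lattice_def by blast
qed

lemma lattice_diff: "u \<in> lattice \<tau> \<Longrightarrow> v \<in> lattice \<tau> \<Longrightarrow> u - v \<in> lattice \<tau>"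
  using lattice_add[of u \<tau> "- v"] lattice_minus[of v \<tau>] by simp

lemma lattice_add_cancel: "v \<in> lattice \<tau> \<Longrightarrow> u + v \<in> lattice \<tau> \<longleftrightarrow> u \<in> lattice \<tau>"
  by (metis add_diff_cancel_right' lattice_add lattice_diff)

lemma one_in_lattice [simp]: "1 \<in> lattice \<tau>"
  and tau_in_lattice [simp]: "\<tau> \<in> lattice \<tau>"
  unfolding lattice_def by (force intro: exI[of _ "0::int"] exI[of _ "1::int"])+

lemma countable_gauss_ints: "countable gauss_ints"
proof -
  have "gauss_ints = (\<lambda>(a, b). of_int a + of_int b * \<i>) ` UNIV"
    by (force simp: lattice_def)
  then show ?thesis
    by (metis countableI_type countable_image)
qed

lemma closed_gauss_ints: "closed gauss_ints"
proof -
  have "gauss_ints = Re -` \<int> \<inter> Im -` \<int>"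
    by (auto simp: gauss_ints_iff)
  moreover have "closed (Re -` \<int>)" "closed (Im -` \<int>)"
    by (intro closed_vimage continuous_intros closed_Ints)+
  ultimately show ?thesis
    by auto
qed

lemma punctures_iff: "u \<in> punctures x \<longleftrightarrow> (\<exists>i. u - snd x $ i \<in> lattice (fst x))"
proof -
  have "u = snd x $ i + l \<longleftrightarrow> u - snd x $ i = l" for i l
    by (auto simp: algebra_simps)
  then show ?thesis
    unfolding punctures_def by auto
qed


section \<open>Topology of the Torelli space and of the level sets of \<open>\<xi>\<close>\<close>

definition distinct_mod_gauss :: "complex ^ 'n \<Rightarrow> bool" where
  "distinct_mod_gauss w \<longleftrightarrow> (\<forall>i j. i \<noteq> j \<longrightarrow> w $ i - w $ j \<notin> gauss_ints)"

definition config_of_coords :: "'n::finite config \<Rightarrow> 'n config" where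
  "config_of_coords = (\<lambda>(\<tau>, w). (\<tau>, \<chi> i. from_coords \<tau> (w $ i)))"

lemma continuous_on_config_of_coords: "continuous_on S config_of_coords"
  unfolding config_of_coords_def case_prod_unfold by (intro continuous_intros)

text \<open>In real coordinates the conditions on the marked points no longer mention \<tau>, so the
  Torelli space becomes a product with the upper half plane.\<close>

lemma torelli_eq_image:
  "torelli o1 = config_of_coords ` ({\<tau>. Im \<tau> > 0} \<times> {w. w $ o1 = 0 \<and> distinct_mod_gauss w})"
proof (intro equalityI subsetI)
  fix x assume x: "x \<in> torelli o1"
  obtain \<tau> z where [simp]: "x = (\<tau>, z)" by force
  have \<tau>: "Im \<tau> > 0" and z: "z $ o1 = 0" "\<And>i j. i \<noteq> j \<Longrightarrow> z $ i - z $ j \<notin> lattice \<tau>"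
    using x by (auto simp: torelli_def)
  define w where "w = (\<chi> i. coords \<tau> (z $ i))"
  have "x = config_of_coords (\<tau>, w)"
    using \<tau> by (simp add: config_of_coords_def w_def vec_eq_iff)
  moreover have "w $ o1 = 0" "distinct_mod_gauss w"
    using z \<tau> by (auto simp: distinct_mod_gauss_def w_def coords_in_gauss_ints_iff simp flip: coords_diff)
  ultimately show "x \<in> config_of_coords ` ({\<tau>. Im \<tau> > 0} \<times> {w. w $ o1 = 0 \<and> distinct_mod_gauss w})"
    using \<tau> by auto
qed (auto simp: torelli_def distinct_mod_gauss_def config_of_coords_def simp flip: from_coords_diff)

text \<open>A small perturbation \<open>w + \<zeta> v\<close> of one end point serves as a vertex of a broken line
  avoiding the codimension two conditions: each of them excludes only a line of
  parameters \<open>\<zeta>\<close>, and there are countably many of them.\<close>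

lemma
  fixes A :: "(complex ^ 'n) set" and v :: "'n::finite \<Rightarrow> real"
  assumes A: "convex A" and inv: "\<And>w \<zeta>. w \<in> A \<Longrightarrow> (\<chi> i. w $ i + \<zeta> * of_real (v i)) \<in> A" and v: "inj v"
  shows connected_distinct_mod_gauss: "connected {w \<in> A. distinct_mod_gauss w}"
    and ex_distinct_mod_gauss: "A \<noteq> {} \<Longrightarrow> \<exists>w\<in>A. distinct_mod_gauss w"
proof -
  \<comment> \<open>The parameters \<zeta> for which the segment from \<open>y\<close> to the
    perturbed point \<open>x + \<zeta> v\<close> passes through a point whose entries
    \<open>i\<close> and \<open>j\<close> differ by \<kappa>.\<close>
  define bad :: "complex ^ 'n \<Rightarrow> complex ^ 'n \<Rightarrow> ('n \<times> 'n) \<times> complex \<Rightarrow> complex set"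
    where "bad = (\<lambda>x y ((i, j), \<kappa>). {\<zeta>. \<exists>s\<in>{0..1}. 
      (1 - of_real s) * (y $ i - y $ j) + of_real s * (x $ i - x $ j + \<zeta> * of_real (v i - v j)) = \<kappa>})"
  define J where "J = {(i, j) |i j :: 'n. i \<noteq> j} \<times> gauss_ints"
  have J: "countable J"
    unfolding J_def by (intro countable_SIGMA countable_gauss_ints) auto
  have neg: "negligible (bad x y k)" if y: "distinct_mod_gauss y" and k: "k \<in> J" for x y k
  proof -
    obtain i j \<kappa> where kk: "k = ((i, j), \<kappa>)" and ij: "i \<noteq> j" and \<kappa>: "\<kappa> \<in> gauss_ints"
      using k by (auto simp: J_def)
    define d where "d = \<kappa> - (y $ i - y $ j)"
    define r where "r = v i - v j"
    define e where "e = (x $ i - x $ j) - (y $ i - y $ j)"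
    have d: "d \<noteq> 0" using y ij \<kappa> by (auto simp: d_def distinct_mod_gauss_def)
    have r: "r \<noteq> 0" using v ij by (auto simp: r_def inj_def)
    \<comment> \<open>Along the segment the condition reads s (e + \<zeta> r) = d. Since
      \<open>d\<close> is nonzero, so is s, and e + \<zeta> r must be a real multiple of
      \<open>d\<close>. This confines \<zeta> to a real line, written as the vanishing of Im (cnj d
      (e + \<zeta> r)).\<close>
    have "bad x y k \<subseteq> {\<zeta>. Complex (- Im d) (Re d) \<bullet> \<zeta> = - Im (cnj d * e) / r}"
    proof
      fix \<zeta> assume "\<zeta> \<in> bad x y k"
      then obtain s :: real where "(1 - of_real s) * (y $ i - y $ j) + of_real s * (x $ i - x $ j + \<zeta> * of_real r) = \<kappa>"
        by (auto simp: bad_def kk r_def)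
      then have s: "of_real s * (e + \<zeta> * of_real r) = d"
        by (simp add: d_def e_def algebra_simps)
      have "s \<noteq> 0" using s d by auto
      have "Im (a * (of_real s * b)) = s * Im (a * b)" for a b
        by (simp add: algebra_simps)
      then have "s * Im (cnj d * (e + \<zeta> * of_real r)) = Im (cnj d * d)"
        using s by metis
      then have "Im (cnj d * (e + \<zeta> * of_real r)) = 0"
        using \<open>s \<noteq> 0\<close> by simp
      then show "\<zeta> \<in> {\<zeta>. Complex (- Im d) (Re d) \<bullet> \<zeta> = - Im (cnj d * e) / r}"
        using r by (simp add: inner_complex_def field_simps)
    qed
    moreover have "Complex (- Im d) (Re d) \<noteq> 0"
      using d by (auto simp: complex_eq_iff)
    then have "negligible {\<zeta>. Complex (- Im d) (Re d) \<bullet> \<zeta> = - Im (cnj d * e) / r}"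
      by (intro negligible_hyperplane) auto
    ultimately show ?thesis
      using negligible_subset by blast
  qed
  show "\<exists>w\<in>A. distinct_mod_gauss w" if nonempty: "A \<noteq> {}"
  proof -
    obtain x where x: "x \<in> A" using nonempty by auto
    \<comment> \<open>For each pair of indices and each Gaussian integer exactly one \<zeta> is
      excluded: the linear equation for it has the nonzero coefficient v_i - v_j.\<close>
    define B where "B = (\<lambda>((i, j), \<kappa>). (\<kappa> - (x $ i - x $ j)) / of_real (v i - v j)) ` J"
    have "countable B" unfolding B_def using J by auto
    then obtain \<zeta> where \<zeta>: "\<zeta> \<notin> B"
      using uncountable_UNIV_complex by (metis UNIV_eq_I)
    have "distinct_mod_gauss (\<chi> i. x $ i + \<zeta> * of_real (v i))"
      unfolding distinct_mod_gauss_def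
    proof (intro allI impI notI)
      fix i j :: 'n assume ij: "i \<noteq> j"
        and *: "(\<chi> i. x $ i + \<zeta> * of_real (v i)) $ i - (\<chi> i. x $ i + \<zeta> * of_real (v i)) $ j \<in> gauss_ints"
      have "of_real (v i - v j) \<noteq> (0 :: complex)" using v ij by (auto simp: inj_def)
      then have "\<zeta> = ((x $ i + \<zeta> * of_real (v i)) - (x $ j + \<zeta> * of_real (v j)) - (x $ i - x $ j)) / of_real (v i - v j)"
        by (simp add: field_simps)
      moreover have "((i, j), (x $ i + \<zeta> * of_real (v i)) - (x $ j + \<zeta> * of_real (v j))) \<in> J"
        using ij * by (auto simp: J_def)
      ultimately have "\<zeta> \<in> B" unfolding B_def by (force simp: image_iff)
      with \<zeta> show False by simp
    qed
    then show ?thesis using inv[OF x] by blast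
  qed
  show "connected {w \<in> A. distinct_mod_gauss w}"
  proof (subst connected_iff_connected_component, intro ballI)
    fix x y assume x: "x \<in> {w \<in> A. distinct_mod_gauss w}" and y: "y \<in> {w \<in> A. distinct_mod_gauss w}"
    \<comment> \<open>The broken line runs from \<open>x\<close> to the vertex \<open>m\<close> and
      on to \<open>y\<close>. As \<open>m\<close> is a perturbation of \<open>x\<close>, the first
      piece is controlled by \<open>bad x x\<close> and the second by
      \<open>bad x y\<close>.\<close>
    have "negligible (\<Union>k\<in>J. bad x x k \<union> bad x y k)"
      using x y neg J by (intro negligible_countable_Union countable_image) auto
    then have "(\<Union>k\<in>J. bad x x k \<union> bad x y k) \<noteq> UNIV"
      using non_negligible_UNIV by metis
    then obtain \<zeta> where \<zeta>: "\<And>k. k \<in> J \<Longrightarrow> \<zeta> \<notin> bad x x k" "\<And>k. k \<in> J \<Longrightarrow> \<zeta> \<notin> bad x y k"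
      by blast
    define m where "m = (\<chi> i. x $ i + \<zeta> * of_real (v i))"
    have mA: "m \<in> A" using inv x by (auto simp: m_def)
    have seg: "closed_segment u m \<subseteq> {w \<in> A. distinct_mod_gauss w}"
      if u: "u \<in> A" "\<And>k. k \<in> J \<Longrightarrow> \<zeta> \<notin> bad x u k" for u
    proof
      fix p assume p: "p \<in> closed_segment u m"
      then obtain s where s: "0 \<le> s" "s \<le> 1" "p = (1 - s) *\<^sub>R u + s *\<^sub>R m"
        by (auto simp: closed_segment_def)
      have "p \<in> A" using A u(1) mA p closed_segment_subset by blast
      moreover have "distinct_mod_gauss p"
        unfolding distinct_mod_gauss_def
      proof (intro allI impI notI)
        fix i j :: 'n assume ij: "i \<noteq> j" and *: "p $ i - p $ j \<in> gauss_ints"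
        have "(1 - of_real s) * (u $ i - u $ j) + of_real s * (x $ i - x $ j + \<zeta> * of_real (v i - v j)) = p $ i - p $ j"
          unfolding s(3) m_def vector_add_component vector_scaleR_component
          by (simp add: scaleR_conv_of_real algebra_simps)
        then have "\<zeta> \<in> bad x u ((i, j), p $ i - p $ j)"
          using s by (auto simp: bad_def)
        moreover have "((i, j), p $ i - p $ j) \<in> J" using ij * by (auto simp: J_def)
        ultimately show False using u(2) by blast
      qed
      ultimately show "p \<in> {w \<in> A. distinct_mod_gauss w}" by simp
    qed
    have "connected (closed_segment x m \<union> closed_segment y m)"
      by (intro connected_Un connected_segment) auto
    moreover have "closed_segment x m \<union> closed_segment y m \<subseteq> {w \<in> A. distinct_mod_gauss w}"
      using seg[of x] seg[of y] \<zeta> x y by auto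
    ultimately show "connected_component {w \<in> A. distinct_mod_gauss w} x y"
      unfolding connected_component_def by (metis Un_iff ends_in_segment(1))
  qed
qed

lemma connected_torelli: "connected (torelli o1)"
proof -
  \<comment> \<open>The direction vanishes at \<open>o1\<close>, so that perturbed points still
    satisfy the normalization there.\<close>
  define v :: "'a \<Rightarrow> real" where "v = (\<lambda>i. real (to_nat i) - real (to_nat o1))"
  have "inj v" using inj_to_nat by (auto simp: v_def inj_def)
  moreover have "convex {w :: complex ^ 'a. w $ o1 = 0}"
    by (auto simp: convex_def)
  ultimately have "connected {w \<in> {w :: complex ^ 'a. w $ o1 = 0}. distinct_mod_gauss w}"
    by (intro connected_distinct_mod_gauss[where v = v]) (auto simp: v_def)
  then have "connected ({\<tau>. Im \<tau> > 0} \<times> {w :: complex ^ 'a. w $ o1 = 0 \<and> distinct_mod_gauss w})"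
    by (intro connected_Times convex_connected[OF convex_halfspace_Im_gt]) auto
  then show ?thesis
    unfolding torelli_eq_image by (rule connected_continuous_image[OF continuous_on_config_of_coords])
qed

section \<open>Level sets and image of \<xi>\<close>

lemma weighted_sum_from_coords:
  "weighted_sum \<alpha> (\<chi> i. from_coords \<tau> (w $ i)) = from_coords \<tau> (weighted_sum \<alpha> w)"
  unfolding weighted_sum_def from_coords_sum
  by (intro sum.cong) (simp_all add: from_coords_def algebra_simps)

lemma xi_config_of_coords:
  assumes "Im \<tau> > 0"
  shows "xi \<alpha> (config_of_coords (\<tau>, w)) = (- Im (weighted_sum \<alpha> w), Re (weighted_sum \<alpha> w))"
  using assms
  by (auto simp: xi_def config_of_coords_def a_zero_def a_infty_def weighted_sum_from_coords)
    (auto simp: from_coords_def)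

lemma a_infty_real:
  assumes "Im (fst x) > 0"
  shows "a_infty \<alpha> x \<in> \<real>"
  using assms by (simp add: complex_is_Real_iff a_infty_def a_zero_def)

text \<open>One complex equation fixes both values: its imaginary part determines a_0 because Im
  \<tau> is positive, and its real part is then the value of a_infty.\<close>

lemma xi_eq_iff:
  assumes "Im (fst x) > 0"
  shows "xi \<alpha> x = (a0, ainf) \<longleftrightarrow> of_real a0 * fst x + weighted_sum \<alpha> (snd x) = of_real ainf"
proof -
  have "xi \<alpha> x = (a0, ainf) \<longleftrightarrow>
      a_zero \<alpha> x = a0 \<and> a0 * Re (fst x) + Re (weighted_sum \<alpha> (snd x)) = ainf"
    by (auto simp: xi_def a_infty_def)
  moreover have "a_zero \<alpha> x = a0 \<longleftrightarrow> a0 * Im (fst x) + Im (weighted_sum \<alpha> (snd x)) = 0"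
    unfolding a_zero_def divide_eq_eq using assms by auto
  ultimately show ?thesis
    by (auto simp: complex_eq_iff)
qed

lemma xi_level_eq_image:
  "{x \<in> torelli o1. xi \<alpha> x = (a0, ainf)} = config_of_coords ` ({\<tau>. Im \<tau> > 0} \<times>
     {w \<in> {w. w $ o1 = 0 \<and> weighted_sum \<alpha> w = Complex ainf (- a0)}. distinct_mod_gauss w})"
proof -
  have [simp]: "xi \<alpha> (config_of_coords (\<tau>, w)) = (a0, ainf) \<longleftrightarrow> weighted_sum \<alpha> w = Complex ainf (- a0)"
    if "Im \<tau> > 0" for \<tau> w
    using xi_config_of_coords[OF that, of \<alpha> w] by (auto simp: complex_eq_iff)
  show ?thesis
    unfolding torelli_eq_image by auto
qed

lemma continuous_on_xi: "continuous_on (torelli o1) (xi \<alpha>)"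
  unfolding xi_def a_zero_def a_infty_def weighted_sum_def
  by (intro continuous_intros) (auto simp: torelli_def)

lemma ex_index_neq:
  assumes "CARD('n::finite) \<ge> 2"
  shows "\<exists>j :: 'n. j \<noteq> o1"
  using card_mono[of "{o1}" "UNIV :: 'n set"] assms by auto

lemma sum_split_at:
  fixes o1 :: "'n::finite" and g :: "'n \<Rightarrow> 'b::ab_group_add"
  shows "(\<Sum>i\<in>UNIV. g i) = g o1 + (\<Sum>i\<in>-{o1}. g i)"
  using sum.remove[of UNIV o1 g] by (simp add: Compl_eq_Diff_UNIV)

text \<open>This is the direction of perturbation inside a level set of \<xi>: it preserves the
  normalization and the weighted sum, and injectivity lets it separate all entries. With \<beta>_i =
  -\<alpha>_i/\<alpha>_1, positive numbers of sum 1, one takes distinct reals f_i and subtracts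
  their \<beta>-mean \<open>m\<close>. It remains to arrange that no f_i equals \<open>m\<close>,
  since 0 is already the entry at \<open>o1\<close>.\<close>

lemma ex_generic_direction:
  fixes \<alpha> :: "real ^ 'n::finite"
  assumes n: "CARD('n) \<ge> 3" and \<alpha>: "admissible \<alpha> o1"
  shows "\<exists>v :: 'n \<Rightarrow> real. inj v \<and> v o1 = 0 \<and> (\<Sum>i\<in>UNIV. \<alpha> $ i * v i) = 0"
proof -
  obtain j where j: "j \<noteq> o1" using ex_index_neq[of o1] n by auto
  have "\<not> (UNIV :: 'n set) \<subseteq> {o1, j}"
    using n card_mono[of "{o1, j}" "UNIV :: 'n set"] j by auto
  then obtain k where k: "k \<noteq> o1" "k \<noteq> j" by auto
  define \<beta> where "\<beta> i = - \<alpha> $ i / \<alpha> $ o1" for i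
  have o1: "\<alpha> $ o1 > 0" and neg: "\<And>i. i \<noteq> o1 \<Longrightarrow> \<alpha> $ i < 0" and sum0: "(\<Sum>i\<in>UNIV. \<alpha> $ i) = 0"
    using \<alpha> by (auto simp: admissible_def)
  have \<beta>pos: "\<beta> i > 0" if "i \<noteq> o1" for i
    using neg[OF that] o1 by (simp add: \<beta>_def field_simps)
  have "(\<Sum>i\<in>-{o1}. \<alpha> $ i) = - \<alpha> $ o1"
    using sum0 sum_split_at[of "\<lambda>i. \<alpha> $ i" o1] by simp
  then have \<beta>sum: "(\<Sum>i\<in>-{o1}. \<beta> i) = 1"
    using o1 by (simp add: \<beta>_def sum_negf sum_divide_distrib[symmetric])
  \<comment> \<open>The third index takes a positive share of the total 1. With only two points
    \<open>\<beta> j\<close> would be 1, and the mean would coincide with \<open>f j\<close> for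
    every choice.\<close>
  have \<beta>j: "\<beta> j < 1"
  proof -
    have "\<beta> j + \<beta> k = sum \<beta> {j, k}" using k by simp
    also have "\<dots> \<le> (\<Sum>i\<in>-{o1}. \<beta> i)"
      using j k \<beta>pos by (intro sum_mono2) (auto intro: less_imp_le)
    finally show ?thesis using \<beta>sum \<beta>pos[of k] k by linarith
  qed
  define g where "g i = real (to_nat i)" for i :: 'n
  define S where "S = (\<Sum>i\<in>-{o1, j}. \<beta> i * g i)"
  \<comment> \<open>The three excluded sets correspond to the possible coincidences: T = g_i, f_i =
    m for an index other than \<open>j\<close>, and f_j = m. The last one is a single value of T
    because \<open>\<beta> j\<close> is not 1.\<close>
  obtain T where T: "T \<notin> g ` UNIV \<union> (\<lambda>i. (g i - S) / \<beta> j) ` UNIV \<union> {S / (1 - \<beta> j)}"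
    using ex_new_if_finite[of "g ` UNIV \<union> (\<lambda>i. (g i - S) / \<beta> j) ` UNIV \<union> {S / (1 - \<beta> j)}"]
      infinite_UNIV_char_0 by auto
  define f where "f = g(j := T)"
  define m where "m = \<beta> j * T + S"
  define v where "v = (\<lambda>i. if i = o1 then 0 else f i - m)"
  have injf: "inj f"
  proof (rule injI)
    have "g i = g i' \<Longrightarrow> i = i'" and "g i \<noteq> T" for i i'
      using T inj_to_nat by (auto simp: g_def inj_def)
    then show "i = i'" if "f i = f i'" for i i'
      using that by (metis f_def fun_upd_apply)
  qed
  have fm: "f i \<noteq> m" if "i \<noteq> o1" for i
  proof (cases "i = j")
    case True
    have "T \<noteq> S / (1 - \<beta> j)" using T by auto
    then show ?thesis using True \<beta>j by (simp add: f_def m_def field_simps)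
  next
    case False
    have "T \<noteq> (g i - S) / \<beta> j" using T by auto
    then show ?thesis using False \<beta>pos[OF j] by (simp add: f_def m_def field_simps)
  qed
  have "inj v"
    using injf fm by (auto simp: v_def inj_def split: if_splits)
  moreover have "(\<Sum>i\<in>UNIV. \<alpha> $ i * v i) = 0"
  proof -
    have *: "- {o1} = insert j (- {o1, j})" using j by auto
    have "(\<Sum>i\<in>-{o1}. \<beta> i * f i) = \<beta> j * T + (\<Sum>i\<in>-{o1, j}. \<beta> i * f i)"
      unfolding * by (subst sum.insert) (auto simp: f_def)
    also have "(\<Sum>i\<in>-{o1, j}. \<beta> i * f i) = S"
      unfolding S_def by (intro sum.cong) (auto simp: f_def)
    finally have "(\<Sum>i\<in>-{o1}. \<beta> i * f i) = m" by (simp add: m_def)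
    then have **: "(\<Sum>i\<in>-{o1}. \<beta> i * v i) = 0"
    proof -
      have "(\<Sum>i\<in>-{o1}. \<beta> i * v i) = (\<Sum>i\<in>-{o1}. \<beta> i * f i - \<beta> i * m)"
        by (intro sum.cong) (auto simp: v_def algebra_simps)
      then show ?thesis
        using \<beta>sum \<open>(\<Sum>i\<in>-{o1}. \<beta> i * f i) = m\<close> by (simp add: sum_subtractf sum_distrib_right[symmetric])
    qed
    have "(\<Sum>i\<in>UNIV. \<alpha> $ i * v i) = (\<Sum>i\<in>-{o1}. \<alpha> $ i * v i)"
      by (subst sum_split_at[of _ o1]) (simp add: v_def)
    also have "\<dots> = (\<Sum>i\<in>-{o1}. - \<alpha> $ o1 * (\<beta> i * v i))"
      using o1 by (intro sum.cong) (auto simp: \<beta>_def)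
    also have "\<dots> = - \<alpha> $ o1 * (\<Sum>i\<in>-{o1}. \<beta> i * v i)"
      by (rule sum_distrib_left[symmetric])
    also have "\<dots> = 0" using ** by simp
    finally show ?thesis .
  qed
  ultimately show ?thesis by (auto simp: v_def)
qed

lemma weighted_sum_add_smult:
  "weighted_sum \<alpha> (\<chi> i. w $ i + \<zeta> * of_real (v i)) = weighted_sum \<alpha> w + \<zeta> * of_real (\<Sum>i\<in>UNIV. \<alpha> $ i * v i)"
  by (simp add: weighted_sum_def algebra_simps sum.distrib sum_distrib_left)

lemma weighted_sum_axis: "weighted_sum \<alpha> (axis j c) = of_real (\<alpha> $ j) * c"
proof -
  have "weighted_sum \<alpha> (axis j c) = (\<Sum>i\<in>UNIV. if i = j then of_real (\<alpha> $ j) * c else 0)"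
    unfolding weighted_sum_def by (intro sum.cong) (auto simp: axis_def)
  then show ?thesis by simp
qed

lemma convex_weighted_level:
  "convex {w :: complex ^ 'n::finite. w $ o1 = 0 \<and> weighted_sum \<alpha> w = b}"
proof -
  have lin: "weighted_sum \<alpha> (u *\<^sub>R x + v *\<^sub>R y) = u *\<^sub>R weighted_sum \<alpha> x + v *\<^sub>R weighted_sum \<alpha> y" for u v and x y :: "complex ^ 'n"
    by (simp add: weighted_sum_def scaleR_sum_right sum.distrib algebra_simps)
  show ?thesis
    by (auto simp: convex_def lin simp flip: scaleR_add_left)
qed

lemma UNIV_two:
  assumes "CARD('n::finite) = 2" "j \<noteq> (o1 :: 'n)"
  shows "(UNIV :: 'n set) = {o1, j}"
  using card_subset_eq[of "UNIV :: 'n set" "{o1, j}"] assms by simp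

lemma connected_xi_level:
  fixes \<alpha> :: "real ^ 'n::finite"
  assumes n: "CARD('n) \<ge> 2" and \<alpha>: "admissible \<alpha> o1"
  shows "connected {x \<in> torelli o1. xi \<alpha> x = a}"
proof -
  obtain a0 ainf where a: "a = (a0, ainf)" by force
  define b where "b = Complex ainf (- a0)"
  have "connected {w \<in> {w :: complex ^ 'n. w $ o1 = 0 \<and> weighted_sum \<alpha> w = b}. distinct_mod_gauss w}"
  proof (cases "CARD('n) = 2")
    case False
    then obtain v :: "'n \<Rightarrow> real" where "inj v" "v o1 = 0" "(\<Sum>i\<in>UNIV. \<alpha> $ i * v i) = 0"
      using ex_generic_direction[OF _ \<alpha>] n by fastforce
    then show ?thesis
      by (intro connected_distinct_mod_gauss[where v = v] convex_weighted_level)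
        (auto simp: weighted_sum_add_smult simp flip: of_real_mult of_real_sum)
  next
    case True
    obtain j :: 'n where j: "j \<noteq> o1" using ex_index_neq[of o1] n by auto
    have U: "(UNIV :: 'n set) = {o1, j}" using UNIV_two[OF True j] .
    \<comment> \<open>With two marked points there is no room for a perturbation: the normalization
      and the weighted sum determine the configuration, so the set is empty or a single
      point.\<close>
    have "w = w'" if "w $ o1 = 0" "weighted_sum \<alpha> w = b" "w' $ o1 = 0" "weighted_sum \<alpha> w' = b" for w w' :: "complex ^ 'n"
    proof -
      have "\<alpha> $ j \<noteq> 0" using \<alpha> j by (auto simp: admissible_def)
      moreover have "of_real (\<alpha> $ j) * w $ j = of_real (\<alpha> $ j) * w' $ j"
        using that j by (auto simp: weighted_sum_def U)
      ultimately have "w $ j = w' $ j" by simp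
      moreover have "i = o1 \<or> i = j" for i using U by auto
      ultimately show ?thesis using that(1,3) unfolding vec_eq_iff by metis
    qed
    then have "{w \<in> {w :: complex ^ 'n. w $ o1 = 0 \<and> weighted_sum \<alpha> w = b}. distinct_mod_gauss w} = {} \<or>
      (\<exists>w0. {w \<in> {w :: complex ^ 'n. w $ o1 = 0 \<and> weighted_sum \<alpha> w = b}. distinct_mod_gauss w} = {w0})"
      by blast
    then show ?thesis by (elim disjE exE) (simp_all only: connected_empty connected_sing)
  qed
  then have "connected ({\<tau>. Im \<tau> > 0} \<times>
      {w \<in> {w :: complex ^ 'n. w $ o1 = 0 \<and> weighted_sum \<alpha> w = b}. distinct_mod_gauss w})"
    by (intro connected_Times convex_connected[OF convex_halfspace_Im_gt]) auto
  then show ?thesis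
    unfolding a xi_level_eq_image b_def
    by (rule connected_continuous_image[OF continuous_on_config_of_coords])
qed

lemma in_image_xi_iff:
  "(a0, ainf) \<in> xi \<alpha> ` torelli o1 \<longleftrightarrow>
     (\<exists>w. w $ o1 = 0 \<and> weighted_sum \<alpha> w = Complex ainf (- a0) \<and> distinct_mod_gauss w)"
proof -
  have "(a0, ainf) \<in> xi \<alpha> ` torelli o1 \<longleftrightarrow> {x \<in> torelli o1. xi \<alpha> x = (a0, ainf)} \<noteq> {}"
  proof
    assume "(a0, ainf) \<in> xi \<alpha> ` torelli o1"
    then obtain x where "(a0, ainf) = xi \<alpha> x" "x \<in> torelli o1"
      by (rule imageE)
    then have "x \<in> {x \<in> torelli o1. xi \<alpha> x = (a0, ainf)}"
      by simp
    then show "{x \<in> torelli o1. xi \<alpha> x = (a0, ainf)} \<noteq> {}"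
      by blast
  next
    assume "{x \<in> torelli o1. xi \<alpha> x = (a0, ainf)} \<noteq> {}"
    then obtain x where "x \<in> torelli o1" "xi \<alpha> x = (a0, ainf)"
      by blast
    then show "(a0, ainf) \<in> xi \<alpha> ` torelli o1"
      by (intro rev_image_eqI[of x]) simp_all
  qed
  also have "\<dots> \<longleftrightarrow> (\<exists>w. w $ o1 = 0 \<and> weighted_sum \<alpha> w = Complex ainf (- a0) \<and> distinct_mod_gauss w)"
    unfolding xi_level_eq_image by (auto intro!: exI[of _ \<i>])
  finally show ?thesis .
qed

text \<open>The affine space belonging to the value contains a vector supported at one index
  \<open>j\<close>, because \<alpha>_j is nonzero; moving it in the generic direction makes its
  entries distinct modulo the lattice.\<close>

lemma xi_image_ge_3:
  fixes \<alpha> :: "real ^ 'n::finite"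
  assumes n: "CARD('n) \<ge> 3" and \<alpha>: "admissible \<alpha> o1"
  shows "xi \<alpha> ` torelli o1 = UNIV"
proof -
  have "(a0, ainf) \<in> xi \<alpha> ` torelli o1" for a0 ainf
  proof -
    obtain v :: "'n \<Rightarrow> real" where v: "inj v" "v o1 = 0" "(\<Sum>i\<in>UNIV. \<alpha> $ i * v i) = 0"
      using ex_generic_direction[OF n \<alpha>] by auto
    obtain j where j: "j \<noteq> o1" using ex_index_neq[of o1] n by auto
    define A where "A = {w :: complex ^ 'n. w $ o1 = 0 \<and> weighted_sum \<alpha> w = Complex ainf (- a0)}"
    have "\<alpha> $ j \<noteq> 0" using \<alpha> j by (auto simp: admissible_def)
    then have "axis j (Complex ainf (- a0) / of_real (\<alpha> $ j)) \<in> A"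
      using j by (simp add: A_def weighted_sum_axis) (simp add: axis_def)
    then have "\<exists>w\<in>A. distinct_mod_gauss w"
      using v unfolding A_def
      by (intro ex_distinct_mod_gauss[where v = v] convex_weighted_level)
        (auto simp: weighted_sum_add_smult simp flip: of_real_mult of_real_sum)
    then show ?thesis
      unfolding in_image_xi_iff by (auto simp: A_def)
  qed
  then show ?thesis by auto
qed

lemma xi_image_2:
  fixes \<alpha> :: "real ^ 'n::finite"
  assumes n: "CARD('n) = 2" and \<alpha>: "admissible \<alpha> o1"
  shows "xi \<alpha> ` torelli o1 = UNIV - {(\<alpha> $ o1 * of_int k, \<alpha> $ o1 * of_int l) | k l. True}"
proof -
  obtain j :: 'n where j: "j \<noteq> o1" using ex_index_neq[of o1] n by auto
  have U: "(UNIV :: 'n set) = {o1, j}" using UNIV_two[OF n j] .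
  have o1: "\<alpha> $ o1 > 0" using \<alpha> by (auto simp: admissible_def)
  have \<alpha>j: "\<alpha> $ j = - \<alpha> $ o1" using \<alpha> j by (auto simp: admissible_def U)
  have "(a0, ainf) \<in> xi \<alpha> ` torelli o1 \<longleftrightarrow>
      (a0, ainf) \<notin> {(\<alpha> $ o1 * of_int k, \<alpha> $ o1 * of_int l) | k l. True}" for a0 ainf
  proof -
    define c where "c = Complex (- ainf / \<alpha> $ o1) (a0 / \<alpha> $ o1)"
    have *: "w = axis j c" if "w $ o1 = 0" "weighted_sum \<alpha> w = Complex ainf (- a0)" for w :: "complex ^ 'n"
    proof -
      have "- of_real (\<alpha> $ o1) * w $ j = Complex ainf (- a0)"
        using that j \<alpha>j by (auto simp: weighted_sum_def U)
      then have "w $ j = c"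
        using o1 by (auto simp: c_def complex_eq_iff field_simps)
      have "w $ i = axis j c $ i" for i
      proof -
        have "i = o1 \<or> i = j" using U by auto
        then show ?thesis using that(1) j \<open>w $ j = c\<close> by (auto simp: axis_def)
      qed
      then show ?thesis by (simp add: vec_eq_iff)
    qed
    moreover have "axis j c $ o1 = 0" "weighted_sum \<alpha> (axis j c) = Complex ainf (- a0)"
      using o1 j by (auto simp: weighted_sum_axis \<alpha>j c_def complex_eq_iff) (auto simp: axis_def)
    ultimately have "(a0, ainf) \<in> xi \<alpha> ` torelli o1 \<longleftrightarrow> distinct_mod_gauss (axis j c)"
      unfolding in_image_xi_iff by blast
    also have "\<dots> \<longleftrightarrow> c \<notin> gauss_ints"
    proof -
      have "distinct_mod_gauss (axis j c) \<longleftrightarrow> c \<notin> gauss_ints \<and> - c \<notin> gauss_ints"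
      proof
        assume "distinct_mod_gauss (axis j c)"
        then have "axis j c $ j - axis j c $ o1 \<notin> gauss_ints" "axis j c $ o1 - axis j c $ j \<notin> gauss_ints"
          using j unfolding distinct_mod_gauss_def by metis+
        then show "c \<notin> gauss_ints \<and> - c \<notin> gauss_ints" using j by (simp add: axis_def)
      next
        assume *: "c \<notin> gauss_ints \<and> - c \<notin> gauss_ints"
        show "distinct_mod_gauss (axis j c)"
          unfolding distinct_mod_gauss_def
        proof (intro allI impI)
          fix a b :: 'n assume "a \<noteq> b"
          moreover have "a \<in> {o1, j}" "b \<in> {o1, j}" using U by auto
          ultimately have "a = o1 \<and> b = j \<or> a = j \<and> b = o1" by auto
          then show "axis j c $ a - axis j c $ b \<notin> gauss_ints"
            using * j by (auto simp: axis_def)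
        qed
      qed
      then show ?thesis using lattice_minus by fastforce
    qed
    also have "\<dots> \<longleftrightarrow> (a0, ainf) \<notin> {(\<alpha> $ o1 * of_int k, \<alpha> $ o1 * of_int l) | k l. True}"
    proof -
      have "c \<in> gauss_ints \<longleftrightarrow> a0 / \<alpha> $ o1 \<in> \<int> \<and> ainf / \<alpha> $ o1 \<in> \<int>"
        unfolding gauss_ints_iff using minus_in_Ints_iff by (auto simp: c_def)
      also have "\<dots> \<longleftrightarrow> (\<exists>k l. a0 = \<alpha> $ o1 * of_int k \<and> ainf = \<alpha> $ o1 * of_int l)"
        using o1 by (auto simp: field_simps elim!: Ints_cases)
      finally show ?thesis by auto
    qed
    finally show ?thesis .
  qed
  then show ?thesis by auto
qed


section \<open>A theta function\<close>

text \<open>In closed form (-1)^n q^(n(n+1)/2) / ((1 - q) ... (1 - q^n)). With a power series in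
  place of the product, convergence is a ratio test and the functional equation a recursion of
  coefficients.\<close>

definition euler_coeff :: "complex \<Rightarrow> nat \<Rightarrow> complex" where
  "euler_coeff q n = (\<Prod>k\<in>{1..n}. - (q ^ k / (1 - q ^ k)))"

text \<open>Euler's power series of the product of the factors $1 - q^n X$ for $n \ge 1$.\<close>

definition euler_prod :: "complex \<Rightarrow> complex \<Rightarrow> complex" where
  "euler_prod q X = (\<Sum>n. euler_coeff q n * X ^ n)"

section \<open>Convergence, functional equation and zeros of Euler's series\<close>

lemma one_minus_power_nonzero: "norm (q :: complex) < 1 \<Longrightarrow> n > 0 \<Longrightarrow> 1 - q ^ n \<noteq> 0"
proof
  assume q: "norm q < 1" "n > 0" "1 - q ^ n = 0"
  then have "norm (q ^ n) = 1" by simp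
  moreover have "norm q ^ n < 1" using q by (simp add: power_less_one_iff)
  ultimately show False by (simp add: norm_power)
qed

lemma euler_coeff_Suc:
  assumes "norm q < 1"
  shows "euler_coeff q (Suc n) = euler_coeff q (Suc n) * q ^ Suc n - q ^ Suc n * euler_coeff q n"
proof -
  have "1 - q ^ Suc n \<noteq> 0" using one_minus_power_nonzero[OF assms, of "Suc n"] by blast
  moreover have "euler_coeff q (Suc n) = euler_coeff q n * - (q ^ Suc n / (1 - q ^ Suc n))"
    unfolding euler_coeff_def by simp
  ultimately have "euler_coeff q (Suc n) * (1 - q ^ Suc n) = - (q ^ Suc n * euler_coeff q n)"
    by (simp only: mult.assoc) (simp add: mult.commute del: power_Suc)
  then show ?thesis by (simp add: algebra_simps)
qed

text \<open>Consecutive terms have the quotient -q^(n+1) X / (1 - q^(n+1)), which tends to 0 for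
  every X, so the series is entire.\<close>

lemma summable_euler:
  assumes "norm q < 1"
  shows "summable (\<lambda>n. euler_coeff q n * X ^ n)"
proof -
  have "(\<lambda>n. q ^ n / (1 - q ^ n) * X) \<longlonglongrightarrow> 0 / (1 - 0) * X"
    using assms by (intro tendsto_intros LIMSEQ_power_zero) auto
  then have "(\<lambda>n. q ^ Suc n / (1 - q ^ Suc n) * X) \<longlonglongrightarrow> 0"
    by (intro LIMSEQ_Suc[of "\<lambda>n. q ^ n / (1 - q ^ n) * X"]) simp
  then obtain N where N: "\<And>n. n \<ge> N \<Longrightarrow> norm (q ^ Suc n / (1 - q ^ Suc n) * X) < 1 / 2"
    using LIMSEQ_D[of _ 0 "1/2"] by fastforce
  show ?thesis
  proof (rule summable_ratio_test)
    fix n assume "n \<ge> N"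
    have "euler_coeff q (Suc n) * X ^ Suc n = - (q ^ Suc n / (1 - q ^ Suc n) * X) * (euler_coeff q n * X ^ n)"
      unfolding euler_coeff_def by simp
    then have "norm (euler_coeff q (Suc n) * X ^ Suc n) = norm (q ^ Suc n / (1 - q ^ Suc n) * X) * norm (euler_coeff q n * X ^ n)"
      by (metis norm_minus_cancel norm_mult)
    also have "\<dots> \<le> 1 / 2 * norm (euler_coeff q n * X ^ n)"
      using N[OF \<open>n \<ge> N\<close>] by (intro mult_right_mono) auto
    finally show "norm (euler_coeff q (Suc n) * X ^ Suc n) \<le> 1 / 2 * norm (euler_coeff q n * X ^ n)" .
  qed simp
qed

lemma euler_prod_holomorphic: "norm q < 1 \<Longrightarrow> euler_prod q holomorphic_on A"
  using termdiffs_strong_converges_everywhere[OF summable_euler]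
  unfolding euler_prod_def holomorphic_on_def field_differentiable_def
  using has_field_derivative_at_within by blast

lemma euler_prod_0: "euler_prod q 0 = 1"
  unfolding euler_prod_def by (subst powser_zero) (simp add: euler_coeff_def)

text \<open>Coefficient by coefficient this is \<open>euler_coeff_Suc\<close>. The constant term 1
  is split off first, so that the multiplication by \<open>q * X\<close> lines up with the shifted
  index.\<close>

lemma euler_prod_functional:
  assumes q: "norm q < 1"
  shows "euler_prod q X = (1 - q * X) * euler_prod q (q * X)"
proof -
  let ?c = "euler_coeff q"
  have s: "(\<lambda>n. ?c n * (q * X) ^ n) sums euler_prod q (q * X)"
    unfolding euler_prod_def by (rule summable_sums[OF summable_euler[OF q]])
  have "(\<lambda>n. ?c (Suc n) * (q * X) ^ Suc n) sums (euler_prod q (q * X) - 1)"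
    using s by (subst sums_Suc_iff) (simp add: euler_coeff_def)
  from sums_diff[OF this sums_mult[OF s, of "q * X"]]
  have "(\<lambda>n. ?c (Suc n) * (q * X) ^ Suc n - q * X * (?c n * (q * X) ^ n)) sums
      (euler_prod q (q * X) - 1 - q * X * euler_prod q (q * X))" .
  moreover have "?c (Suc n) * (q * X) ^ Suc n - q * X * (?c n * (q * X) ^ n) = ?c (Suc n) * X ^ Suc n" for n
    by (subst (2) euler_coeff_Suc[OF q]) (simp add: power_mult_distrib algebra_simps)
  ultimately have "(\<lambda>n. ?c (Suc n) * X ^ Suc n) sums (euler_prod q (q * X) - 1 - q * X * euler_prod q (q * X))"
    by simp
  then have "(\<lambda>n. ?c n * X ^ n) sums (euler_prod q (q * X) - q * X * euler_prod q (q * X))"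
    by (subst (asm) sums_Suc_iff) (simp add: euler_coeff_def)
  then show ?thesis
    unfolding euler_prod_def[of q X] by (simp add: sums_iff algebra_simps)
qed

text \<open>If none of the factors 1 - q^n X vanished, the functional equation would carry the zero
  at X to all q^n X. These tend to 0, where the value is 1, against continuity.\<close>

lemma euler_prod_eq_0D:
  assumes q: "norm q < 1" and 0: "euler_prod q X = 0"
  shows "\<exists>n>0. q ^ n * X = 1"
proof (rule ccontr)
  assume *: "\<not> (\<exists>n>0. q ^ n * X = 1)"
  have "euler_prod q (q ^ n * X) = 0" for n
  proof (induction n)
    case (Suc n)
    have "1 - q * (q ^ n * X) \<noteq> 0" using * by (auto simp: algebra_simps dest: spec[of _ "Suc n"])
    then show ?case
      using Suc euler_prod_functional[OF q, of "q ^ n * X"] by (simp add: algebra_simps)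
  qed (use 0 in simp)
  moreover have "(\<lambda>n. euler_prod q (q ^ n * X)) \<longlonglongrightarrow> euler_prod q (0 * X)"
    using q
    by (intro isCont_tendsto_compose[of _ "euler_prod q"] tendsto_intros LIMSEQ_power_zero
        continuous_on_interior[OF holomorphic_on_imp_continuous_on[OF euler_prod_holomorphic[of q UNIV]]]) auto
  ultimately show False
    by (simp add: euler_prod_0 LIMSEQ_const_iff)
qed

text \<open>Jacobi's odd theta function up to a constant and the factor exp (pi \<i> u), as a
  product in X = exp (2 pi \<i> u). In this normalization it is exactly 1-periodic, and only the
  period \<tau> produces a multiplier.\<close>

definition theta :: "complex \<Rightarrow> complex \<Rightarrow> complex" where
  "theta \<tau> u = (1 - exp (2 * pi * \<i> * u)) * euler_prod (exp (2 * pi * \<i> * \<tau>)) (exp (2 * pi * \<i> * u))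
     * euler_prod (exp (2 * pi * \<i> * \<tau>)) (exp (- (2 * pi * \<i> * u)))"

section \<open>Quasi-periods and zeros of the theta function\<close>

lemma norm_nome_less_1: "Im \<tau> > 0 \<Longrightarrow> norm (exp (2 * pi * \<i> * \<tau>)) < 1"
  by (simp add: norm_exp_eq_Re)

lemma theta_holomorphic: "Im \<tau> > 0 \<Longrightarrow> theta \<tau> holomorphic_on A"
  unfolding theta_def
  by (intro holomorphic_intros holomorphic_on_compose_gen[OF _ euler_prod_holomorphic[of _ UNIV], unfolded o_def])
    (auto simp: norm_nome_less_1)

lemma exp_add_2pi_i: "exp (2 * pi * \<i> * (u + 1)) = exp (2 * pi * \<i> * u)"
  by (simp add: distrib_left exp_add exp_two_pi_i)

lemma theta_add_1: "theta \<tau> (u + 1) = theta \<tau> u"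
  by (simp only: theta_def exp_minus exp_add_2pi_i)

text \<open>The translation replaces X by q X. The first factor is absorbed by the second through
  the functional equation, and the third releases the new factor 1 - 1/X = -(1 - X)/X.\<close>

lemma theta_add_tau:
  assumes "Im \<tau> > 0"
  shows "theta \<tau> (u + \<tau>) = - exp (- (2 * pi * \<i> * u)) * theta \<tau> u"
proof -
  define q where "q = exp (2 * pi * \<i> * \<tau>)"
  define X where "X = exp (2 * pi * \<i> * u)"
  have q: "norm q < 1" using norm_nome_less_1[OF assms] by (simp add: q_def)
  have [simp]: "X \<noteq> 0" "q \<noteq> 0" by (simp_all add: X_def q_def)
  have e: "exp (2 * pi * \<i> * (u + \<tau>)) = q * X" by (simp add: q_def X_def algebra_simps exp_add)
  have "theta \<tau> (u + \<tau>) = (1 - q * X) * euler_prod q (q * X) * euler_prod q (inverse (q * X))"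
    by (simp only: theta_def exp_minus e q_def[symmetric])
  also have "(1 - q * X) * euler_prod q (q * X) = euler_prod q X"
    by (simp only: euler_prod_functional[OF q, symmetric])
  also have "euler_prod q (inverse (q * X)) = (1 - inverse X) * euler_prod q (inverse X)"
    by (subst euler_prod_functional[OF q]) (simp add: field_simps)
  also have "euler_prod q X * ((1 - inverse X) * euler_prod q (inverse X)) =
      - inverse X * ((1 - X) * euler_prod q X * euler_prod q (inverse X))"
    by (simp add: field_simps)
  also have "\<dots> = - exp (- (2 * pi * \<i> * u)) * theta \<tau> u"
    by (simp only: theta_def exp_minus q_def X_def)
  finally show ?thesis .
qed

lemma theta_add_lattice_eq_0_iff:
  assumes \<tau>: "Im \<tau> > 0" and l: "l \<in> lattice \<tau>"
  shows "theta \<tau> (u + l) = 0 \<longleftrightarrow> theta \<tau> u = 0"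
proof -
  obtain a b :: int where ab: "l = of_int a + of_int b * \<tau>" using l by (auto simp: lattice_def)
  have 1: "theta \<tau> (v + of_int a) = theta \<tau> v" for v
  proof (induction a rule: int_induct[of _ 0])
    case (step1 i) then show ?case using theta_add_1[of \<tau> "v + of_int i"] by (simp add: algebra_simps)
  next
    case (step2 i) then show ?case using theta_add_1[of \<tau> "v + of_int (i - 1)"] by (simp add: algebra_simps)
  qed simp
  have "theta \<tau> (v + of_int b * \<tau>) = 0 \<longleftrightarrow> theta \<tau> v = 0" for v
  proof (induction b rule: int_induct[of _ 0])
    case (step1 i)
    then show ?case using theta_add_tau[OF \<tau>, of "v + of_int i * \<tau>"] by (simp add: algebra_simps)
  next
    case (step2 i)
    then show ?case using theta_add_tau[OF \<tau>, of "v + of_int (i - 1) * \<tau>"] by (simp add: algebra_simps)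
  qed simp
  from this[of u] 1[of "u + of_int b * \<tau>"] show ?thesis
    by (simp add: ab add.assoc add.commute add.left_commute)
qed

lemma exp_2pi_i_eq_1_iff: "exp (2 * pi * \<i> * u) = 1 \<longleftrightarrow> u \<in> \<int>"
proof
  assume "exp (2 * pi * \<i> * u) = 1"
  then obtain n :: int where "Re (2 * pi * \<i> * u) = 0" "Im (2 * pi * \<i> * u) = of_int (2 * n) * pi"
    by (auto simp: exp_eq_1)
  then have "u = of_int n" by (auto simp: complex_eq_iff)
  then show "u \<in> \<int>" by simp
qed (auto elim!: Ints_cases simp: exp_eq_1)

text \<open>The three factors vanish at X = 1, at q^n X = 1 and at q^n / X = 1 with n > 0
  respectively. Together these are the integral powers of q, that is, the lattice points.\<close>

lemma theta_eq_0_iff: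
  assumes \<tau>: "Im \<tau> > 0"
  shows "theta \<tau> u = 0 \<longleftrightarrow> u \<in> lattice \<tau>"
proof
  assume "u \<in> lattice \<tau>"
  moreover have "theta \<tau> 0 = 0" by (simp add: theta_def)
  ultimately show "theta \<tau> u = 0" using theta_add_lattice_eq_0_iff[OF \<tau>, of u 0] by simp
next
  assume "theta \<tau> u = 0"
  have "\<exists>n :: int. exp (2 * pi * \<i> * (u + of_int n * \<tau>)) = 1"
  proof -
    have ee: "exp (2 * pi * \<i> * \<tau>) ^ n = exp (2 * pi * \<i> * (of_nat n * \<tau>))" for n
      by (simp add: exp_of_nat_mult[symmetric] algebra_simps)
    consider "exp (2 * pi * \<i> * u) = 1" | n where "exp (2 * pi * \<i> * \<tau>) ^ n * exp (2 * pi * \<i> * u) = 1"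
      | n where "exp (2 * pi * \<i> * \<tau>) ^ n * exp (- (2 * pi * \<i> * u)) = 1"
    proof -
      from \<open>theta \<tau> u = 0\<close> consider "exp (2 * pi * \<i> * u) = 1"
        | "euler_prod (exp (2 * pi * \<i> * \<tau>)) (exp (2 * pi * \<i> * u)) = 0"
        | "euler_prod (exp (2 * pi * \<i> * \<tau>)) (exp (- (2 * pi * \<i> * u))) = 0"
        unfolding theta_def mult_eq_0_iff eq_iff_diff_eq_0[of 1, symmetric] by metis
      then show ?thesis
        using that euler_prod_eq_0D[OF norm_nome_less_1[OF \<tau>]] by cases metis+
    qed
    then show ?thesis
    proof cases
      case 1 then show ?thesis by (intro exI[of _ 0]) simp
    next
      case (2 n)
      then show ?thesis
        unfolding ee by (intro exI[of _ "int n"]) (simp add: exp_add[symmetric] algebra_simps)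
    next
      case (3 n)
      then have "exp (2 * pi * \<i> * (of_nat n * \<tau>) + - (2 * pi * \<i> * u)) = 1"
        unfolding ee exp_add .
      then have "inverse (exp (2 * pi * \<i> * (of_nat n * \<tau>) + - (2 * pi * \<i> * u))) = 1"
        by simp
      then show ?thesis
        unfolding exp_minus[symmetric] by (intro exI[of _ "- int n"]) (simp add: algebra_simps)
    qed
  qed
  then obtain n m :: int where "u + of_int n * \<tau> = of_int m"
    unfolding exp_2pi_i_eq_1_iff by (metis Ints_cases)
  then have "u = of_int m + of_int (- n) * \<tau>" by (simp add: algebra_simps)
  then show "u \<in> lattice \<tau>" unfolding lattice_def by blast
qed

text \<open>The zero at the origin is simple, so the exponent of theta in the metric is exactly the
  cone parameter. Indeed 1 - X has a simple zero, and the cofactor has the value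
  \<open>euler_prod q 1\<close> squared, nonzero because no positive power of q is 1.\<close>

lemma deriv_theta_0:
  assumes \<tau>: "Im \<tau> > 0"
  shows "deriv (theta \<tau>) 0 \<noteq> 0"
proof -
  define q where "q = exp (2 * pi * \<i> * \<tau>)"
  have q: "norm q < 1" using norm_nome_less_1[OF \<tau>] by (simp add: q_def)
  define B where "B u = euler_prod q (exp (2 * pi * \<i> * u)) * euler_prod q (exp (- (2 * pi * \<i> * u)))" for u
  have "B holomorphic_on UNIV"
    unfolding B_def
    by (intro holomorphic_intros holomorphic_on_compose_gen[OF _ euler_prod_holomorphic[of _ UNIV], unfolded o_def])
      (auto simp: q)
  then have "(B has_field_derivative deriv B 0) (at 0)"
    by (simp add: holomorphic_derivI)
  then have "((\<lambda>u. (1 - exp (2 * pi * \<i> * u)) * B u) has_field_derivative - (2 * pi * \<i>) * B 0) (at 0)"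
    by (auto intro!: derivative_eq_intros)
  moreover have "theta \<tau> = (\<lambda>u. (1 - exp (2 * pi * \<i> * u)) * B u)"
    by (simp add: theta_def B_def q_def fun_eq_iff mult.assoc)
  moreover have "B 0 \<noteq> 0"
  proof -
    have "euler_prod q 1 \<noteq> 0"
    proof
      assume "euler_prod q 1 = 0"
      then obtain n where "n > 0" "q ^ n * 1 = 1" using euler_prod_eq_0D[OF q] by blast
      then show False using one_minus_power_nonzero[OF q, of n] by simp
    qed
    then show ?thesis by (simp add: B_def)
  qed
  ultimately show ?thesis
    using DERIV_imp_deriv by fastforce
qed

lemma theta_factor_at_0:
  assumes \<tau>: "Im \<tau> > 0"
  obtains \<eta> where "\<eta> holomorphic_on UNIV" "\<And>u. theta \<tau> u = u * \<eta> u"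
    "\<And>u. u = 0 \<or> u \<notin> lattice \<tau> \<Longrightarrow> \<eta> u \<noteq> 0"
proof
  define \<eta> where "\<eta> u = (if u = 0 then deriv (theta \<tau>) 0 else theta \<tau> u / u)" for u
  have 0: "theta \<tau> 0 = 0" by (simp add: theta_eq_0_iff[OF \<tau>])
  show "\<eta> holomorphic_on UNIV"
    using pole_lemma_open[OF theta_holomorphic[OF \<tau>, of UNIV] open_UNIV, of 0]
    by (simp add: \<eta>_def[abs_def] 0 cong: if_cong)
  show "theta \<tau> u = u * \<eta> u" for u by (simp add: \<eta>_def 0)
  show "\<eta> u \<noteq> 0" if "u = 0 \<or> u \<notin> lattice \<tau>" for u
    using that deriv_theta_0[OF \<tau>] by (auto simp: \<eta>_def theta_eq_0_iff[OF \<tau>])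
qed


section \<open>Local normal form of a conical singularity\<close>

text \<open>Integrating $v^a k(v)$ termwise gives $v^{a+1} K(v)$.\<close>

lemma ex_termwise_primitive:
  fixes k :: "complex \<Rightarrow> complex" and a :: real
  assumes a: "a > -1" and k: "k holomorphic_on ball u r" and r: "r > 0"
  obtains K where "K holomorphic_on ball u r" 
    "\<And>v. v \<in> ball u r \<Longrightarrow> of_real (a + 1) * K v + (v - u) * deriv K v = k v"
proof -
  define c where "c n = (deriv ^^ n) k u / fact n" for n
  \<comment> \<open>Integrating c_n v^(a+n) divides by a + n + 1. Since a > -1 these numbers are at
    least a + 1 > 0, which also gives the comparison series.\<close>
  define d where "d n = c n / of_real (a + 1 + of_nat n)" for n
  have c: "(\<lambda>n. c n * h ^ n) sums k (u + h)" if "norm h < r" for h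
    using holomorphic_power_series[OF k, of "u + h"] that by (simp add: c_def dist_norm)
  have d: "summable (\<lambda>n. d n * h ^ n)" if h: "norm h < r" for h
  proof -
    obtain s where s: "norm h < s" "s < r" using dense h by blast
    have "norm (of_real s :: complex) < r" "norm h < norm (of_real s :: complex)"
      using s norm_ge_zero[of h] by (auto simp del: norm_ge_zero)
    then have "summable (\<lambda>n. norm (c n * h ^ n))"
      using powser_insidea[of c "of_real s" h] sums_summable[OF c] by auto
    then have "summable (\<lambda>n. norm (c n * h ^ n) / (a + 1))"
      by (rule summable_divide)
    moreover have "norm (d n * h ^ n) \<le> norm (c n * h ^ n) / (a + 1)" for n
    proof -
      have "norm (complex_of_real (a + 1 + of_nat n)) = a + 1 + of_nat n"
        using a by (simp add: norm_of_real del: of_real_add)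
      then have "norm (d n * h ^ n) = norm (c n * h ^ n) / (a + 1 + of_nat n)"
        unfolding d_def by (simp add: norm_mult norm_divide norm_power del: of_real_add)
      also have "\<dots> \<le> norm (c n * h ^ n) / (a + 1)"
        using a by (intro divide_left_mono mult_pos_pos) auto
      finally show ?thesis .
    qed
    ultimately show ?thesis
      by (metis (no_types, lifting) summable_comparison_test)
  qed
  define g where "g h = (\<Sum>n. d n * h ^ n)" for h
  define g' where "g' h = (\<Sum>n. diffs d n * h ^ n)" for h
  have g: "(g has_field_derivative g' h) (at h)" if "norm h < r" for h
    unfolding g_def g'_def using termdiffs_strong'[of r d h] d that by blast
  have eq: "of_real (a + 1) * g h + h * g' h = k (u + h)" if h: "norm h < r" for h
  proof -
    have "summable (\<lambda>n. diffs d n * h ^ n)"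
      using termdiff_converges[of h r d] d h by auto
    then have "(\<lambda>n. h * (of_nat n * d n * h ^ (n - Suc 0))) sums (h * g' h)"
      unfolding g'_def by (intro sums_mult diffs_equiv)
    moreover have "h * (of_nat n * d n * h ^ (n - Suc 0)) = of_nat n * d n * h ^ n" for n
      by (cases n) auto
    ultimately have "(\<lambda>n. of_nat n * d n * h ^ n) sums (h * g' h)" by simp
    moreover have "(\<lambda>n. of_real (a + 1) * (d n * h ^ n)) sums (of_real (a + 1) * g h)"
      unfolding g_def by (intro sums_mult summable_sums d h)
    ultimately have "(\<lambda>n. of_real (a + 1) * (d n * h ^ n) + of_nat n * d n * h ^ n) sums
        (of_real (a + 1) * g h + h * g' h)"
      by (rule sums_add[rotated])
    moreover have "of_real (a + 1) * (d n * h ^ n) + of_nat n * d n * h ^ n = c n * h ^ n" for n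
    proof -
      have "a + 1 + of_nat n \<noteq> 0" using a by linarith
      then have "complex_of_real (a + 1 + of_nat n) \<noteq> 0" using of_real_eq_0_iff by blast
      then have "of_real (a + 1 + of_nat n) * d n = c n" by (simp add: d_def del: of_real_add)
      then show ?thesis by (simp add: algebra_simps flip: \<open>_ = c n\<close>)
    qed
    ultimately have "(\<lambda>n. c n * h ^ n) sums (of_real (a + 1) * g h + h * g' h)" by simp
    with c[OF h] show ?thesis by (rule sums_unique2[symmetric])
  qed
  define K where "K v = g (v - u)" for v
  have K: "(K has_field_derivative g' (v - u)) (at v)" if "v \<in> ball u r" for v
  proof -
    have "norm (v - u) < r" using that by (simp add: dist_norm norm_minus_commute)
    then have "((\<lambda>v. g (v - u)) has_field_derivative g' (v - u) * 1) (at v)"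
      by (intro DERIV_chain2[where g = "\<lambda>v. v - u"] g) (auto intro!: derivative_eq_intros)
    then show ?thesis by (simp add: K_def[abs_def])
  qed
  show thesis
  proof
    show "K holomorphic_on ball u r"
      using K unfolding holomorphic_on_open[OF open_ball] by blast
    show "of_real (a + 1) * K v + (v - u) * deriv K v = k v" if v: "v \<in> ball u r" for v
      using eq[of "v - u"] v DERIV_imp_deriv[OF K[OF v]]
      by (simp add: K_def dist_norm norm_minus_commute)
  qed
qed

text \<open>The desired coordinate satisfies w^a w' = (v - u)^a k up to modulus. Integration gives
  w^(a+1) = (a+1) (v - u)^(a+1) K with \<open>K\<close> from \<open>ex_termwise_primitive\<close>,
  so w is v - u times a root of (a+1) K. The root is single-valued near \<open>u\<close> because
  K(u) = k(u)/(a+1) is nonzero.\<close>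

lemma conical_singularityI:
  assumes a: "a > -1" and k: "k holomorphic_on ball u r" and r: "r > 0"
    and ku: "k u \<noteq> 0" and lam: "\<And>v. v \<in> ball u r - {u} \<Longrightarrow> lam v = norm (v - u) powr a * norm (k v)"
  shows "conical_singularity a lam u"
proof -
  obtain K where K: "K holomorphic_on ball u r" 
    and eq: "\<And>v. v \<in> ball u r \<Longrightarrow> of_real (a + 1) * K v + (v - u) * deriv K v = k v"
    using ex_termwise_primitive[OF a k r] by blast
  have Ku: "K u \<noteq> 0" using eq[of u] ku r by auto
  have contK: "isCont K u" and u: "u \<in> ball u r"
    using continuous_on_interior[OF holomorphic_on_imp_continuous_on[OF K], of u] r by auto
  obtain e where e: "e > 0" "\<And>v. dist v u < e \<Longrightarrow> K v \<noteq> 0"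
    using continuous_at_avoid[OF contK Ku] by (auto simp: dist_commute)
  define s where "s = min e r"
  have s: "s > 0" "ball u s \<subseteq> ball u r" using e r by (auto simp: s_def)
  have "a + 1 \<noteq> 0" using a by linarith
  then have a1: "of_real (a + 1) \<noteq> (0 :: complex)" using of_real_eq_0_iff by blast
  have "(\<lambda>v. of_real (a + 1) * K v) holomorphic_on ball u s"
    using K s by (intro holomorphic_intros) (auto intro: holomorphic_on_subset)
  moreover have "of_real (a + 1) * K v \<noteq> 0" if "v \<in> ball u s" for v
    using that e(2) a1 by (auto simp: s_def dist_commute)
  ultimately obtain g where g: "g holomorphic_on ball u s"
    and eg: "\<And>v. v \<in> ball u s \<Longrightarrow> exp (g v) = of_real (a + 1) * K v"
    using holomorphic_logarithm_exists[of "ball u s" "\<lambda>v. of_real (a + 1) * K v" u] s by auto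
  define b where "b = 1 / (a + 1)"
  define w where "w v = (v - u) * exp (of_real b * g v)" for v
  have w: "w holomorphic_on ball u s"
    unfolding w_def by (intro holomorphic_intros g)
  have dg: "(g has_field_derivative deriv g v) (at v)" if "v \<in> ball u s" for v
    using g that by (meson holomorphic_derivI open_ball)
  have dK: "exp (g v) * deriv g v = of_real (a + 1) * deriv K v" if v: "v \<in> ball u s" for v
  proof -
    have "((\<lambda>v. exp (g v)) has_field_derivative exp (g v) * deriv g v) (at v)"
      using dg[OF v] by (rule DERIV_fun_exp)
    then have "((\<lambda>v. of_real (a + 1) * K v) has_field_derivative exp (g v) * deriv g v) (at v)"
      by (rule has_field_derivative_transform_within_open[OF _ open_ball v]) (simp add: eg)
    moreover have "((\<lambda>v. of_real (a + 1) * K v) has_field_derivative of_real (a + 1) * deriv K v) (at v)"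
      using K s v by (intro DERIV_cmult) (meson holomorphic_derivI open_ball subsetD)
    ultimately show ?thesis using DERIV_unique by blast
  qed
  have dw: "deriv w v = exp (of_real b * g v) * (1 + (v - u) * (of_real b * deriv g v))"
    if v: "v \<in> ball u s" for v
    unfolding w_def using dg[OF v]
    by (intro DERIV_imp_deriv) (auto intro!: derivative_eq_intros simp: algebra_simps)
  have dw': "deriv w v = exp (of_real b * g v) * exp (- g v) * k v" if v: "v \<in> ball u s" for v
  proof -
    have "exp (g v) * (1 + (v - u) * (of_real b * deriv g v)) =
        exp (g v) + (v - u) * (of_real b * (exp (g v) * deriv g v))"
      by (simp add: algebra_simps)
    also have "\<dots> = of_real (a + 1) * K v + (v - u) * (of_real b * of_real (a + 1)) * deriv K v"
      by (subst dK[OF v], subst eg[OF v]) (simp only: mult.assoc)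
    also have "of_real b * of_real (a + 1) = (1 :: complex)"
      using a1 by (simp add: b_def del: of_real_add)
    also have "of_real (a + 1) * K v + (v - u) * 1 * deriv K v = k v"
      using eq[of v] v s by auto
    finally have "1 + (v - u) * (of_real b * deriv g v) = exp (- g v) * k v"
      by (simp add: exp_minus field_simps)
    then show ?thesis using dw[OF v] by simp
  qed
  have us: "u \<in> ball u s" using s by simp
  have "deriv w u \<noteq> 0" using dw[OF us] by simp
  then obtain t where t: "t > 0" "ball u t \<subseteq> ball u s" "inj_on w (ball u t)"
    using has_complex_derivative_locally_injective[OF w us open_ball] by blast
  have "lam v = norm (w v) powr a * norm (deriv w v)" if v: "v \<in> ball u t - {u}" for v
  proof -
    have vs: "v \<in> ball u s" using v t by auto
    have "norm (w v) powr a = norm (v - u) powr a * exp (a * b * Re (g v))"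
    proof -
      have "exp (b * Re (g v)) powr a = exp (a * b * Re (g v))" by (simp add: powr_def)
      then show ?thesis by (simp add: w_def norm_mult powr_mult norm_exp_eq_Re)
    qed
    moreover have "norm (deriv w v) = exp (b * Re (g v)) * exp (- Re (g v)) * norm (k v)"
      by (simp add: dw'[OF vs] norm_mult norm_exp_eq_Re)
    moreover have "exp (a * b * Re (g v)) * (exp (b * Re (g v)) * exp (- Re (g v))) = 1"
    proof -
      have "a * b + b = 1" using a by (simp add: b_def field_simps)
      then have "a * b * Re (g v) + (b * Re (g v) + - Re (g v)) = 0"
        by (metis add.assoc distrib_right mult_1 add.right_inverse)
      then show ?thesis by (simp only: exp_add[symmetric] exp_zero)
    qed
    moreover have "lam v = norm (v - u) powr a * norm (k v)"
      using lam v vs s by auto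
    ultimately show ?thesis by (simp add: mult.assoc[symmetric])
  qed
  moreover have "w holomorphic_on ball u t" using w t holomorphic_on_subset by blast
  moreover have "w u = 0" by (simp add: w_def)
  ultimately show ?thesis
    unfolding conical_singularity_def using t by blast
qed


section \<open>Holomorphic functions of constant modulus and developing maps\<close>

lemma holomorphic_const_norm_ball:
  assumes f: "f holomorphic_on ball u r" and r: "r > 0"
    and n: "\<And>v. v \<in> ball u r \<Longrightarrow> norm (f v) = M" and v: "v \<in> ball u r"
  shows "f v = f u"
proof -
  have "f constant_on ball u r"
    using r n by (intro maximum_modulus_principle[OF f open_ball _ open_ball order_refl, of u]) auto
  then show ?thesis using r v unfolding constant_on_def by auto
qed

lemma deriv_proportional_if_norm_proportional:
  assumes f: "f holomorphic_on ball u r" and g: "g holomorphic_on ball u r" and r: "r > 0"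
    and n: "\<And>v. v \<in> ball u r \<Longrightarrow> norm (f v) = M * norm (g v)"
    and g0: "\<And>v. v \<in> ball u r \<Longrightarrow> g v \<noteq> 0"
  obtains c where "norm c = M" "\<And>v. v \<in> ball u r \<Longrightarrow> f v = c * g v"
proof
  have h: "(\<lambda>v. f v / g v) holomorphic_on ball u r"
    using f g g0 by (intro holomorphic_intros) auto
  have n': "norm (f v / g v) = M" if "v \<in> ball u r" for v
    using n[OF that] g0[OF that] by (simp add: norm_divide)
  show "f v = f u / g u * g v" if v: "v \<in> ball u r" for v
    using holomorphic_const_norm_ball[OF h r n' v] g0[OF v] by (simp add: field_simps)
  show "norm (f u / g u) = M" using n' r by auto
qed

text \<open>The quotient of the derivatives is holomorphic of modulus 1, hence constant; integrating
  leaves a rotation followed by a translation. This is the source of both continuation and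
  holonomy.\<close>

lemma developing_maps_differ_by_isometry:
  assumes D: "D holomorphic_on ball u r" and E: "E holomorphic_on ball u r" and r: "r > 0"
    and n: "\<And>v. v \<in> ball u r \<Longrightarrow> norm (deriv D v) = norm (deriv E v)"
    and E0: "\<And>v. v \<in> ball u r \<Longrightarrow> deriv E v \<noteq> 0"
  obtains \<rho> c where "norm \<rho> = 1" "\<And>v. v \<in> ball u r \<Longrightarrow> D v = \<rho> * E v + c"
proof -
  obtain \<rho> where \<rho>: "norm \<rho> = 1" "\<And>v. v \<in> ball u r \<Longrightarrow> deriv D v = \<rho> * deriv E v"
    using deriv_proportional_if_norm_proportional[of "deriv D" u r "deriv E" 1]
      holomorphic_deriv[OF D] holomorphic_deriv[OF E] r n E0 by auto
  have "((\<lambda>v. D v - \<rho> * E v) has_field_derivative 0) (at v within ball u r)" if v: "v \<in> ball u r" for v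
  proof -
    have "(D has_field_derivative deriv D v) (at v)" "(E has_field_derivative deriv E v) (at v)"
      using holomorphic_derivI[OF D open_ball v] holomorphic_derivI[OF E open_ball v] by auto
    then have "((\<lambda>v. D v - \<rho> * E v) has_field_derivative deriv D v - \<rho> * deriv E v) (at v)"
      by (intro DERIV_diff DERIV_cmult)
    then show ?thesis using \<rho>(2)[OF v] by (simp add: has_field_derivative_at_within)
  qed
  then obtain c where "\<And>v. v \<in> ball u r \<Longrightarrow> D v - \<rho> * E v = c"
    using has_field_derivative_zero_constant[OF convex_ball, of u r "\<lambda>v. D v - \<rho> * E v"] by blast
  then show thesis using that[of \<rho> c] \<rho>(1) by (metis diff_eq_eq add.commute)
qed

lemma ex_log_family:
  fixes f :: "'i::finite \<Rightarrow> complex \<Rightarrow> complex"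
  assumes f: "\<And>i. f i holomorphic_on UNIV" and u: "\<And>i. f i u \<noteq> 0"
  obtains r l where "r > 0" "\<And>i. l i holomorphic_on ball u r"
    "\<And>i v. v \<in> ball u r \<Longrightarrow> exp (l i v) = f i v"
proof -
  have "open (\<Inter>i. {v. f i v \<noteq> 0})"
    using holomorphic_on_imp_continuous_on[OF f]
    by (intro open_INT finite_UNIV ballI open_Collect_neq) (auto intro: continuous_intros)
  moreover have "u \<in> (\<Inter>i. {v. f i v \<noteq> 0})" using u by auto
  ultimately obtain r where r: "r > 0" "ball u r \<subseteq> (\<Inter>i. {v. f i v \<noteq> 0})"
    using openE by blast
  have "\<exists>l. l holomorphic_on ball u r \<and> (\<forall>v\<in>ball u r. exp (l v) = f i v)" for i
  proof -
    have "f i holomorphic_on ball u r" using holomorphic_on_subset[OF f[of i]] by blast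
    moreover have "f i v \<noteq> 0" if "v \<in> ball u r" for v using r(2) that by auto
    ultimately show ?thesis
      using holomorphic_logarithm_exists[of "ball u r" "f i" u] r(1) convex_ball open_ball
      by (metis centre_in_ball)
  qed
  then show thesis using that r(1) by metis
qed

lemma norm_exp_weighted_sum:
  fixes l :: "'i \<Rightarrow> complex"
  assumes "finite A"
  shows "norm (exp (\<Sum>i\<in>A. of_real (a i) * l i)) = (\<Prod>i\<in>A. norm (exp (l i)) powr a i)"
  using assms
  by (simp add: norm_exp_eq_Re powr_def exp_sum[symmetric])

lemma lattice_periodicI:
  assumes "l \<in> lattice \<tau>" and 1: "\<And>u. f (u + 1) = f u" and 2: "\<And>u. f (u + \<tau>) = f u"
  shows "f (u + l) = f u"
proof -
  obtain a b :: int where ab: "l = of_int a + of_int b * \<tau>" using assms(1) by (auto simp: lattice_def)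
  have a: "f (v + of_int a) = f v" for v
  proof (induction a rule: int_induct[of _ 0])
    case (step1 i) then show ?case using 1[of "v + of_int i"] by (simp add: algebra_simps)
  next
    case (step2 i) then show ?case using 1[of "v + of_int (i - 1)"] by (simp add: algebra_simps)
  qed simp
  have "f (v + of_int b * \<tau>) = f v" for v
  proof (induction b rule: int_induct[of _ 0])
    case (step1 i)
    then show ?case using 2[of "v + of_int i * \<tau>"] by (simp add: algebra_simps)
  next
    case (step2 i)
    then show ?case using 2[of "v + of_int (i - 1) * \<tau>"] by (simp add: algebra_simps)
  qed simp
  from this[of u] a[of "u + of_int b * \<tau>"] show ?thesis
    by (simp add: ab add.assoc add.commute add.left_commute)
qed


section \<open>The flat metric of a weighted configuration\<close>

locale weighted_config =
  fixes \<alpha> :: "real ^ 'n::finite" and \<tau> :: complex and z :: "complex ^ 'n"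
  assumes Im_tau: "Im \<tau> > 0"
    and sum_weights: "(\<Sum>i\<in>UNIV. \<alpha> $ i) = 0"
    and weights_gt: "\<alpha> $ i > -1"
    and distinct_points: "i \<noteq> j \<Longrightarrow> z $ i - z $ j \<notin> lattice \<tau>"
begin

definition slope :: complex where
  "slope = 2 * pi * \<i> * a_zero \<alpha> (\<tau>, z)"

definition theta_metric :: "complex \<Rightarrow> real" where
  "theta_metric u = (\<Prod>i\<in>UNIV. norm (theta \<tau> (u - z $ i)) powr (\<alpha> $ i)) * norm (exp (slope * u))"

abbreviation punct :: "complex set" where
  "punct \<equiv> punctures (\<tau>, z)"

section \<open>The theta metric is a flat cone metric\<close>

lemma theta_nonzero: "u \<notin> punct \<Longrightarrow> theta \<tau> (u - z $ i) \<noteq> 0"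
  by (auto simp: theta_eq_0_iff[OF Im_tau] punctures_iff)

lemma theta_shift_holomorphic: "(\<lambda>u. theta \<tau> (u - z $ i)) holomorphic_on A"
  by (intro holomorphic_on_compose_gen[OF _ theta_holomorphic[OF Im_tau, of UNIV], unfolded o_def] holomorphic_intros) auto

lemma theta_metric_pos: "u \<notin> punct \<Longrightarrow> theta_metric u > 0"
  unfolding theta_metric_def using theta_nonzero by (intro mult_pos_pos prod_pos) auto

lemma closed_punctures: "closed punct"
proof -
  have "punct = (\<Union>i. {u. theta \<tau> (u - z $ i) = 0})"
    by (auto simp: theta_eq_0_iff[OF Im_tau] punctures_iff)
  moreover have "closed {u. theta \<tau> (u - z $ i) = 0}" for i
    using holomorphic_on_imp_continuous_on[OF theta_shift_holomorphic]
    by (intro closed_Collect_eq) (auto intro: continuous_intros)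
  ultimately show ?thesis by (simp add: closed_UN)
qed

lemma punctures_add_lattice: "l \<in> lattice \<tau> \<Longrightarrow> u + l \<in> punct \<longleftrightarrow> u \<in> punct"
proof -
  assume l: "l \<in> lattice \<tau>"
  have "u + l - z $ i = (u - z $ i) + l" for i by (simp add: algebra_simps)
  then have "u + l - z $ i \<in> lattice \<tau> \<longleftrightarrow> u - z $ i \<in> lattice \<tau>" for i
    by (simp only: lattice_add_cancel[OF l])
  then show ?thesis by (simp add: punctures_iff)
qed

text \<open>Under u + \<tau> the theta product gains exp (-2 pi Im (sum of \<alpha>_i z_i)): the
  terms in u cancel because the weights sum to 0. The exponential factor gains the inverse, by the
  choice of a_0. Its rate \<open>slope\<close> is purely imaginary, so the period 1 does not change
  its modulus.\<close>

lemma theta_metric_add_lattice: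
  assumes "l \<in> lattice \<tau>"
  shows "theta_metric (u + l) = theta_metric u"
proof (rule lattice_periodicI[OF assms])
  have "theta \<tau> (u + 1 - z $ i) = theta \<tau> (u - z $ i)" for u i
    using theta_add_1[of \<tau> "u - z $ i"] by (simp add: algebra_simps)
  moreover have "norm (exp (slope * (u + 1))) = norm (exp (slope * u))" for u
    by (simp add: slope_def norm_exp_eq_Re)
  ultimately show "theta_metric (u + 1) = theta_metric u" for u
    by (simp only: theta_metric_def)
next
  fix u
  have "norm (theta \<tau> (u + \<tau> - z $ i)) powr (\<alpha> $ i) =
      exp (2 * pi * (\<alpha> $ i * Im u - \<alpha> $ i * Im (z $ i))) * norm (theta \<tau> (u - z $ i)) powr (\<alpha> $ i)" for i
  proof -
    have "norm (theta \<tau> (u + \<tau> - z $ i)) = exp (2 * pi * (Im u - Im (z $ i))) * norm (theta \<tau> (u - z $ i))"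
      using theta_add_tau[OF Im_tau, of "u - z $ i"]
      by (simp add: norm_mult norm_exp_eq_Re algebra_simps)
    moreover have "exp (2 * pi * (Im u - Im (z $ i))) powr (\<alpha> $ i) = exp (2 * pi * (\<alpha> $ i * Im u - \<alpha> $ i * Im (z $ i)))"
      by (simp add: powr_def algebra_simps)
    ultimately show ?thesis by (simp add: powr_mult)
  qed
  then have "(\<Prod>i\<in>UNIV. norm (theta \<tau> (u + \<tau> - z $ i)) powr (\<alpha> $ i)) =
      exp (\<Sum>i\<in>UNIV. 2 * pi * (\<alpha> $ i * Im u - \<alpha> $ i * Im (z $ i))) *
      (\<Prod>i\<in>UNIV. norm (theta \<tau> (u - z $ i)) powr (\<alpha> $ i))"
    by (simp add: prod.distrib exp_sum)
  moreover have "(\<Sum>i\<in>UNIV. 2 * pi * (\<alpha> $ i * Im u - \<alpha> $ i * Im (z $ i))) = - (2 * pi * Im (weighted_sum \<alpha> z))"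
    using sum_weights
    by (simp add: weighted_sum_def sum_distrib_left[symmetric] sum_subtractf sum_distrib_right[symmetric])
  moreover have "norm (exp (slope * (u + \<tau>))) = exp (2 * pi * Im (weighted_sum \<alpha> z)) * norm (exp (slope * u))"
  proof -
    have slope: "Re (slope * w) = - (2 * pi * (a_zero \<alpha> (\<tau>, z) * Im w))" for w
      by (simp add: slope_def)
    have "a_zero \<alpha> (\<tau>, z) * Im \<tau> = - Im (weighted_sum \<alpha> z)"
      using Im_tau by (simp add: a_zero_def)
    then have "Re (slope * (u + \<tau>)) = 2 * pi * Im (weighted_sum \<alpha> z) + Re (slope * u)"
      unfolding slope by (simp add: algebra_simps)
    then show ?thesis by (simp add: norm_exp_eq_Re exp_add)
  qed
  ultimately show "theta_metric (u + \<tau>) = theta_metric u"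
    by (simp add: theta_metric_def exp_minus field_simps)
qed

text \<open>The logarithms of the factors are kept apart, since along a path each of them is to be
  compared with its own continuation.\<close>

lemma theta_metric_branch:
  assumes u: "u \<notin> punct"
  obtains r l where "r > 0" "ball u r \<inter> punct = {}" "\<And>i. l i holomorphic_on ball u r"
    "\<And>i v. v \<in> ball u r \<Longrightarrow> exp (l i v) = theta \<tau> (v - z $ i)"
    "\<And>v. v \<in> ball u r \<Longrightarrow>
      theta_metric v = norm (exp ((\<Sum>i\<in>UNIV. of_real (\<alpha> $ i) * l i v) + slope * v))"
proof -
  obtain r l where rl: "r > 0" "\<And>i. l i holomorphic_on ball u r"
    "\<And>i v. v \<in> ball u r \<Longrightarrow> exp (l i v) = theta \<tau> (v - z $ i)"
    using ex_log_family[of "\<lambda>i v. theta \<tau> (v - z $ i)" u] theta_shift_holomorphic theta_nonzero[OF u] by metis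
  show thesis
  proof
    show "theta_metric v = norm (exp ((\<Sum>i\<in>UNIV. of_real (\<alpha> $ i) * l i v) + slope * v))" if "v \<in> ball u r" for v
      using rl(3)[OF that] norm_exp_weighted_sum[OF finite_class.finite_UNIV, of "\<lambda>i. \<alpha> $ i" "\<lambda>i. l i v"]
      by (simp add: theta_metric_def exp_add norm_mult)
    have "theta \<tau> (v - z $ i) \<noteq> 0" if "v \<in> ball u r" for v i
      using rl(3)[OF that, of i] by (metis exp_not_eq_zero)
    then show "ball u r \<inter> punct = {}"
      by (auto simp: theta_eq_0_iff[OF Im_tau] punctures_iff)
  qed (use rl in auto)
qed

text \<open>At \<open>z $ i\<close> only the factor of index \<open>i\<close> vanishes, and simply.
  After division by \<open>v - z $ i\<close> all factors have local logarithms, and \<open>k\<close>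
  is the exponential of their weighted sum.\<close>

lemma theta_metric_near_puncture:
  obtains r k where "r > 0" "k holomorphic_on ball (z $ i) r" "\<And>v. v \<in> ball (z $ i) r \<Longrightarrow> k v \<noteq> 0"
    "\<And>v. v \<in> ball (z $ i) r \<Longrightarrow> theta_metric v = norm (v - z $ i) powr (\<alpha> $ i) * norm (k v)"
    "\<And>v. v \<in> ball (z $ i) r - {z $ i} \<Longrightarrow> v \<notin> punct"
proof -
  obtain \<eta> where \<eta>: "\<eta> holomorphic_on UNIV" "\<And>u. theta \<tau> u = u * \<eta> u"
    "\<And>u. u = 0 \<or> u \<notin> lattice \<tau> \<Longrightarrow> \<eta> u \<noteq> 0"
    using theta_factor_at_0[OF Im_tau] by blast
  define f where "f j v = (if j = i then \<eta> (v - z $ i) else theta \<tau> (v - z $ j))" for j v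
  have "(\<lambda>v. \<eta> (v - z $ i)) holomorphic_on UNIV"
    by (intro holomorphic_on_compose_gen[OF _ \<eta>(1), unfolded o_def] holomorphic_intros) auto
  then have "f j holomorphic_on UNIV" for j
    using theta_shift_holomorphic[of j UNIV] by (cases "j = i") (simp_all add: f_def[abs_def])
  moreover have "f j (z $ i) \<noteq> 0" for j
    using \<eta>(3)[of 0] distinct_points[of i j] by (auto simp: f_def theta_eq_0_iff[OF Im_tau])
  ultimately obtain r l where rl: "r > 0" "\<And>j. l j holomorphic_on ball (z $ i) r"
    "\<And>j v. v \<in> ball (z $ i) r \<Longrightarrow> exp (l j v) = f j v"
    using ex_log_family[of f "z $ i"] by metis
  define k where "k v = exp ((\<Sum>j\<in>UNIV. of_real (\<alpha> $ j) * l j v) + slope * v)" for v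
  show thesis
  proof
    show "k holomorphic_on ball (z $ i) r"
      unfolding k_def by (intro holomorphic_intros rl)
    show "theta_metric v = norm (v - z $ i) powr (\<alpha> $ i) * norm (k v)" if v: "v \<in> ball (z $ i) r" for v
    proof -
      have "norm (k v) = (\<Prod>j\<in>UNIV. norm (f j v) powr (\<alpha> $ j)) * norm (exp (slope * v))"
        using rl(3)[OF v] norm_exp_weighted_sum[OF finite_class.finite_UNIV, of "\<lambda>j. \<alpha> $ j" "\<lambda>j. l j v"]
        by (simp add: k_def exp_add norm_mult)
      moreover have "(\<Prod>j\<in>UNIV. norm (theta \<tau> (v - z $ j)) powr (\<alpha> $ j)) =
          norm (v - z $ i) powr (\<alpha> $ i) * (\<Prod>j\<in>UNIV. norm (f j v) powr (\<alpha> $ j))"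
      proof -
        have "(\<Prod>j\<in>UNIV. norm (f j v) powr (\<alpha> $ j)) = norm (f i v) powr (\<alpha> $ i) * (\<Prod>j\<in>UNIV-{i}. norm (f j v) powr (\<alpha> $ j))"
          by (rule prod.remove) auto
        moreover have "(\<Prod>j\<in>UNIV. norm (theta \<tau> (v - z $ j)) powr (\<alpha> $ j)) = norm (theta \<tau> (v - z $ i)) powr (\<alpha> $ i) *
            (\<Prod>j\<in>UNIV-{i}. norm (theta \<tau> (v - z $ j)) powr (\<alpha> $ j))"
          by (rule prod.remove) auto
        moreover have "(\<Prod>j\<in>UNIV-{i}. norm (theta \<tau> (v - z $ j)) powr (\<alpha> $ j)) = (\<Prod>j\<in>UNIV-{i}. norm (f j v) powr (\<alpha> $ j))"
          by (intro prod.cong) (auto simp: f_def)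
        moreover have "norm (theta \<tau> (v - z $ i)) powr (\<alpha> $ i) =
            norm (v - z $ i) powr (\<alpha> $ i) * norm (f i v) powr (\<alpha> $ i)"
          unfolding \<eta>(2) by (simp add: f_def norm_mult powr_mult)
        ultimately show ?thesis by (simp only: mult.assoc)
      qed
      ultimately show ?thesis by (simp add: theta_metric_def)
    qed
    show "v \<notin> punct" if v: "v \<in> ball (z $ i) r - {z $ i}" for v
    proof -
      have "theta \<tau> (v - z $ j) \<noteq> 0" for j
      proof -
        have "f j v \<noteq> 0" using rl(3)[of v j] v by (metis DiffD1 exp_not_eq_zero)
        then show ?thesis using v \<eta>(2)[of "v - z $ i"] by (auto simp: f_def split: if_splits)
      qed
      then show ?thesis by (auto simp: theta_eq_0_iff[OF Im_tau] punctures_iff)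
    qed
  qed (use rl in \<open>auto simp: k_def\<close>)
qed

lemma flat_cone_metric_theta_metric: "flat_cone_metric \<alpha> (\<tau>, z) theta_metric"
  unfolding flat_cone_metric_def
proof (intro conjI allI impI)
  fix u assume u: "u \<notin> punct"
  show "theta_metric u > 0" using theta_metric_pos[OF u] .
  show "\<forall>l\<in>lattice (fst (\<tau>, z)). theta_metric (u + l) = theta_metric u"
    using theta_metric_add_lattice by auto
  obtain r l where rl: "r > 0" "\<And>i. l i holomorphic_on ball u r"
    "\<And>v. v \<in> ball u r \<Longrightarrow> theta_metric v = norm (exp ((\<Sum>i\<in>UNIV. of_real (\<alpha> $ i) * l i v) + slope * v))"
    using theta_metric_branch[OF u] by metis
  define F where "F v = exp ((\<Sum>i\<in>UNIV. of_real (\<alpha> $ i) * l i v) + slope * v)" for v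
  have "F holomorphic_on ball u r" unfolding F_def by (intro holomorphic_intros rl)
  then obtain D where "\<And>v. v \<in> ball u r \<Longrightarrow> (D has_field_derivative F v) (at v within ball u r)"
    using holomorphic_convex_primitive'[OF convex_ball open_ball] by blast
  then have D: "\<And>v. v \<in> ball u r \<Longrightarrow> (D has_field_derivative F v) (at v)"
    by (simp add: at_within_open[OF _ open_ball])
  then have "D holomorphic_on ball u r" unfolding holomorphic_on_open[OF open_ball] by blast
  moreover have "theta_metric v = norm (deriv D v)" if "v \<in> ball u r" for v
    using rl(3)[OF that] DERIV_imp_deriv[OF D[OF that]] by (simp add: F_def)
  ultimately show "\<exists>D. local_developing_map theta_metric u D"
    unfolding local_developing_map_def using rl(1) by blast
next
  fix i
  obtain r k where rk: "r > 0" "k holomorphic_on ball (z $ i) r" "\<And>v. v \<in> ball (z $ i) r \<Longrightarrow> k v \<noteq> 0"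
    "\<And>v. v \<in> ball (z $ i) r \<Longrightarrow> theta_metric v = norm (v - z $ i) powr (\<alpha> $ i) * norm (k v)"
    using theta_metric_near_puncture[of i] by metis
  then have "conical_singularity (\<alpha> $ i) theta_metric (z $ i)"
    by (intro conical_singularityI[OF weights_gt rk(2,1)]) auto
  then show "conical_singularity (\<alpha> $ i) theta_metric (snd (\<tau>, z) $ i)" by simp
qed

section \<open>Uniqueness of the flat metric up to scaling\<close>

lemma flat_cone_metric_add_lattice:
  assumes "flat_cone_metric \<alpha> (\<tau>, z) lam" "u \<notin> punct" "l \<in> lattice \<tau>"
  shows "lam (u + l) = lam u"
  using assms by (simp add: flat_cone_metric_def)

lemma flat_cone_metric_pos:
  assumes "flat_cone_metric \<alpha> (\<tau>, z) lam" "u \<notin> punct"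
  shows "lam u > 0"
  using assms by (simp add: flat_cone_metric_def)

text \<open>Away from the punctures both metrics are moduli of nonvanishing holomorphic functions.
  At a puncture both contain the same power of |v - z_i|, which cancels, so the quotient extends
  holomorphically across it; this is what makes the maximum principle available on the whole
  torus.\<close>

lemma metric_ratio_local:
  assumes lam: "flat_cone_metric \<alpha> (\<tau>, z) lam"
  shows "\<exists>r>0. \<exists>K. K holomorphic_on ball u r \<and> (\<forall>v\<in>ball u r - {u}. v \<notin> punct) \<and>
      (\<forall>v\<in>ball u r - punct. lam v = norm (K v) * theta_metric v)"
proof (cases "u \<in> punct")
  case False
  obtain r l where rl: "r > 0" "ball u r \<inter> punct = {}" "\<And>i. l i holomorphic_on ball u r"
    "\<And>i v. v \<in> ball u r \<Longrightarrow> exp (l i v) = theta \<tau> (v - z $ i)"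
    "\<And>v. v \<in> ball u r \<Longrightarrow> theta_metric v = norm (exp ((\<Sum>i\<in>UNIV. of_real (\<alpha> $ i) * l i v) + slope * v))"
    by (rule theta_metric_branch[OF False]) (rule that)
  define F where "F v = exp ((\<Sum>i\<in>UNIV. of_real (\<alpha> $ i) * l i v) + slope * v)" for v
  obtain D s where D: "s > 0" "D holomorphic_on ball u s" "\<And>v. v \<in> ball u s \<Longrightarrow> lam v = norm (deriv D v)"
    using lam False unfolding flat_cone_metric_def local_developing_map_def by blast
  define t where "t = min r s"
  have sub: "ball u t \<subseteq> ball u r" "ball u t \<subseteq> ball u s" by (auto simp: t_def)
  have "F holomorphic_on ball u t"
    unfolding F_def by (intro holomorphic_intros holomorphic_on_subset[OF rl(3) sub(1)])
  with holomorphic_on_subset[OF holomorphic_deriv[OF D(2) open_ball] sub(2)]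
  have "(\<lambda>v. deriv D v / F v) holomorphic_on ball u t"
    by (rule holomorphic_on_divide) (simp add: F_def)
  moreover have "lam v = norm (deriv D v / F v) * theta_metric v" if v: "v \<in> ball u t" for v
  proof -
    have "theta_metric v = norm (F v)" using rl(5)[of v] v sub by (auto simp: F_def)
    moreover have "F v \<noteq> 0" by (simp add: F_def)
    ultimately show ?thesis using D(3)[of v] v sub by (auto simp: norm_divide)
  qed
  moreover have "t > 0" using rl D by (simp add: t_def)
  ultimately show ?thesis using rl(2) sub(1) by (intro exI[of _ t] conjI exI[of _ "\<lambda>v. deriv D v / F v"]) auto
next
  case True
  then obtain i l where i: "u = z $ i + l" and l: "l \<in> lattice \<tau>"
    by (auto simp: punctures_def)
  obtain r k where rk: "r > 0" "k holomorphic_on ball (z $ i) r" "\<And>v. v \<in> ball (z $ i) r \<Longrightarrow> k v \<noteq> 0"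
    "\<And>v. v \<in> ball (z $ i) r \<Longrightarrow> theta_metric v = norm (v - z $ i) powr (\<alpha> $ i) * norm (k v)"
    "\<And>v. v \<in> ball (z $ i) r - {z $ i} \<Longrightarrow> v \<notin> punct"
    using theta_metric_near_puncture[of i] by metis
  have "conical_singularity (\<alpha> $ i) lam (z $ i)"
    using lam by (simp add: flat_cone_metric_def)
  then obtain w s where w: "s > 0" "w holomorphic_on ball (z $ i) s" "inj_on w (ball (z $ i) s)" "w (z $ i) = 0"
    "\<And>v. v \<in> ball (z $ i) s - {z $ i} \<Longrightarrow> lam v = norm (w v) powr (\<alpha> $ i) * norm (deriv w v)"
    unfolding conical_singularity_def by blast
  \<comment> \<open>\<open>m\<close> is \<open>w\<close> with its zero divided out. Injectivity of
    \<open>w\<close> excludes further zeros and makes the derivative at the centre nonzero, so a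
    power of \<open>m\<close> has a holomorphic branch.\<close>
  define m where "m v = (if v = z $ i then deriv w (z $ i) else w v / (v - z $ i))" for v
  have m: "m holomorphic_on ball (z $ i) s"
    using pole_lemma_open[OF w(2) open_ball, of "z $ i"] by (simp add: m_def[abs_def] w(4) cong: if_cong)
  have wm: "w v = (v - z $ i) * m v" for v by (simp add: m_def w(4))
  have m0: "m v \<noteq> 0" if v: "v \<in> ball (z $ i) s" for v
  proof (cases "v = z $ i")
    case True
    then show ?thesis
      using holomorphic_injective_imp_regular[OF w(2) open_ball w(3)] v by (simp add: m_def)
  next
    case False
    then have "w v \<noteq> w (z $ i)" using w(3) v w(1) by (auto dest: inj_onD)
    then show ?thesis using w(4) wm by auto
  qed
  obtain g where g: "g holomorphic_on ball (z $ i) s" "\<And>v. v \<in> ball (z $ i) s \<Longrightarrow> exp (g v) = m v"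
    using holomorphic_logarithm_exists[OF convex_ball open_ball m m0, of "z $ i"] w(1) by auto
  define K where "K v = exp (of_real (\<alpha> $ i) * g v) * deriv w v / k v" for v
  define t where "t = min r s"
  have sub: "ball (z $ i) t \<subseteq> ball (z $ i) r" "ball (z $ i) t \<subseteq> ball (z $ i) s" by (auto simp: t_def)
  have K: "K holomorphic_on ball (z $ i) t"
    unfolding K_def
  proof (intro holomorphic_on_divide holomorphic_on_mult)
    show "(\<lambda>v. exp (of_real (\<alpha> $ i) * g v)) holomorphic_on ball (z $ i) t"
      using holomorphic_on_subset[OF g(1) sub(2)] by (intro holomorphic_intros)
    show "deriv w holomorphic_on ball (z $ i) t"
      by (rule holomorphic_on_subset[OF holomorphic_deriv[OF w(2) open_ball] sub(2)])
    show "k holomorphic_on ball (z $ i) t"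
      by (rule holomorphic_on_subset[OF rk(2) sub(1)])
  qed (use rk(3) sub(1) in auto)
  have lamK: "lam v = norm (K v) * theta_metric v" if v: "v \<in> ball (z $ i) t - {z $ i}" for v
  proof -
    have vr: "v \<in> ball (z $ i) r" and vs: "v \<in> ball (z $ i) s - {z $ i}" using v sub by auto
    have "norm (exp (of_real (\<alpha> $ i) * g v)) = norm (m v) powr (\<alpha> $ i)"
      using g(2)[of v] vs by (simp add: norm_exp_eq_Re powr_def flip: g(2))
    then show ?thesis
      using rk(3)[OF vr] w(5)[OF vs]
      by (simp add: rk(4)[OF vr] K_def norm_mult norm_divide wm powr_mult)
  qed
  \<comment> \<open>The comparison was made at the marked point itself; periodicity of both metrics
    carries it to the translate \<open>u\<close>.\<close>
  have shift: "v - l \<in> ball (z $ i) t \<longleftrightarrow> v \<in> ball u t" "v - l = z $ i \<longleftrightarrow> v = u" for v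
    by (auto simp: i dist_norm algebra_simps)
  have "v \<notin> punct" if "v \<in> ball u t - {u}" for v
  proof -
    have "v - l \<notin> punct" using that shift[of v] rk(5)[of "v - l"] sub by auto
    then show ?thesis using punctures_add_lattice[OF l, of "v - l"] by simp
  qed
  moreover have "lam v = norm (K (v - l)) * theta_metric v" if v: "v \<in> ball u t - punct" for v
  proof -
    have "v \<noteq> u" using True v by auto
    then have "lam (v - l) = norm (K (v - l)) * theta_metric (v - l)"
      using v shift[of v] by (intro lamK) auto
    moreover have "lam (v - l + l) = lam (v - l)"
      using v punctures_add_lattice[OF l, of "v - l"] by (intro flat_cone_metric_add_lattice[OF lam _ l]) simp
    moreover have "theta_metric (v - l + l) = theta_metric (v - l)"
      by (rule theta_metric_add_lattice[OF l])
    ultimately show ?thesis by simp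
  qed
  moreover have "(\<lambda>v. K (v - l)) holomorphic_on ball u t"
    using shift by (intro holomorphic_on_compose_gen[OF _ K, unfolded o_def] holomorphic_intros) auto
  moreover have "t > 0" using rk w by (simp add: t_def)
  ultimately show ?thesis by (intro exI[of _ t] conjI exI[of _ "\<lambda>v. K (v - l)"]) auto
qed

lemma ex_lattice_reduction: "\<exists>l\<in>lattice \<tau>. u + l \<in> from_coords \<tau> ` cbox 0 (Complex 1 1)"
proof -
  define w where "w = coords \<tau> u"
  define g where "g = Complex (- of_int \<lfloor>Re w\<rfloor>) (- of_int \<lfloor>Im w\<rfloor>)"
  have "g \<in> gauss_ints" by (simp add: g_def gauss_ints_iff)
  then have "from_coords \<tau> g \<in> lattice \<tau>" using Im_tau by simp
  moreover have "w + g \<in> cbox 0 (Complex 1 1)"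
    by (simp add: g_def cbox_def Basis_complex_def inner_complex_def) linarith
  moreover have "u + from_coords \<tau> g = from_coords \<tau> (w + g)"
    using Im_tau by (simp add: w_def from_coords_add)
  ultimately show ?thesis by (metis image_eqI)
qed

text \<open>The quotient of two metrics is locally the modulus of a holomorphic function, also at the
  marked points, and it attains its maximum on the torus.\<close>

lemma flat_cone_metric_unique:
  assumes lam: "flat_cone_metric \<alpha> (\<tau>, z) lam"
  obtains M where "M > 0" "\<And>u. u \<notin> punct \<Longrightarrow> lam u = M * theta_metric u"
proof -
  obtain r K where r: "\<And>u. r u > 0" and K: "\<And>u. K u holomorphic_on ball u (r u)"
    and np: "\<And>u v. v \<in> ball u (r u) - {u} \<Longrightarrow> v \<notin> punct"
    and eq: "\<And>u v. v \<in> ball u (r u) - punct \<Longrightarrow> lam v = norm (K u v) * theta_metric v"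
    using metric_ratio_local[OF lam] by metis
  define R where "R u = norm (K u u)" for u
  have lamR: "lam u = R u * theta_metric u" if "u \<notin> punct" for u
    using eq[of u u] r[of u] that by (simp add: R_def)
  have RK: "R v = norm (K u v)" if v: "v \<in> ball u (r u)" for u v
  proof (cases "v = u")
    case False
    then have "v \<notin> punct" using np v by blast
    then show ?thesis using eq[of v u] lamR[of v] v theta_metric_pos[of v] by auto
  qed (simp add: R_def)
  have contR: "isCont R u" for u
  proof -
    have "continuous_on (ball u (r u)) (\<lambda>v. norm (K u v))"
      by (intro continuous_intros holomorphic_on_imp_continuous_on K)
    then have "continuous_on (ball u (r u)) R"
      by (rule continuous_on_eq) (simp add: RK)
    then show ?thesis using r[of u] by (simp add: continuous_on_eq_continuous_at)
  qed
  then have contR': "continuous_on A R" for A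
    by (simp add: continuous_at_imp_continuous_on)
  \<comment> \<open>The metrics are known to be periodic only off the punctures. Punctures are
    isolated and \<open>R\<close> is continuous, so its periodicity holds at every point.\<close>
  have per: "R (u + l) = R u" if l: "l \<in> lattice \<tau>" for u l
  proof (rule tendsto_unique)
    show "(R \<longlongrightarrow> R u) (at u)" using contR isCont_def by blast
    have "((\<lambda>v. R (v + l)) \<longlongrightarrow> R (u + l)) (at u)"
      by (intro isCont_tendsto_compose[OF contR] tendsto_intros)
    moreover have "\<forall>\<^sub>F v in at u. R (v + l) = R v"
      unfolding eventually_at
    proof (intro exI conjI ballI impI)
      show "r u > 0" by (rule r)
      fix v assume v: "v \<noteq> u \<and> dist v u < r u"
      then have vp: "v \<notin> punct" using np[of v u] by (simp add: dist_commute)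
      then have "v + l \<notin> punct" using punctures_add_lattice[OF l] by simp
      then have "R (v + l) * theta_metric (v + l) = lam (v + l)" by (simp add: lamR)
      also have "lam (v + l) = lam v" by (rule flat_cone_metric_add_lattice[OF lam vp l])
      also have "lam v = R v * theta_metric v" using vp by (simp add: lamR)
      finally show "R (v + l) = R v"
        using theta_metric_add_lattice[OF l] theta_metric_pos[OF vp] by simp
    qed
    ultimately show "(R \<longlongrightarrow> R (u + l)) (at u)"
      by (simp cong: tendsto_cong)
  qed simp
  define C where "C = from_coords \<tau> ` cbox 0 (Complex 1 1)"
  have C: "compact C" unfolding C_def by (intro compact_continuous_image continuous_intros) auto
  have C': "C \<noteq> {}" unfolding C_def by (auto simp: cbox_def Basis_complex_def inner_complex_def intro: exI[of _ 0])
  obtain u1 where u1: "u1 \<in> C" "\<And>v. v \<in> C \<Longrightarrow> R v \<le> R u1"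
    using continuous_attains_sup[OF C C' contR'] by blast
  have max: "R v \<le> R u1" for v
  proof -
    obtain l where "l \<in> lattice \<tau>" "v + l \<in> C"
      using ex_lattice_reduction[of v] unfolding C_def by blast
    then show ?thesis using u1(2)[of "v + l"] per[of l v] by simp
  qed
  \<comment> \<open>The maximum modulus principle makes the set of maximum points open, continuity
    makes it closed, and the plane is connected.\<close>
  have "open {u. R u = R u1}"
    unfolding open_contains_ball
  proof (intro ballI exI conjI subsetI)
    fix u v assume u: "u \<in> {u. R u = R u1}" and v: "v \<in> ball u (r u)"
    have "norm (K u v) \<le> norm (K u u)" if "v \<in> ball u (r u)" for v
      using RK[OF that] max[of v] u by (simp add: R_def)
    then have "K u constant_on ball u (r u)"
      using r[of u] by (intro maximum_modulus_principle[OF K open_ball _ open_ball order_refl, of u]) auto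
    then have "K u v = K u u" using v r[of u] unfolding constant_on_def by auto
    then show "v \<in> {u. R u = R u1}" using RK[OF v] u by (simp add: R_def)
  qed (rule r)
  moreover have "closed {u. R u = R u1}"
    using contR' by (intro closed_Collect_eq continuous_intros)
  ultimately have "{u. R u = R u1} = UNIV"
    using clopen[of "{u. R u = R u1}"] by auto
  then have R: "R u = R u1" for u by auto
  have eqR: "lam u = R u1 * theta_metric u" if "u \<notin> punct" for u
    using lamR[OF that] R by simp
  \<comment> \<open>\<open>u1\<close> may be a puncture, where the metrics say nothing; a nearby
    point is not one, and there both metrics are positive.\<close>
  obtain v where v: "v \<in> ball u1 (r u1)" "v \<noteq> u1"
    using r[of u1] that[of "u1 + of_real (r u1 / 2)"] by (auto simp: dist_norm)
  then have "v \<notin> punct" using np by blast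
  then have "R u1 > 0"
    using lam eqR[of v] theta_metric_pos[of v] by (auto simp: flat_cone_metric_def zero_less_mult_iff)
  then show thesis using that eqR by blast
qed

end


section \<open>Continuation of developing maps and their holonomy\<close>

lemma exp_eq_1_small: "exp w = 1 \<Longrightarrow> norm (w :: complex) < 2 * pi \<Longrightarrow> w = 0"
proof -
  assume "exp w = 1" and w: "norm w < 2 * pi"
  then obtain n :: int where n: "Re w = 0" "Im w = of_int (2 * n) * pi" by (auto simp: exp_eq_1)
  have "2 * pi * \<bar>real_of_int n\<bar> < 2 * pi * 1"
  proof -
    have "\<bar>Im w\<bar> = 2 * pi * \<bar>real_of_int n\<bar>" by (simp add: n(2) abs_mult)
    then show ?thesis using abs_Im_le_cmod[of w] w by linarith
  qed
  then have "\<bar>real_of_int n\<bar> < 1" by (subst (asm) mult_less_cancel_left_pos) auto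
  then show ?thesis using n by (simp add: complex_eq_iff)
qed

lemma eventually_nhds_ballI: "v \<in> ball u r \<Longrightarrow> (\<And>w. w \<in> ball u r \<Longrightarrow> P w) \<Longrightarrow> eventually P (nhds v)"
  by (rule eventually_nhds_in_open[THEN eventually_mono, of "ball u r"]) auto

lemma continuous_interval_ball:
  fixes \<Gamma> :: "real \<Rightarrow> complex"
  assumes "continuous_on {0..1} \<Gamma>" "t \<in> {0..1}" "\<Gamma> t \<in> ball u r"
  obtains d where "d > 0" "\<And>s. s \<in> {0..1} \<Longrightarrow> \<bar>s - t\<bar> < d \<Longrightarrow> \<Gamma> s \<in> ball u r"
proof -
  define e where "e = r - dist u (\<Gamma> t)"
  have "e > 0" using assms(3) by (simp add: e_def)
  then obtain d where d: "d > 0" "\<And>s. s \<in> {0..1} \<Longrightarrow> dist s t < d \<Longrightarrow> dist (\<Gamma> s) (\<Gamma> t) < e"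
    using assms(1,2) unfolding continuous_on_iff by meson
  show thesis
  proof (rule that[OF d(1)])
    fix s :: real assume "s \<in> {0..1}" "\<bar>s - t\<bar> < d"
    then have "dist (\<Gamma> s) (\<Gamma> t) < e" using d(2) by (simp add: dist_real_def)
    then show "\<Gamma> s \<in> ball u r"
      using dist_triangle[of u "\<Gamma> s" "\<Gamma> t"] by (simp add: e_def dist_commute)
  qed
qed

text \<open>These are the continuation clauses of \<open>linear_holonomy\<close> on a subinterval,
  so that continuations can be built by concatenation.\<close>

definition continuation_on ::
    "(complex \<Rightarrow> real) \<Rightarrow> (real \<Rightarrow> complex) \<Rightarrow> real \<Rightarrow> real \<Rightarrow> (real \<Rightarrow> complex \<Rightarrow> complex) \<Rightarrow> bool" where
  "continuation_on lam \<Gamma> a b D \<longleftrightarrow>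
     (\<forall>t\<in>{a..b}. local_developing_map lam (\<Gamma> t) (D t)) \<and>
     (\<forall>t\<in>{a..b}. \<exists>\<delta>>0. \<forall>s\<in>{a..b}. \<bar>s - t\<bar> < \<delta> \<longrightarrow> eventually (\<lambda>v. D s v = D t v) (nhds (\<Gamma> s)))"

text \<open>Only the junction \<open>b\<close> is delicate. There \<open>E b\<close> and
  \<open>D b\<close> agree on a disc around \<open>\<Gamma> b\<close>, and for parameters close to
  \<open>b\<close> the path stays in this disc, so the germs taken after \<open>b\<close> also agree
  with \<open>D b\<close>.\<close>

lemma continuation_on_concat:
  assumes \<Gamma>: "continuous_on {0..1} \<Gamma>" and ab: "0 \<le> a" "a \<le> b" "b \<le> c" "c \<le> 1"
    and D: "continuation_on lam \<Gamma> a b D" and E: "continuation_on lam \<Gamma> b c E"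
    and DE: "eventually (\<lambda>v. E b v = D b v) (nhds (\<Gamma> b))"
  shows "continuation_on lam \<Gamma> a c (\<lambda>t. if t \<le> b then D t else E t)"
  unfolding continuation_on_def
proof (intro conjI ballI)
  fix t assume t: "t \<in> {a..c}"
  then show "local_developing_map lam (\<Gamma> t) (if t \<le> b then D t else E t)"
    using D E by (auto simp: continuation_on_def)
  consider "t < b" | "t = b" | "t > b" by linarith
  then show "\<exists>\<delta>>0. \<forall>s\<in>{a..c}. \<bar>s - t\<bar> < \<delta> \<longrightarrow>
      eventually (\<lambda>v. (if s \<le> b then D s else E s) v = (if t \<le> b then D t else E t) v) (nhds (\<Gamma> s))"
  proof cases
    case 1
    then obtain \<delta> where \<delta>: "\<delta> > 0" "\<And>s. s \<in> {a..b} \<Longrightarrow> \<bar>s - t\<bar> < \<delta> \<Longrightarrow> eventually (\<lambda>v. D s v = D t v) (nhds (\<Gamma> s))"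
      using D t unfolding continuation_on_def by (metis atLeastAtMost_iff less_imp_le)
    show ?thesis
    proof (intro exI[of _ "min \<delta> (b - t)"] conjI ballI impI)
      fix s assume s: "s \<in> {a..c}" "\<bar>s - t\<bar> < min \<delta> (b - t)"
      then show "eventually (\<lambda>v. (if s \<le> b then D s else E s) v = (if t \<le> b then D t else E t) v) (nhds (\<Gamma> s))"
      proof -
        have "s \<le> b" using s(2) by (simp add: abs_less_iff)
        then show ?thesis using 1 s \<delta>(2)[of s] by simp
      qed
    qed (use 1 \<delta> in auto)
  next
    case 3
    then obtain \<delta> where \<delta>: "\<delta> > 0" "\<And>s. s \<in> {b..c} \<Longrightarrow> \<bar>s - t\<bar> < \<delta> \<Longrightarrow> eventually (\<lambda>v. E s v = E t v) (nhds (\<Gamma> s))"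
      using E t unfolding continuation_on_def by (metis atLeastAtMost_iff less_imp_le)
    show ?thesis
    proof (intro exI[of _ "min \<delta> (t - b)"] conjI ballI impI)
      fix s assume s: "s \<in> {a..c}" "\<bar>s - t\<bar> < min \<delta> (t - b)"
      then show "eventually (\<lambda>v. (if s \<le> b then D s else E s) v = (if t \<le> b then D t else E t) v) (nhds (\<Gamma> s))"
      proof -
        have "s > b" using s(2) by (simp add: abs_less_iff)
        then show ?thesis using 3 s \<delta>(2)[of s] by simp
      qed
    qed (use 3 \<delta> in auto)
  next
    case 2
    obtain \<delta> where \<delta>: "\<delta> > 0" "\<And>s. s \<in> {a..b} \<Longrightarrow> \<bar>s - b\<bar> < \<delta> \<Longrightarrow> eventually (\<lambda>v. D s v = D b v) (nhds (\<Gamma> s))"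
      using D ab unfolding continuation_on_def by (metis atLeastAtMost_iff order_refl)
    obtain \<delta>' where \<delta>': "\<delta>' > 0" "\<And>s. s \<in> {b..c} \<Longrightarrow> \<bar>s - b\<bar> < \<delta>' \<Longrightarrow> eventually (\<lambda>v. E s v = E b v) (nhds (\<Gamma> s))"
      using E ab unfolding continuation_on_def by (metis atLeastAtMost_iff order_refl)
    obtain r where r: "r > 0" "\<And>v. v \<in> ball (\<Gamma> b) r \<Longrightarrow> E b v = D b v"
      using DE unfolding eventually_nhds_metric by (auto simp: dist_commute)
    obtain d where d: "d > 0" "\<And>s. s \<in> {0..1} \<Longrightarrow> \<bar>s - b\<bar> < d \<Longrightarrow> \<Gamma> s \<in> ball (\<Gamma> b) r"
      using continuous_interval_ball[OF \<Gamma>, of b "\<Gamma> b" r] ab r by auto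
    show ?thesis
    proof (intro exI[of _ "min d (min \<delta> \<delta>')"] conjI ballI impI)
      fix s assume s: "s \<in> {a..c}" "\<bar>s - t\<bar> < min d (min \<delta> \<delta>')"
      show "eventually (\<lambda>v. (if s \<le> b then D s else E s) v = (if t \<le> b then D t else E t) v) (nhds (\<Gamma> s))"
      proof (cases "s \<le> b")
        case True
        then show ?thesis using 2 \<delta>(2)[of s] s by simp
      next
        case False
        have "eventually (\<lambda>v. E b v = D b v) (nhds (\<Gamma> s))"
          using s 2 ab by (intro eventually_nhds_ballI[OF d(2)] r(2)) auto
        moreover have "eventually (\<lambda>v. E s v = E b v) (nhds (\<Gamma> s))"
          using \<delta>'(2)[of s] s 2 False by simp
        ultimately have "eventually (\<lambda>v. E s v = D b v) (nhds (\<Gamma> s))"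
          by eventually_elim simp
        then show ?thesis using False 2 by simp
      qed
    qed (use d \<delta> \<delta>' in auto)
  qed
qed

context weighted_config
begin

text \<open>Near a point of the path one developing map \<open>E\<close> is defined on a whole disc,
  and any germ inside the disc is \<rho> E + c; this extends the germ to the entire disc.
  Compactness of the interval enters through \<open>Bolzano\<close>.\<close>

lemma ex_continuation:
  assumes lam: "flat_cone_metric \<alpha> (\<tau>, z) lam" and \<Gamma>: "continuous_on {0..1} \<Gamma>"
    and np: "\<And>t. t \<in> {0..1} \<Longrightarrow> \<Gamma> t \<notin> punct"
  obtains D where "continuation_on lam \<Gamma> 0 1 D"
proof -
  \<comment> \<open>The initial germ is arbitrary, which makes \<open>P\<close> transitive. The
    guards make \<open>P\<close> vacuous outside the unit interval, where nothing is assumed about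
    \<Gamma>.\<close>
  define P where "P a b \<longleftrightarrow> (0 \<le> a \<longrightarrow> b \<le> 1 \<longrightarrow> a \<le> b \<longrightarrow> (\<forall>D0. local_developing_map lam (\<Gamma> a) D0 \<longrightarrow>
    (\<exists>D. continuation_on lam \<Gamma> a b D \<and> eventually (\<lambda>v. D a v = D0 v) (nhds (\<Gamma> a)))))" for a b
  have "(0::real) \<le> 1" by simp
  then have "P 0 1"
  proof (induction rule: Bolzano)
    case (trans a b c)
    show ?case
      unfolding P_def
    proof (intro impI allI)
      fix D0 assume ac: "0 \<le> a" "c \<le> 1" and D0: "local_developing_map lam (\<Gamma> a) D0"
      then obtain D where D: "continuation_on lam \<Gamma> a b D" "eventually (\<lambda>v. D a v = D0 v) (nhds (\<Gamma> a))"
        using trans unfolding P_def by (meson order_trans)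
      have "local_developing_map lam (\<Gamma> b) (D b)"
        using D(1) trans(3) by (auto simp: continuation_on_def)
      then obtain E where E: "continuation_on lam \<Gamma> b c E" "eventually (\<lambda>v. E b v = D b v) (nhds (\<Gamma> b))"
        using trans ac unfolding P_def by (meson order_trans)
      have "continuation_on lam \<Gamma> a c (\<lambda>t. if t \<le> b then D t else E t)"
        using continuation_on_concat[OF \<Gamma> ac(1) trans(3,4) ac(2) D(1) E] .
      then show "\<exists>D. continuation_on lam \<Gamma> a c D \<and> eventually (\<lambda>v. D a v = D0 v) (nhds (\<Gamma> a))"
        using D(2) trans(3) by (intro exI[of _ "\<lambda>t. if t \<le> b then D t else E t"]) auto
    qed
  next
    case (local x)
    then have x: "x \<in> {0..1}" by auto
    obtain E r where r: "r > 0" and E: "E holomorphic_on ball (\<Gamma> x) r"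
      and lamE: "\<And>v. v \<in> ball (\<Gamma> x) r \<Longrightarrow> lam v = norm (deriv E v)"
      using lam np[OF x] unfolding flat_cone_metric_def local_developing_map_def by blast
    obtain q where q: "q > 0" "ball (\<Gamma> x) q \<subseteq> - punct"
      using closed_punctures np[OF x] open_contains_ball[of "- punct"] by (auto simp: open_Compl)
    define e where "e = min r q"
    have e: "e > 0" "ball (\<Gamma> x) e \<subseteq> ball (\<Gamma> x) r" "ball (\<Gamma> x) e \<subseteq> - punct"
      using r q by (auto simp: e_def)
    have E0: "deriv E v \<noteq> 0" if "v \<in> ball (\<Gamma> x) e" for v
    proof -
      have "lam v > 0" using that e(3) by (intro flat_cone_metric_pos[OF lam]) auto
      then show ?thesis using lamE[of v] that e(2) by auto
    qed
    obtain d where d: "d > 0" "\<And>s. s \<in> {0..1} \<Longrightarrow> \<bar>s - x\<bar> < d \<Longrightarrow> \<Gamma> s \<in> ball (\<Gamma> x) e"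
      using continuous_interval_ball[OF \<Gamma> x, of "\<Gamma> x" e] e by auto
    show ?case
    proof (intro exI[of _ d] conjI allI impI)
      fix a b assume ab: "a \<le> x \<and> x \<le> b \<and> b - a < d"
      show "P a b"
        unfolding P_def
      proof (intro impI allI)
        fix D0 assume 01: "0 \<le> a" "b \<le> 1" and D0: "local_developing_map lam (\<Gamma> a) D0"
        have \<Gamma>ab: "\<Gamma> t \<in> ball (\<Gamma> x) e" if "t \<in> {a..b}" for t
          using that ab 01 by (intro d(2)) auto
        then have "\<Gamma> a \<in> ball (\<Gamma> x) e" using ab by auto
        then obtain s1 where s1: "s1 > 0" "ball (\<Gamma> a) s1 \<subseteq> ball (\<Gamma> x) e"
          using open_contains_ball[of "ball (\<Gamma> x) e"] by blast
        obtain s2 where s2: "s2 > 0" "D0 holomorphic_on ball (\<Gamma> a) s2"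
          "\<And>v. v \<in> ball (\<Gamma> a) s2 \<Longrightarrow> lam v = norm (deriv D0 v)"
          using D0 unfolding local_developing_map_def by blast
        define s where "s = min s1 s2"
        have s: "s > 0" "ball (\<Gamma> a) s \<subseteq> ball (\<Gamma> x) e" "ball (\<Gamma> a) s \<subseteq> ball (\<Gamma> a) s2"
          using s1 s2 by (auto simp: s_def)
        obtain \<rho> c where \<rho>: "norm \<rho> = 1" "\<And>v. v \<in> ball (\<Gamma> a) s \<Longrightarrow> D0 v = \<rho> * E v + c"
        proof (rule developing_maps_differ_by_isometry[of D0 "\<Gamma> a" s E])
          show "D0 holomorphic_on ball (\<Gamma> a) s" "E holomorphic_on ball (\<Gamma> a) s"
            using s2(2) E s e(2) by (auto intro: holomorphic_on_subset)
          show "norm (deriv D0 v) = norm (deriv E v)" if v: "v \<in> ball (\<Gamma> a) s" for v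
          proof -
            have "v \<in> ball (\<Gamma> a) s2" "v \<in> ball (\<Gamma> x) r" using v s e(2) by blast+
            then show ?thesis using s2(3)[of v] lamE[of v] by metis
          qed
        qed (use s E0 in auto)
        define F where "F v = \<rho> * E v + c" for v
        have "E holomorphic_on ball (\<Gamma> x) e" using E e(2) by (auto intro: holomorphic_on_subset)
        then have F: "F holomorphic_on ball (\<Gamma> x) e" unfolding F_def by (intro holomorphic_intros)
        have dF: "norm (deriv F v) = lam v" if v: "v \<in> ball (\<Gamma> x) e" for v
        proof -
          have "(E has_field_derivative deriv E v) (at v)"
            using E e(2) v by (meson holomorphic_derivI open_ball subsetD)
          then have "(F has_field_derivative \<rho> * deriv E v) (at v)"
            unfolding F_def by (auto intro!: derivative_eq_intros)
          then show ?thesis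
            using \<rho>(1) lamE[of v] v e(2) by (auto simp: DERIV_imp_deriv norm_mult)
        qed
        have "local_developing_map lam (\<Gamma> t) F" if t: "t \<in> {a..b}" for t
        proof -
          obtain h where h: "h > 0" "ball (\<Gamma> t) h \<subseteq> ball (\<Gamma> x) e"
            using open_contains_ball[of "ball (\<Gamma> x) e"] \<Gamma>ab[OF t] by blast
          then show ?thesis
            unfolding local_developing_map_def using F dF holomorphic_on_subset
            by (intro exI[of _ h]) auto
        qed
        then have "continuation_on lam \<Gamma> a b (\<lambda>_. F)"
          by (auto simp: continuation_on_def intro: exI[of _ 1])
        moreover have "eventually (\<lambda>v. F v = D0 v) (nhds (\<Gamma> a))"
          using s(1) \<rho>(2) by (intro eventually_nhds_ballI[of "\<Gamma> a" "\<Gamma> a" s]) (auto simp: F_def)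
        ultimately show "\<exists>D. continuation_on lam \<Gamma> a b D \<and> eventually (\<lambda>v. D a v = D0 v) (nhds (\<Gamma> a))"
          by (intro exI[of _ "\<lambda>_. F"]) simp
      qed
    qed (rule d)
  qed
  moreover obtain D0 where "local_developing_map lam (\<Gamma> 0) D0"
    using lam np[of 0] by (auto simp: flat_cone_metric_def)
  ultimately show thesis using that unfolding P_def by auto
qed

text \<open>By periodicity of the metric the translate of the final germ by \<open>p\<close> is
  again a developing map at the starting point, so it differs from the initial germ by a rotation
  and a translation.\<close>

lemma ex_linear_holonomy:
  assumes lam: "flat_cone_metric \<alpha> (\<tau>, z) lam" and \<Gamma>: "continuous_on {0..1} \<Gamma>"
    and np: "\<And>t. t \<in> {0..1} \<Longrightarrow> \<Gamma> t \<notin> punct"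
    and p: "p \<in> lattice \<tau>" "\<Gamma> 1 = \<Gamma> 0 + p"
  shows "\<exists>\<rho>. linear_holonomy lam \<Gamma> p \<rho>"
proof -
  obtain D where D: "continuation_on lam \<Gamma> 0 1 D" using ex_continuation[OF lam \<Gamma> np] by blast
  have dev: "local_developing_map lam (\<Gamma> 0) (D 0)" "local_developing_map lam (\<Gamma> 1) (D 1)"
    using D by (auto simp: continuation_on_def)
  obtain r0 where r0: "r0 > 0" "D 0 holomorphic_on ball (\<Gamma> 0) r0" "\<And>v. v \<in> ball (\<Gamma> 0) r0 \<Longrightarrow> lam v = norm (deriv (D 0) v)"
    using dev(1) unfolding local_developing_map_def by blast
  obtain r1 where r1: "r1 > 0" "D 1 holomorphic_on ball (\<Gamma> 1) r1" "\<And>v. v \<in> ball (\<Gamma> 1) r1 \<Longrightarrow> lam v = norm (deriv (D 1) v)"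
    using dev(2) unfolding local_developing_map_def by blast
  obtain q where q: "q > 0" "ball (\<Gamma> 0) q \<subseteq> - punct"
    using closed_punctures np[of 0] open_contains_ball[of "- punct"] by (auto simp: open_Compl)
  define s where "s = min q (min r0 r1)"
  have s: "s > 0" "ball (\<Gamma> 0) s \<subseteq> ball (\<Gamma> 0) r0" "ball (\<Gamma> 0) s \<subseteq> - punct"
    using q r0 r1 by (auto simp: s_def)
  have sh: "v + p \<in> ball (\<Gamma> 1) r1" if "v \<in> ball (\<Gamma> 0) s" for v
    using that by (simp add: p(2) dist_norm s_def)
  have E: "(\<lambda>v. D 1 (v + p)) holomorphic_on ball (\<Gamma> 0) s"
    using sh by (intro holomorphic_on_compose_gen[OF _ r1(2), unfolded o_def] holomorphic_intros) auto
  have dE: "deriv (\<lambda>v. D 1 (v + p)) v = deriv (D 1) (v + p)" if v: "v \<in> ball (\<Gamma> 0) s" for v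
  proof -
    have "((\<lambda>v. D 1 (v + p)) has_field_derivative deriv (D 1) (v + p) * 1) (at v)"
      by (rule DERIV_chain2[where f = "D 1" and g = "\<lambda>v. v + p", OF holomorphic_derivI[OF r1(2) open_ball sh[OF v]]])
        (auto intro!: derivative_eq_intros)
    then show ?thesis by (simp add: DERIV_imp_deriv)
  qed
  obtain \<rho> c where \<rho>: "norm \<rho> = 1" "\<And>v. v \<in> ball (\<Gamma> 0) s \<Longrightarrow> D 1 (v + p) = \<rho> * D 0 v + c"
  proof (rule developing_maps_differ_by_isometry[OF E _ s(1), of "D 0"])
    show "D 0 holomorphic_on ball (\<Gamma> 0) s" using r0(2) s(2) by (rule holomorphic_on_subset)
    fix v assume v: "v \<in> ball (\<Gamma> 0) s"
    then have vp: "v \<notin> punct" using s by auto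
    have "lam (v + p) = lam v" by (rule flat_cone_metric_add_lattice[OF lam vp p(1)])
    then show "norm (deriv (\<lambda>v. D 1 (v + p)) v) = norm (deriv (D 0) v)"
      using r1(3)[OF sh[OF v]] r0(3)[of v] v s(2) by (auto simp: dE[OF v])
    have "lam v > 0" using lam vp by (auto simp: flat_cone_metric_def)
    then show "deriv (D 0) v \<noteq> 0" using r0(3)[of v] v s(2) by auto
  qed blast
  have "eventually (\<lambda>v. D 1 (v + p) = \<rho> * D 0 v + c) (nhds (\<Gamma> 0))"
    using s(1) \<rho>(2) by (intro eventually_nhds_ballI[of "\<Gamma> 0" "\<Gamma> 0" s]) auto
  then show ?thesis
    using D \<rho>(1) unfolding linear_holonomy_def continuation_on_def by blast
qed

text \<open>Both the derivative of the developing map and the exponential of the weighted sum of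
  logarithms of theta continue along the path, and their quotient is locally constant.\<close>

lemma linear_holonomy_formula:
  assumes lam: "flat_cone_metric \<alpha> (\<tau>, z) lam" and \<Gamma>: "continuous_on {0..1} \<Gamma>"
    and np: "\<And>t. t \<in> {0..1} \<Longrightarrow> \<Gamma> t \<notin> punct" and p: "\<Gamma> 1 = \<Gamma> 0 + p"
    and L: "\<And>i. continuous_on {0..1} (L i)" "\<And>i t. t \<in> {0..1} \<Longrightarrow> exp (L i t) = theta \<tau> (\<Gamma> t - z $ i)"
    and hol: "linear_holonomy lam \<Gamma> p \<rho>"
  shows "\<rho> = exp ((\<Sum>i\<in>UNIV. of_real (\<alpha> $ i) * (L i 1 - L i 0)) + slope * p)"
proof -
  obtain M where M: "M > 0" "\<And>u. u \<notin> punct \<Longrightarrow> lam u = M * theta_metric u"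
    using flat_cone_metric_unique[OF lam] by blast
  obtain D c where dev: "\<And>t. t \<in> {0..1} \<Longrightarrow> local_developing_map lam (\<Gamma> t) (D t)"
    and loc: "\<And>t. t \<in> {0..1} \<Longrightarrow> \<exists>\<delta>>0. \<forall>s\<in>{0..1}. \<bar>s - t\<bar> < \<delta> \<longrightarrow> eventually (\<lambda>v. D s v = D t v) (nhds (\<Gamma> s))"
    and fin: "eventually (\<lambda>v. D 1 (v + p) = \<rho> * D 0 v + c) (nhds (\<Gamma> 0))"
    using hol unfolding linear_holonomy_def by blast
  define F where "F t = exp ((\<Sum>i\<in>UNIV. of_real (\<alpha> $ i) * L i t) + slope * \<Gamma> t)" for t
  \<comment> \<open>Once \<open>E\<close> is locally constant, it has equal values at both ends.
    Differentiating the closing relation gives D_1' = \<rho> D_0' at the ends, whence \<rho> =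
    F(1)/F(0).\<close>
  define E where "E t = deriv (D t) (\<Gamma> t) / F t" for t
  have local_const: "\<exists>\<delta>>0. \<forall>s\<in>{0..1}. \<bar>s - t\<bar> < \<delta> \<longrightarrow> E s = E t" if t: "t \<in> {0..1}" for t
  proof -
    obtain r l where r: "r > 0" "ball (\<Gamma> t) r \<inter> punct = {}" and l: "\<And>i. l i holomorphic_on ball (\<Gamma> t) r"
      "\<And>i v. v \<in> ball (\<Gamma> t) r \<Longrightarrow> exp (l i v) = theta \<tau> (v - z $ i)"
      and tm: "\<And>v. v \<in> ball (\<Gamma> t) r \<Longrightarrow> theta_metric v = norm (exp ((\<Sum>i\<in>UNIV. of_real (\<alpha> $ i) * l i v) + slope * v))"
      by (rule theta_metric_branch[OF np[OF t]]) (rule that)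
    obtain r' where r': "r' > 0" "D t holomorphic_on ball (\<Gamma> t) r'" "\<And>v. v \<in> ball (\<Gamma> t) r' \<Longrightarrow> lam v = norm (deriv (D t) v)"
      using dev[OF t] unfolding local_developing_map_def by blast
    define q where "q = min r r'"
    have q: "q > 0" "ball (\<Gamma> t) q \<subseteq> ball (\<Gamma> t) r" "ball (\<Gamma> t) q \<subseteq> ball (\<Gamma> t) r'"
      using r r' by (auto simp: q_def)
    define H where "H v = exp ((\<Sum>i\<in>UNIV. of_real (\<alpha> $ i) * l i v) + slope * v)" for v
    obtain k where k: "\<And>v. v \<in> ball (\<Gamma> t) q \<Longrightarrow> deriv (D t) v = k * H v"
    proof (rule deriv_proportional_if_norm_proportional[of "deriv (D t)" "\<Gamma> t" q H M])
      show "deriv (D t) holomorphic_on ball (\<Gamma> t) q"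
        by (rule holomorphic_on_subset[OF holomorphic_deriv[OF r'(2) open_ball] q(3)])
      show "H holomorphic_on ball (\<Gamma> t) q"
        unfolding H_def by (intro holomorphic_intros holomorphic_on_subset[OF l(1) q(2)])
      show "norm (deriv (D t) v) = M * norm (H v)" if v: "v \<in> ball (\<Gamma> t) q" for v
      proof -
        have v': "v \<in> ball (\<Gamma> t) r" "v \<in> ball (\<Gamma> t) r'" using v q by auto
        then have "v \<notin> punct" using r(2) by blast
        then show ?thesis
          using r'(3)[OF v'(2)] tm[OF v'(1)] M(2)[of v] unfolding H_def by metis
      qed
    qed (use q in \<open>auto simp: H_def\<close>)
    obtain \<delta>1 where \<delta>1: "\<delta>1 > 0" "\<And>s. s \<in> {0..1} \<Longrightarrow> \<bar>s - t\<bar> < \<delta>1 \<Longrightarrow> eventually (\<lambda>v. D s v = D t v) (nhds (\<Gamma> s))"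
      using loc[OF t] by blast
    obtain \<delta>2 where \<delta>2: "\<delta>2 > 0" "\<And>s. s \<in> {0..1} \<Longrightarrow> \<bar>s - t\<bar> < \<delta>2 \<Longrightarrow> \<Gamma> s \<in> ball (\<Gamma> t) q"
      using continuous_interval_ball[OF \<Gamma> t, of "\<Gamma> t" q] q by auto
    \<comment> \<open>The given logarithm along the path and the local branch differ by a multiple
      of 2 pi \<i>; being continuous, the difference is locally constant.\<close>
    define g where "g i s = L i s - l i (\<Gamma> s)" for i s
    have "\<exists>\<delta>>0. \<forall>s\<in>{0..1}. \<bar>s - t\<bar> < \<delta> \<longrightarrow> g i s = g i t" for i
    proof -
      have "continuous_on ({0..1} \<inter> {t - \<delta>2<..<t + \<delta>2}) (g i)"
        unfolding g_def
      proof (intro continuous_on_diff continuous_on_subset[OF L(1)])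
        have "continuous_on ({0..1} \<inter> {t - \<delta>2<..<t + \<delta>2}) \<Gamma>" using \<Gamma> by (rule continuous_on_subset) auto
        moreover have "\<Gamma> ` ({0..1} \<inter> {t - \<delta>2<..<t + \<delta>2}) \<subseteq> ball (\<Gamma> t) r"
          using \<delta>2(2) q(2) by (fastforce simp: abs_less_iff)
        ultimately show "continuous_on ({0..1} \<inter> {t - \<delta>2<..<t + \<delta>2}) (\<lambda>s. l i (\<Gamma> s))"
          using continuous_on_compose2[OF holomorphic_on_imp_continuous_on[OF l(1)]] by blast
      qed auto
      moreover have "t \<in> {0..1} \<inter> {t - \<delta>2<..<t + \<delta>2}" using t \<delta>2(1) by auto
      ultimately obtain \<delta> where \<delta>: "\<delta> > 0"
        "\<And>s. s \<in> {0..1} \<inter> {t - \<delta>2<..<t + \<delta>2} \<Longrightarrow> dist s t < \<delta> \<Longrightarrow> dist (g i s) (g i t) < 1"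
        unfolding continuous_on_iff by (meson zero_less_one)
      have expg: "exp (g i s) = 1" if "s \<in> {0..1}" "\<bar>s - t\<bar> < \<delta>2" for s
      proof -
        have "\<Gamma> s \<in> ball (\<Gamma> t) r" using \<delta>2(2)[OF that] q(2) by blast
        then show ?thesis using L(2)[OF that(1), of i] l(2)[of "\<Gamma> s" i]
          by (metis exp_diff divide_self exp_not_eq_zero g_def)
      qed
      show ?thesis
      proof (intro exI[of _ "min \<delta> \<delta>2"] conjI ballI impI)
        fix s :: real assume s: "s \<in> {0..1}" "\<bar>s - t\<bar> < min \<delta> \<delta>2"
        have "exp (g i s - g i t) = 1"
          using expg[of s] expg[of t] s t \<delta>2(1) by (simp add: exp_diff)
        moreover have "norm (g i s - g i t) < 1"
          using \<delta>(2)[of s] s by (auto simp: dist_norm abs_less_iff)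
        then have "norm (g i s - g i t) < 2 * pi" using pi_gt3 by linarith
        ultimately show "g i s = g i t" using exp_eq_1_small by fastforce
      qed (use \<delta> \<delta>2 in auto)
    qed
    then obtain \<delta>3 where \<delta>3: "\<And>i. \<delta>3 i > 0" "\<And>i s. s \<in> {0..1} \<Longrightarrow> \<bar>s - t\<bar> < \<delta>3 i \<Longrightarrow> g i s = g i t"
      by metis
    define \<delta> where "\<delta> = min (min \<delta>1 \<delta>2) (Min (range \<delta>3))"
    have Es: "E s = k / exp (\<Sum>i\<in>UNIV. of_real (\<alpha> $ i) * g i t)" if s: "s \<in> {0..1}" "\<bar>s - t\<bar> < \<delta>" for s
    proof -
      have gs: "g i s = g i t" for i
        using s \<delta>3(2)[of s i] by (auto simp: \<delta>_def Min_gr_iff)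
      have s': "\<bar>s - t\<bar> < \<delta>1" "\<bar>s - t\<bar> < \<delta>2" using s by (auto simp: \<delta>_def)
      have "deriv (D s) (\<Gamma> s) = deriv (D t) (\<Gamma> s)"
        using \<delta>1(2)[OF s(1) s'(1)] by (rule deriv_cong_ev) simp
      also have "\<dots> = k * H (\<Gamma> s)" using k[OF \<delta>2(2)[OF s(1) s'(2)]] .
      finally have 1: "deriv (D s) (\<Gamma> s) = k * H (\<Gamma> s)" .
      have "L i s = l i (\<Gamma> s) + g i t" for i using gs[of i] unfolding g_def by (simp add: algebra_simps)
      then have "F s = exp (((\<Sum>i\<in>UNIV. of_real (\<alpha> $ i) * l i (\<Gamma> s)) + slope * \<Gamma> s) + (\<Sum>i\<in>UNIV. of_real (\<alpha> $ i) * g i t))"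
        by (simp add: F_def distrib_left sum.distrib algebra_simps)
      then have 2: "F s = H (\<Gamma> s) * exp (\<Sum>i\<in>UNIV. of_real (\<alpha> $ i) * g i t)"
        unfolding exp_add[of "(\<Sum>i\<in>UNIV. of_real (\<alpha> $ i) * l i (\<Gamma> s)) + slope * \<Gamma> s"] H_def .
      have "H (\<Gamma> s) \<noteq> 0" by (simp add: H_def)
      then show ?thesis unfolding E_def 1 2 by simp
    qed
    have "\<delta> > 0" using \<delta>1 \<delta>2 \<delta>3 by (simp add: \<delta>_def)
    then show ?thesis using Es t by (intro exI[of _ \<delta>]) auto
  qed
  have "E 1 = E 0"
  proof (rule connected_induction_simple[of "{0..1::real}" 0 1 "\<lambda>t. E t = E 0"])
    fix t :: real assume t: "t \<in> {0..1}"
    obtain \<delta> where \<delta>: "\<delta> > 0" "\<And>s. s \<in> {0..1} \<Longrightarrow> \<bar>s - t\<bar> < \<delta> \<Longrightarrow> E s = E t" using local_const[OF t] by blast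
    show "\<exists>T. openin (top_of_set {0..1}) T \<and> t \<in> T \<and> (\<forall>x\<in>T. \<forall>y\<in>T. E x = E 0 \<longrightarrow> E y = E 0)"
    proof (intro exI[of _ "{0..1} \<inter> ball t \<delta>"] conjI ballI impI)
      fix x y assume "x \<in> {0..1} \<inter> ball t \<delta>" "y \<in> {0..1} \<inter> ball t \<delta>" "E x = E 0"
      then show "E y = E 0" using \<delta>(2)[of x] \<delta>(2)[of y] by (auto simp: dist_real_def abs_minus_commute)
    qed (use t \<delta>(1) in auto)
  qed auto
  moreover have "deriv (D 1) (\<Gamma> 1) = \<rho> * deriv (D 0) (\<Gamma> 0)"
  proof -
    obtain r0 where r0: "r0 > 0" "D 0 holomorphic_on ball (\<Gamma> 0) r0"
      using dev[of 0] by (auto simp: local_developing_map_def)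
    obtain r1 where r1: "r1 > 0" "D 1 holomorphic_on ball (\<Gamma> 1) r1"
      using dev[of 1] by (auto simp: local_developing_map_def)
    have "(D 1 has_field_derivative deriv (D 1) (\<Gamma> 1)) (at (\<Gamma> 0 + p))"
      using holomorphic_derivI[OF r1(2) open_ball, of "\<Gamma> 1"] r1(1) p by simp
    then have "((\<lambda>v. D 1 (v + p)) has_field_derivative deriv (D 1) (\<Gamma> 1) * 1) (at (\<Gamma> 0))"
      by (rule DERIV_chain2[where f = "D 1" and g = "\<lambda>v. v + p"]) (auto intro!: derivative_eq_intros)
    moreover have "((\<lambda>v. \<rho> * D 0 v + c) has_field_derivative \<rho> * deriv (D 0) (\<Gamma> 0)) (at (\<Gamma> 0))"
      using holomorphic_derivI[OF r0(2) open_ball, of "\<Gamma> 0"] r0(1) by (auto intro!: derivative_eq_intros)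
    ultimately show ?thesis
      using DERIV_cong_ev[OF refl fin refl] DERIV_unique by (metis mult.right_neutral)
  qed
  moreover have "deriv (D 0) (\<Gamma> 0) \<noteq> 0"
  proof -
    have "lam (\<Gamma> 0) > 0" using lam np[of 0] by (auto simp: flat_cone_metric_def)
    then show ?thesis using dev[of 0] by (auto simp: local_developing_map_def)
  qed
  moreover have "F 0 \<noteq> 0" "F 1 \<noteq> 0" by (auto simp: F_def)
  ultimately have "\<rho> = F 1 / F 0" by (simp add: E_def field_simps)
  also have "\<dots> = exp ((\<Sum>i\<in>UNIV. of_real (\<alpha> $ i) * (L i 1 - L i 0)) + slope * p)"
    by (simp add: F_def exp_diff[symmetric] p right_diff_distrib sum_subtractf algebra_simps)
  finally show ?thesis .
qed

end


section \<open>Increments of the logarithm of theta along marked loops\<close>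

lemma continuous_exp_eq_1_constant:
  fixes g :: "'a::topological_space \<Rightarrow> complex"
  assumes "connected S" "continuous_on S g" and 1: "\<And>x. x \<in> S \<Longrightarrow> exp (g x) = 1"
    and xy: "x \<in> S" "y \<in> S"
  shows "g x = g y"
proof -
  have "\<exists>e>0. \<forall>y. y \<in> S \<and> g y \<noteq> g x \<longrightarrow> e \<le> norm (g y - g x)" if "x \<in> S" for x
  proof (intro exI[of _ 1] conjI allI impI)
    fix y assume y: "y \<in> S \<and> g y \<noteq> g x"
    then have "exp (g y - g x) = 1" using 1 that by (simp add: exp_diff)
    then have "\<not> norm (g y - g x) < 2 * pi" using exp_eq_1_small[of "g y - g x"] y by auto
    then show "1 \<le> norm (g y - g x)" using pi_gt3 by linarith
  qed simp
  then have "g constant_on S"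
    by (intro continuous_discrete_range_constant[OF assms(1,2)]) blast
  then show ?thesis using xy unfolding constant_on_def by metis
qed

lemma ex_path_log:
  fixes f :: "real \<Rightarrow> complex"
  assumes "continuous_on {0..1} f" "\<And>t. t \<in> {0..1} \<Longrightarrow> f t \<noteq> 0"
  obtains L where "continuous_on {0..1} L" "\<And>t. t \<in> {0..1} \<Longrightarrow> exp (L t) = f t"
  using continuous_logarithm_on_contractible[OF assms(1) convex_imp_contractible assms(2)]
  by (metis convex_real_interval(5))

text \<open>The lifted loops are not closed: between their ends \<open>f\<close> changes by the
  factor exp m. Subtracting \<open>m\<close> from the logarithmic increment leaves 2 pi \<i> times
  an integer, a winding number, which is constant along the homotopy. A logarithm on the square
  provides the continuity, and logarithms on its two end sides differ from it by constants.\<close>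

lemma log_increment_homotopy:
  fixes f m :: "complex \<Rightarrow> complex" and H :: "real \<times> real \<Rightarrow> complex"
  assumes f: "continuous_on UNIV f" and m: "continuous_on UNIV m"
    and fp: "\<And>u. f (u + p) = exp (m u) * f u"
    and H: "continuous_on ({0..1} \<times> {0..1}) H"
    and H0: "\<And>s t. s \<in> {0..1} \<Longrightarrow> t \<in> {0..1} \<Longrightarrow> f (H (s, t)) \<noteq> 0"
    and Hp: "\<And>s. s \<in> {0..1} \<Longrightarrow> H (s, 1) = H (s, 0) + p"
    and L0: "continuous_on {0..1} L0" "\<And>t. t \<in> {0..1} \<Longrightarrow> exp (L0 t) = f (H (0, t))"
    and L1: "continuous_on {0..1} L1" "\<And>t. t \<in> {0..1} \<Longrightarrow> exp (L1 t) = f (H (1, t))"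
  shows "L1 1 - L1 0 - m (H (1, 0)) = L0 1 - L0 0 - m (H (0, 0))"
proof -
  have fH: "continuous_on ({0..1} \<times> {0..1}) (\<lambda>x. f (H x))"
    by (rule continuous_on_compose2[OF f H]) auto
  have square: "contractible ({0..1::real} \<times> {0..1::real})"
    by (intro convex_imp_contractible convex_Times) auto
  have fH0: "f (H x) \<noteq> 0" if "x \<in> {0..1} \<times> {0..1}" for x
    using H0 that by (cases x) auto
  obtain \<Lambda> where \<Lambda>: "continuous_on ({0..1} \<times> {0..1}) \<Lambda>"
    "\<And>x. x \<in> {0..1} \<times> {0..1} \<Longrightarrow> f (H x) = exp (\<Lambda> x)"
    using continuous_logarithm_on_contractible[OF fH square fH0] by blast
  have slice: "continuous_on {0..1} (\<lambda>t. \<Lambda> (a, t))" "continuous_on {0..1} (\<lambda>t. \<Lambda> (t, a))" "continuous_on {0..1} (\<lambda>t. H (t, a))"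
    if "a \<in> {0..1}" for a
    using that
    by (auto intro!: continuous_on_compose2[OF \<Lambda>(1)] continuous_on_compose2[OF H] continuous_intros)
  define \<delta> where "\<delta> s = \<Lambda> (s, 1) - \<Lambda> (s, 0) - m (H (s, 0))" for s
  have const: "\<delta> 1 = \<delta> 0"
  proof (rule continuous_exp_eq_1_constant[of "{0..1}" \<delta>])
    show "continuous_on {0..1} \<delta>"
      unfolding \<delta>_def using slice by (intro continuous_intros continuous_on_compose2[OF m]) auto
    show "exp (\<delta> s) = 1" if s: "s \<in> {0..1}" for s
      using \<Lambda>(2)[of "(s, 1)"] \<Lambda>(2)[of "(s, 0)"] s Hp[OF s] fp[of "H (s, 0)"] H0[OF s, of 0]
      by (simp add: exp_diff \<delta>_def mult.commute)
  qed auto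
  have end_eq: "L 1 - L 0 = \<Lambda> (a, 1) - \<Lambda> (a, 0)"
    if L: "continuous_on {0..1} L" "\<And>t. t \<in> {0..1} \<Longrightarrow> exp (L t) = f (H (a, t))" and a: "a \<in> {0..1}" for L a
  proof -
    have "L 1 - \<Lambda> (a, 1) = L 0 - \<Lambda> (a, 0)"
    proof (rule continuous_exp_eq_1_constant[of "{0..1}" "\<lambda>t. L t - \<Lambda> (a, t)"])
      show "continuous_on {0..1} (\<lambda>t. L t - \<Lambda> (a, t))"
        using slice[OF a] L by (intro continuous_intros)
      show "exp (L t - \<Lambda> (a, t)) = 1" if t: "t \<in> {0..1}" for t
        using L(2)[OF t] \<Lambda>(2)[of "(a, t)"] a t by (simp add: exp_diff)
    qed auto
    then show ?thesis by (simp add: algebra_simps)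
  qed
  show ?thesis
    using const end_eq[OF L0] end_eq[OF L1] by (simp add: \<delta>_def)
qed

section \<open>Straight loops of normalized configurations in real coordinates\<close>

lemma from_coords_1 [simp]: "from_coords \<tau> 1 = 1"
  and from_coords_i [simp]: "from_coords \<tau> \<i> = \<tau>"
  by (simp_all add: from_coords_def)

lemma coords_straight_loop:
  assumes "Im \<tau> > 0"
  shows "coords \<tau> (straight_loop e (from_coords \<tau> p) t) = coords \<tau> (base_point e) + t *\<^sub>R p"
  using assms
  by (simp add: straight_loop_def coords_add from_coords_scaleR[symmetric] flip: scaleR_conv_of_real)

lemma coords_base_point:
  "Re (coords \<tau> (base_point e)) = - (e * (1 - Re \<tau> / Im \<tau>))" "Im (coords \<tau> (base_point e)) = - (e / Im \<tau>)"
  by (simp_all add: coords_def base_point_def algebra_simps)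

lemma normalized_configs_coords:
  assumes "x \<in> normalized_configs o1"
  shows "Im (fst x) > 0" "Re (fst x) < Im (fst x)"
    "Re (coords (fst x) (snd x $ i)) \<in> {0..<1}" "Im (coords (fst x) (snd x $ i)) \<in> {0..<1}"
proof -
  show \<tau>: "Im (fst x) > 0" "Re (fst x) < Im (fst x)"
    using assms by (auto simp: normalized_configs_def torelli_def)
  have "\<exists>s\<in>{0..<1}. \<exists>t\<in>{0..<1}. snd x $ i = of_real s + of_real t * fst x"
    using assms unfolding normalized_configs_def case_prod_unfold by blast
  then obtain s t where st: "s \<in> {0..<1}" "t \<in> {0..<1}" "snd x $ i = of_real s + of_real t * fst x"
    by blast
  then have "snd x $ i = from_coords (fst x) (Complex s t)" by (simp add: from_coords_def)
  then show "Re (coords (fst x) (snd x $ i)) \<in> {0..<1}" "Im (coords (fst x) (snd x $ i)) \<in> {0..<1}"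
    using st \<tau> by auto
qed

text \<open>If the base point were too far from the origin, the loop would meet a translate of a
  marked point while being moved to the origin.\<close>

lemma small_for_strip:
  assumes x: "x \<in> normalized_configs o1" and \<epsilon>: "small_for x (from_coords (fst x) p) \<epsilon>" and p: "p \<in> {1, \<i>}"
  shows "if p = 1 then Im (coords (fst x) (base_point \<epsilon>) - coords (fst x) (snd x $ i)) \<in> {-1<..<0}
    else Re (coords (fst x) (base_point \<epsilon>) - coords (fst x) (snd x $ i)) \<in> {-1<..<0}"
proof -
  note [simp] = coords_base_point
  define \<tau> where "\<tau> = fst x"
  define w where "w = coords \<tau> (snd x $ i)"
  note nc = normalized_configs_coords[OF x, folded \<tau>_def]
  have w: "0 \<le> Re w" "Re w < 1" "0 \<le> Im w" "Im w < 1" using nc(3,4)[of i] by (auto simp: w_def)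
  have eps: "\<epsilon> > 0" using \<epsilon> by (simp add: small_for_def)
  have hit: False if e: "0 < e" "e \<le> \<epsilon>" and t: "0 \<le> t" "t \<le> 1"
    and g: "coords \<tau> (base_point e) + t *\<^sub>R p - w \<in> gauss_ints" for e t
  proof -
    have "coords \<tau> (straight_loop e (from_coords \<tau> p) t - snd x $ i) \<in> gauss_ints"
      using g nc(1) by (simp add: coords_diff coords_straight_loop w_def)
    then have "straight_loop e (from_coords \<tau> p) t \<in> punctures x"
      using nc(1) by (auto simp: punctures_iff coords_in_gauss_ints_iff \<tau>_def)
    then show False using \<epsilon> e t by (auto simp: small_for_def \<tau>_def)
  qed
  \<comment> \<open>A straight loop runs through a full period of its own coordinate, so some point
    on it has this coordinate integral relative to the marked point.\<close>
  have frac: "\<exists>t k. 0 \<le> t \<and> t \<le> 1 \<and> y + t = of_int k" for y :: real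
    by (intro exI[of _ "of_int \<lceil>y\<rceil> - y"] exI[of _ "\<lceil>y\<rceil>"]) linarith
  show ?thesis
  proof (cases "p = 1")
    case True
    have "\<not> \<epsilon> / Im \<tau> + Im w \<ge> 1"
    proof
      assume *: "\<epsilon> / Im \<tau> + Im w \<ge> 1"
      \<comment> \<open>At this size the loop lies at height exactly 1 below the marked point, that
        is, level with one of its translates; by \<open>frac\<close> it then runs into a
        translate.\<close>
      define e where "e = (1 - Im w) * Im \<tau>"
      obtain t k where t: "0 \<le> t" "t \<le> 1" "(Re (coords \<tau> (base_point e)) - Re w) + t = of_int k" using frac by blast
      have "1 - Im w \<le> \<epsilon> / Im \<tau>" using * by linarith
      then have e: "0 < e" "e \<le> \<epsilon>" using w nc(1) by (simp_all add: e_def pos_le_divide_eq)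
      have "Im (coords \<tau> (base_point e)) - Im w = - 1" using nc(1) by (simp add: e_def)
      then have "coords \<tau> (base_point e) + t *\<^sub>R p - w \<in> gauss_ints"
        unfolding gauss_ints_iff using t(3) True
        by (metis Ints_1 Ints_minus Ints_of_int add_diff_eq add.commute add_0 diff_add_eq
          plus_complex.sel minus_complex.sel scaleR_complex.sel one_complex.sel mult.right_neutral mult_zero_right)
      then show False using hit[OF e t(1,2)] by blast
    qed
    moreover have "\<epsilon> / Im \<tau> > 0" using eps nc(1) by simp
    ultimately show ?thesis using True w by (simp add: \<tau>_def w_def)
  next
    case False
    then have pi: "p = \<i>" using p by auto
    \<comment> \<open>\<open>\<epsilon> * \<kappa>\<close> is the distance of the base point to the
      left of 0 in the first coordinate; its positivity is the condition Re \<tau> < Im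
      \<tau>.\<close>
    define \<kappa> where "\<kappa> = 1 - Re \<tau> / Im \<tau>"
    have \<kappa>: "\<kappa> > 0" using nc(1,2) by (simp add: \<kappa>_def)
    have "\<not> \<epsilon> * \<kappa> + Re w \<ge> 1"
    proof
      assume *: "\<epsilon> * \<kappa> + Re w \<ge> 1"
      define e where "e = (1 - Re w) / \<kappa>"
      obtain t k where t: "0 \<le> t" "t \<le> 1" "(Im (coords \<tau> (base_point e)) - Im w) + t = of_int k" using frac by blast
      have "1 - Re w \<le> \<epsilon> * \<kappa>" using * by linarith
      then have e: "0 < e" "e \<le> \<epsilon>" using w \<kappa> by (simp_all add: e_def pos_divide_le_eq)
      have "Re (coords \<tau> (base_point e)) - Re w = - 1" using \<kappa> by (simp add: e_def \<kappa>_def[symmetric])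
      then have "coords \<tau> (base_point e) + t *\<^sub>R p - w \<in> gauss_ints"
        unfolding gauss_ints_iff using t(3) pi
        by (metis Ints_1 Ints_minus Ints_of_int add_diff_eq add.commute add_0 diff_add_eq
          plus_complex.sel minus_complex.sel scaleR_complex.sel imaginary_unit.sel mult.right_neutral mult_zero_right)
      then show False using hit[OF e t(1,2)] by blast
    qed
    moreover have "\<epsilon> * \<kappa> > 0" using eps \<kappa> by simp
    ultimately show ?thesis using False w by (simp add: \<tau>_def w_def \<kappa>_def)
  qed
qed

text \<open>All marked points lie on the same side of the straight loop in its strip, so the winding
  of theta along the loop is the same for all of them.\<close>

lemma marked_loop_log_increments:
  fixes z :: "complex ^ 'n::finite"
  assumes x: "(\<tau>, z) \<in> torelli o1" and loop: "marked_loop o1 per (\<tau>, z) \<Gamma>"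
    and per: "\<And>\<tau>. per \<tau> = from_coords \<tau> p" and p: "p \<in> {1, \<i>}"
    and m: "continuous_on UNIV m" "\<And>u. theta \<tau> (u + per \<tau>) = exp (m u) * theta \<tau> u"
    and L: "\<And>i. continuous_on {0..1} (L i)" "\<And>i t. t \<in> {0..1} \<Longrightarrow> exp (L i t) = theta \<tau> (\<Gamma> t - z $ i)"
  obtains \<kappa> where "\<And>i. L i 1 - L i 0 = m (\<Gamma> 0 - z $ i) + \<kappa>"
proof -
  have \<tau>: "Im \<tau> > 0" using x by (simp add: torelli_def)
  have th: "continuous_on UNIV (theta \<tau>)"
    using holomorphic_on_imp_continuous_on[OF theta_holomorphic[OF \<tau>]] .
  obtain c G \<epsilon> where c: "path c" "path_image c \<subseteq> torelli o1" "pathstart c \<in> normalized_configs o1" "pathfinish c = (\<tau>, z)"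
    and G: "continuous_on ({0..1} \<times> {0..1}) G"
    and Gnp: "\<And>s t. s \<in> {0..1} \<Longrightarrow> t \<in> {0..1} \<Longrightarrow> G (s, t) \<notin> punctures (c s)"
    and Gp: "\<And>s. s \<in> {0..1} \<Longrightarrow> G (s, 1) = G (s, 0) + per (fst (c s))"
    and \<epsilon>: "small_for (c 0) (per (fst (c 0))) \<epsilon>"
    and G0: "\<And>t. t \<in> {0..1} \<Longrightarrow> G (0, t) = straight_loop \<epsilon> (per (fst (c 0))) t"
    and G1: "\<And>t. t \<in> {0..1} \<Longrightarrow> G (1, t) = \<Gamma> t"
    using loop unfolding marked_loop_def by blast
  have c0: "c 0 \<in> normalized_configs o1" and c1: "c 1 = (\<tau>, z)"
    using c by (auto simp: pathstart_def pathfinish_def)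
  have cont_c: "continuous_on {0..1} c" using c(1) by (simp add: path_def)
  have Imc: "Im (fst (c s)) > 0" if "s \<in> {0..1}" for s
  proof -
    have "c s \<in> torelli o1" using c(2) that by (auto simp: path_image_def)
    then show ?thesis by (auto simp: torelli_def)
  qed
  \<comment> \<open>The loop relative to the marked point \<open>i\<close>, read in the coordinates
    of the moving lattice and redrawn in the plane of the final \<tau>. The marked point thereby
    stays at 0, and the punctures belonging to it stay at the fixed lattice.\<close>
  define H where "H i = (\<lambda>x. from_coords \<tau> (coords (fst (c (fst x))) (G x - snd (c (fst x)) $ i)))" for i
  have H: "continuous_on ({0..1} \<times> {0..1}) (H i)" for i
    unfolding H_def using Imc
    by (intro continuous_on_from_coords continuous_on_coords continuous_intros G
        continuous_on_compose2[OF cont_c continuous_on_fst[OF continuous_on_id]]) fastforce+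
  have H0: "theta \<tau> (H i (s, t)) \<noteq> 0" if st: "s \<in> {0..1}" "t \<in> {0..1}" for i s t
    using Gnp[OF st] Imc[OF st(1)] \<tau>
    by (auto simp: theta_eq_0_iff H_def coords_in_gauss_ints_iff punctures_iff)
  have Hp: "H i (s, 1) = H i (s, 0) + per \<tau>" if s: "s \<in> {0..1}" for i s
    using Gp[OF s] Imc[OF s] by (simp add: H_def per coords_add coords_diff from_coords_add from_coords_diff)
  have H1: "H i (1, t) = \<Gamma> t - z $ i" if t: "t \<in> {0..1}" for i t
    using G1[OF t] \<tau> by (simp add: H_def c1)
  define b where "b = coords (fst (c 0)) (base_point \<epsilon>)"
  define w where "w i = coords (fst (c 0)) (snd (c 0) $ i)" for i
  have H_start: "H i (0, t) = from_coords \<tau> (b + t *\<^sub>R p - w i)" if t: "t \<in> {0..1}" for i t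
    using G0[OF t] Imc[of 0] by (simp add: H_def per coords_diff coords_straight_loop b_def w_def)
  have strip: "if p = 1 then Im (b - w i) \<in> {-1<..<0} else Re (b - w i) \<in> {-1<..<0}" for i
    unfolding b_def w_def by (rule small_for_strip[OF c0 \<epsilon>[unfolded per] p])
  have "\<exists>L0. continuous_on {0..1} L0 \<and> (\<forall>t\<in>{0..1}. exp (L0 t) = theta \<tau> (H i (0, t)))" for i
  proof -
    have "continuous_on {0..1} (\<lambda>t. theta \<tau> (H i (0, t)))"
      by (intro continuous_on_compose2[OF th] continuous_on_compose2[OF H] continuous_intros) auto
    then show ?thesis using H0[of 0 _ i] ex_path_log[of "\<lambda>t. theta \<tau> (H i (0, t))"] by (metis atLeastAtMost_iff order_refl zero_le_one)
  qed
  then obtain L0 where L0: "\<And>i. continuous_on {0..1} (L0 i)" "\<And>i t. t \<in> {0..1} \<Longrightarrow> exp (L0 i t) = theta \<tau> (H i (0, t))"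
    by metis
  have eq1: "L i 1 - L i 0 - m (H i (1, 0)) = L0 i 1 - L0 i 0 - m (H i (0, 0))" for i
  proof (rule log_increment_homotopy[OF th m H[of i] H0 Hp L0(1)[of i] L0(2)[of _ i] L(1)[of i]])
    show "exp (L i t) = theta \<tau> (H i (1, t))" if "t \<in> {0..1}" for t
      using L(2)[OF that] H1[OF that] by simp
  qed auto
  have eq2: "L0 j 1 - L0 j 0 - m (H j (0, 0)) = L0 i 1 - L0 i 0 - m (H i (0, 0))" for i j
  proof -
    \<comment> \<open>The marked point \<open>i\<close> slides to \<open>j\<close> along a segment
      in coordinates. The strip condition is convex, so the loop meets no lattice translate of the
      sliding point.\<close>
    define K where "K x = from_coords \<tau> (b + snd x *\<^sub>R p - ((1 - fst x) *\<^sub>R w i + fst x *\<^sub>R w j))" for x :: "real \<times> real"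
    have Ki: "K (0, t) = H i (0, t)" and Kj: "K (1, t) = H j (0, t)" if "t \<in> {0..1}" for t
      using H_start[OF that] by (simp_all add: K_def)
    have "L0 j 1 - L0 j 0 - m (K (1, 0)) = L0 i 1 - L0 i 0 - m (K (0, 0))"
    proof (rule log_increment_homotopy[OF th m])
      show "continuous_on ({0..1} \<times> {0..1}) K"
        unfolding K_def by (intro continuous_intros)
      show "K (s, 1) = K (s, 0) + per \<tau>" for s
        by (simp add: K_def per from_coords_add from_coords_diff algebra_simps)
      show "theta \<tau> (K (s, t)) \<noteq> 0" if s: "s \<in> {0..1}" for s t
      proof -
        have conv: "(1 - s) * a + s * a' \<in> {-1<..<0}" if "a \<in> {-1<..<0}" "a' \<in> {-1<..<0}" for a a' :: real
          using convexD[of "{-1<..<0::real}" a a' "1 - s" s] that s by auto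
        have not_int: "y \<notin> \<int>" if "y \<in> {-1<..<0::real}" for y
          using that by (auto elim!: Ints_cases)
        define y where "y = b + t *\<^sub>R p - ((1 - s) *\<^sub>R w i + s *\<^sub>R w j)"
        have "y \<notin> gauss_ints"
        proof (cases "p = 1")
          case True
          have "Im y = (1 - s) * Im (b - w i) + s * Im (b - w j)"
            by (simp add: y_def True algebra_simps)
          then have "Im y \<in> {-1<..<0}" using conv strip[of i] strip[of j] True by simp
          then show ?thesis using not_int by (auto simp: gauss_ints_iff)
        next
          case False
          then have "p = \<i>" using p by auto
          then have "Re y = (1 - s) * Re (b - w i) + s * Re (b - w j)"
            by (simp add: y_def algebra_simps)
          then have "Re y \<in> {-1<..<0}" using conv strip[of i] strip[of j] False by simp
          then show ?thesis using not_int by (auto simp: gauss_ints_iff)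
        qed
        then show ?thesis using \<tau> by (simp add: theta_eq_0_iff K_def y_def)
      qed
    qed (use L0 Ki Kj in auto)
    then show ?thesis using Ki[of 0] Kj[of 0] by simp
  qed
  \<comment> \<open>By \<open>eq2\<close> the winding does not depend on the index;
    \<open>undefined\<close> is an arbitrary element of the index type, used as reference.\<close>
  define \<kappa> where "\<kappa> = L0 undefined 1 - L0 undefined 0 - m (H undefined (0, 0))"
  have "L i 1 - L i 0 = m (\<Gamma> 0 - z $ i) + \<kappa>" for i
  proof -
    have "L i 1 - L i 0 - m (H i (1, 0)) = \<kappa>"
      using eq1[of i] eq2[of i undefined] by (simp only: \<kappa>_def)
    moreover have "H i (1, 0) = \<Gamma> 0 - z $ i" using H1[of 0 i] by simp
    ultimately show ?thesis by (simp only: diff_eq_eq add.commute)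
  qed
  then show thesis using that by blast
qed


section \<open>Existence of marked loops\<close>

definition gauss_orbit :: "complex \<Rightarrow> complex set" where
  "gauss_orbit w = (\<lambda>g. w + g) ` gauss_ints"

text \<open>For \<open>r > 0\<close>, a cutoff equal to 1 up to distance \<open>r\<close> from the
  orbit and 0 beyond \<open>2 * r\<close>. A piecewise linear profile with Lipschitz constant 1/r
  suffices, since only continuity and injectivity of \<open>push\<close> matter.\<close>

definition bump :: "real \<Rightarrow> complex \<Rightarrow> complex \<Rightarrow> real" where
  "bump r w u = max 0 (min 1 (2 - infdist u (gauss_orbit w) / r))"

text \<open>A periodic isotopy of the plane that moves each marked point \<open>w j\<close> by \<open>d j\<close>.\<close>

definition push :: "real \<Rightarrow> ('n::finite \<Rightarrow> complex) \<Rightarrow> ('n \<Rightarrow> complex) \<Rightarrow> complex \<Rightarrow> complex" where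
  "push r w d u = u + (\<Sum>j\<in>UNIV. bump r (w j) u *\<^sub>R d j)"

lemma gauss_orbit_nonempty: "gauss_orbit w \<noteq> {}"
  and closed_gauss_orbit: "closed (gauss_orbit w)"
  unfolding gauss_orbit_def using closed_translation[OF closed_gauss_ints] by (auto intro: lattice_0)

lemma gauss_orbit_iff: "v \<in> gauss_orbit w \<longleftrightarrow> v - w \<in> gauss_ints"
proof
  assume "v - w \<in> gauss_ints"
  then show "v \<in> gauss_orbit w"
    unfolding gauss_orbit_def by (rule rev_image_eqI) simp
qed (auto simp: gauss_orbit_def)

lemma infdist_gauss_orbit_periodic:
  assumes g: "g \<in> gauss_ints"
  shows "infdist (u + g) (gauss_orbit w) = infdist u (gauss_orbit w)"
proof -
  have "gauss_orbit w = (\<lambda>a. a + g) ` gauss_orbit w"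
  proof (intro equalityI subsetI)
    fix v assume "v \<in> gauss_orbit w"
    then have "v - g - w \<in> gauss_ints"
      using lattice_diff[OF _ g, of "v - w"] by (simp add: gauss_orbit_iff algebra_simps)
    then have "v - g \<in> gauss_orbit w" by (simp add: gauss_orbit_iff)
    then show "v \<in> (\<lambda>a. a + g) ` gauss_orbit w" by (rule rev_image_eqI) simp
  next
    fix v assume "v \<in> (\<lambda>a. a + g) ` gauss_orbit w"
    then obtain a where a: "v = a + g" "a - w \<in> gauss_ints" by (auto simp: gauss_orbit_iff)
    have "v - w = (a - w) + g" using a(1) by simp
    then show "v \<in> gauss_orbit w"
      using lattice_add[OF a(2) g] by (simp only: gauss_orbit_iff)
  qed
  then have "dist (u + g) ` gauss_orbit w = dist (u + g) ` (\<lambda>a. a + g) ` gauss_orbit w"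
    by (rule arg_cong)
  also have "\<dots> = dist u ` gauss_orbit w" by (simp add: image_image)
  finally show ?thesis
    by (simp add: infdist_notempty gauss_orbit_nonempty)
qed

lemma bump_periodic: "g \<in> gauss_ints \<Longrightarrow> bump r w (u + g) = bump r w u"
  by (simp add: bump_def infdist_gauss_orbit_periodic)

lemma bump_lipschitz:
  assumes "r > 0"
  shows "\<bar>bump r w u - bump r w v\<bar> \<le> dist u v / r"
proof -
  have "\<bar>infdist u (gauss_orbit w) / r - infdist v (gauss_orbit w) / r\<bar> \<le> dist u v / r"
    using infdist_triangle_abs[of u "gauss_orbit w" v] assms
    by (simp add: divide_right_mono flip: diff_divide_distrib)
  then show ?thesis
    unfolding bump_def by linarith
qed

lemma continuous_on_bump [continuous_intros]:
  "r \<noteq> 0 \<Longrightarrow> continuous_on S f \<Longrightarrow> continuous_on S (\<lambda>x. bump r w (f x))"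
  unfolding bump_def by (intro continuous_intros) auto

lemma push_periodic: "g \<in> gauss_ints \<Longrightarrow> push r w d (u + g) = push r w d u + g"
  by (simp add: push_def bump_periodic)

text \<open>The displacement is Lipschitz with constant at most (r/2)/r = 1/2, and the identity plus
  a contraction is injective.\<close>

lemma inj_push:
  assumes r: "r > 0" and d: "(\<Sum>j\<in>UNIV. norm (d j)) \<le> r / 2"
  shows "inj (push r w d)"
proof (rule injI)
  fix u v assume eq: "push r w d u = push r w d v"
  have "u - v = (\<Sum>j\<in>UNIV. (bump r (w j) v - bump r (w j) u) *\<^sub>R d j)"
    using eq by (simp add: push_def sum_subtractf scaleR_diff_left algebra_simps)
  then have "norm (u - v) \<le> (\<Sum>j\<in>UNIV. norm ((bump r (w j) v - bump r (w j) u) *\<^sub>R d j))"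
    by (metis norm_sum)
  also have "\<dots> \<le> (\<Sum>j\<in>UNIV. dist v u / r * norm (d j))"
    unfolding norm_scaleR by (intro sum_mono mult_right_mono bump_lipschitz[OF r] norm_ge_zero)
  also have "\<dots> = dist v u / r * (\<Sum>j\<in>UNIV. norm (d j))" by (simp add: sum_distrib_left)
  also have "\<dots> \<le> dist v u / r * (r / 2)" using d r by (intro mult_left_mono) auto
  also have "\<dots> = norm (u - v) / 2" using r by (simp add: dist_norm norm_minus_commute)
  finally show "u = v" by simp
qed

text \<open>Within \<open>r\<close> of \<open>w i\<close> the bump of index \<open>i\<close> equals
  1, while the other orbits are still more than 3r - r = 2r away, so their bumps vanish.\<close>

lemma push_marked:
  assumes r: "r > 0" and sep: "\<And>j. j \<noteq> i \<Longrightarrow> infdist (w i) (gauss_orbit (w j)) \<ge> 3 * r"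
    and v: "dist v (w i) < r"
  shows "push r w d v = v + d i"
proof -
  have "bump r (w j) v *\<^sub>R d j = (if j = i then d i else 0)" for j
  proof (cases "j = i")
    case True
    have "infdist v (gauss_orbit (w i)) \<le> dist v (w i)"
      by (rule infdist_le) (simp add: gauss_orbit_iff)
    then have "infdist v (gauss_orbit (w i)) / r \<le> 1" using v r by simp
    then show ?thesis using True by (simp add: bump_def)
  next
    case False
    have "3 * r \<le> infdist v (gauss_orbit (w j)) + dist (w i) v"
      using sep[OF False] infdist_triangle[of "w i" "gauss_orbit (w j)" v] by linarith
    then have "infdist v (gauss_orbit (w j)) / r \<ge> 2" using v r by (simp add: dist_commute pos_le_divide_eq)
    then show ?thesis using False by (simp add: bump_def)
  qed
  then show ?thesis by (simp add: push_def)
qed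

lemma ex_separation:
  fixes w :: "'n::finite \<Rightarrow> complex"
  assumes "\<And>i j. i \<noteq> j \<Longrightarrow> w i - w j \<notin> gauss_ints"
  obtains r where "r > 0" "\<And>i j. i \<noteq> j \<Longrightarrow> infdist (w i) (gauss_orbit (w j)) \<ge> 3 * r"
proof
  \<comment> \<open>The element 1 keeps the set nonempty when there is only one index.\<close>
  define A where "A = insert 1 ((\<lambda>(i, j). infdist (w i) (gauss_orbit (w j))) ` {(i, j). i \<noteq> j})"
  have fin: "finite A" unfolding A_def by simp
  have "infdist (w i) (gauss_orbit (w j)) > 0" if "i \<noteq> j" for i j
    using assms[OF that] by (intro infdist_pos_not_in_closed closed_gauss_orbit gauss_orbit_nonempty) (simp add: gauss_orbit_iff)
  then show "Min A / 3 > 0" using fin by (auto simp: A_def)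
  show "3 * (Min A / 3) \<le> infdist (w i) (gauss_orbit (w j))" if "i \<noteq> j" for i j
    using fin that by (auto simp: A_def intro!: Min_le)
qed

section \<open>Transport of marked loops along paths of configurations\<close>

lemma marked_loopD:
  assumes "marked_loop o1 per x \<Gamma>"
  shows "continuous_on {0..1} \<Gamma>" "\<Gamma> 1 = \<Gamma> 0 + per (fst x)" "\<And>t. t \<in> {0..1} \<Longrightarrow> \<Gamma> t \<notin> punctures x"
proof -
  obtain c and G :: "real \<times> real \<Rightarrow> complex" and \<epsilon> where c: "pathfinish c = x" and G: "continuous_on ({0..1} \<times> {0..1}) G"
    and Gnp: "\<forall>s\<in>{0..1}. \<forall>t\<in>{0..1}. G (s, t) \<notin> punctures (c s)"
    and Gp: "\<forall>s\<in>{0..1}. G (s, 1) = G (s, 0) + per (fst (c s))"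
    and G1: "\<forall>t\<in>{0..1}. G (1, t) = \<Gamma> t"
    using assms unfolding marked_loop_def by blast
  have "continuous_on {0..1} (\<lambda>t. G (1, t))"
    by (intro continuous_on_compose2[OF G] continuous_intros) auto
  then show "continuous_on {0..1} \<Gamma>"
    by (rule continuous_on_eq) (use G1 in auto)
  have c1: "c 1 = x" using c by (simp add: pathfinish_def)
  show "\<Gamma> 1 = \<Gamma> 0 + per (fst x)"
    using Gp[rule_format, of 1] G1[rule_format, of 0] G1[rule_format, of 1] c1 by simp
  show "\<Gamma> t \<notin> punctures x" if "t \<in> {0..1}" for t
    using Gnp[rule_format, of 1 t] G1[rule_format, of t] c1 that by simp
qed

lemma marked_loop_extend:
  assumes loop: "marked_loop o1 per x \<Gamma>"
    and c': "path c'" "path_image c' \<subseteq> torelli o1" "pathstart c' = x"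
    and G': "continuous_on ({0..1} \<times> {0..1}) G'"
      "\<And>s t. s \<in> {0..1} \<Longrightarrow> t \<in> {0..1} \<Longrightarrow> G' (s, t) \<notin> punctures (c' s)"
      "\<And>s. s \<in> {0..1} \<Longrightarrow> G' (s, 1) = G' (s, 0) + per (fst (c' s))"
      "\<And>t. t \<in> {0..1} \<Longrightarrow> G' (0, t) = \<Gamma> t"
  shows "marked_loop o1 per (pathfinish c') (\<lambda>t. G' (1, t))"
proof -
  obtain c G \<epsilon> where c: "path c" "path_image c \<subseteq> torelli o1" "pathstart c \<in> normalized_configs o1" "pathfinish c = x"
    and G: "continuous_on ({0..1} \<times> {0..1}) G"
      "\<forall>s\<in>{0..1}. \<forall>t\<in>{0..1}. G (s, t) \<notin> punctures (c s)"
      "\<forall>s\<in>{0..1}. G (s, 1) = G (s, 0) + per (fst (c s))"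
    and \<epsilon>: "small_for (c 0) (per (fst (c 0))) \<epsilon>"
    and G0: "\<forall>t\<in>{0..1}. G (0, t) = straight_loop \<epsilon> (per (fst (c 0))) t"
    and G1: "\<forall>t\<in>{0..1}. G (1, t) = \<Gamma> t"
    using loop unfolding marked_loop_def by blast
  define H where "H = (\<lambda>x. if fst x \<le> 1 / 2 then G (2 * fst x, snd x) else G' (2 * fst x - 1, snd x))"
  have "continuous_on ({0..1/2} \<times> {0..1} \<union> {1/2..1} \<times> {0..1}) H"
    unfolding H_def
  proof (rule continuous_on_cases)
    show "continuous_on ({0..1/2} \<times> {0..1}) (\<lambda>x. G (2 * fst x, snd x))"
      by (intro continuous_on_compose2[OF G(1)] continuous_intros) auto
    show "continuous_on ({1/2..1} \<times> {0..1}) (\<lambda>x. G' (2 * fst x - 1, snd x))"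
      by (intro continuous_on_compose2[OF G'(1)] continuous_intros) auto
    show "\<forall>x. x \<in> {0..1/2} \<times> {0..1} \<and> \<not> fst x \<le> 1 / 2 \<or> x \<in> {1/2..1} \<times> {0..1} \<and> fst x \<le> 1 / 2 \<longrightarrow>
        G (2 * fst x, snd x) = G' (2 * fst x - 1, snd x)"
    proof (intro allI impI)
      fix x :: "real \<times> real"
      assume "x \<in> {0..1/2} \<times> {0..1} \<and> \<not> fst x \<le> 1 / 2 \<or> x \<in> {1/2..1} \<times> {0..1} \<and> fst x \<le> 1 / 2"
      then have x: "2 * fst x = 1" "snd x \<in> {0..1}" by auto
      show "G (2 * fst x, snd x) = G' (2 * fst x - 1, snd x)"
        unfolding x(1) using G1 G'(4)[OF x(2)] x(2) by simp
    qed
  qed (intro closed_Times closed_real_atLeastAtMost)+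
  moreover have "{0..1/2} \<times> {0..1} \<union> {1/2..1} \<times> {0..1} = {0..1::real} \<times> {0..1::real}" by auto
  ultimately have H: "continuous_on ({0..1} \<times> {0..1}) H" by simp
  show ?thesis
    unfolding marked_loop_def
  proof (intro exI conjI)
    show "path (c +++ c')" using c c' by (simp add: path_join_imp)
    show "path_image (c +++ c') \<subseteq> torelli o1" using c(2) c'(2) path_image_join_subset[of c c'] by blast
    show "\<forall>s\<in>{0..1}. \<forall>t\<in>{0..1}. H (s, t) \<notin> punctures ((c +++ c') s)"
      using G(2) G'(2) by (auto simp: H_def joinpaths_def)
    show "\<forall>s\<in>{0..1}. H (s, 1) = H (s, 0) + per (fst ((c +++ c') s))"
      using G(3) G'(3) by (auto simp: H_def joinpaths_def)
    have start: "(c +++ c') 0 = c 0" by (simp add: joinpaths_def)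
    show "small_for ((c +++ c') 0) (per (fst ((c +++ c') 0))) \<epsilon>"
      using \<epsilon> by (simp only: start)
    show "\<forall>t\<in>{0..1}. H (0, t) = straight_loop \<epsilon> (per (fst ((c +++ c') 0))) t"
      using G0 unfolding start by (simp add: H_def)
    show "\<forall>t\<in>{0..1}. H (1, t) = G' (1, t)" by (simp add: H_def)
  qed (use c c' H in auto)
qed

text \<open>Near \<open>x0\<close> the segment from \<open>x\<close> to \<open>y\<close> stays in
  the Torelli space, and the motion of the marked points along it, in coordinates, is realized by
  the periodic maps \<open>push\<close>. These are injective and carry punctures to punctures, so
  the image of a loop that avoids the punctures avoids the moved ones. The statement is symmetric in
  \<open>x\<close> and \<open>y\<close> and thus fits an induction over a connected set.\<close>

lemma marked_loop_locally_transportable: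
  fixes x0 :: "'n::finite config"
  assumes x0: "x0 \<in> torelli o1" and per: "\<And>\<tau>. per \<tau> = from_coords \<tau> p" and p: "p \<in> gauss_ints"
  shows "\<exists>T. openin (top_of_set (torelli o1)) T \<and> x0 \<in> T \<and>
    (\<forall>x\<in>T. \<forall>y\<in>T. (\<exists>\<Gamma>. marked_loop o1 per x \<Gamma>) \<longrightarrow> (\<exists>\<Gamma>. marked_loop o1 per y \<Gamma>))"
proof -
  define W where "W x i = coords (fst x) (snd x $ i)" for x :: "'n config" and i
  define w where "w = W x0"
  have Im0: "Im (fst x0) > 0" using x0 by (auto simp: torelli_def)
  have "w i - w j \<notin> gauss_ints" if "i \<noteq> j" for i j
    using x0 that Im0 by (auto simp: w_def W_def torelli_def coords_in_gauss_ints_iff simp flip: coords_diff)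
  then obtain r where r: "r > 0" and sep: "\<And>i j. i \<noteq> j \<Longrightarrow> infdist (w i) (gauss_orbit (w j)) \<ge> 3 * r"
    using ex_separation by metis
  define N where "N = real CARD('n)"
  have N: "N \<ge> 1" by (simp add: N_def Suc_leI)
  \<comment> \<open>Each marked point is displaced by at most 2 \<delta>, so all displacements
    together amount to at most r/2, the bound in \<open>inj_push\<close>; and \<delta> < r is what
    \<open>push_marked\<close> asks for.\<close>
  define \<delta> where "\<delta> = r / (4 * N)"
  have \<delta>: "\<delta> > 0" "\<delta> < r" using r N by (simp_all add: \<delta>_def field_simps) 
  define U where "U = {x :: 'n config. Im (fst x) > 0}"
  have U: "open U" unfolding U_def by (intro open_Collect_less continuous_intros)
  have contW: "continuous_on U (\<lambda>x. W x i)" for i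
    unfolding W_def by (intro continuous_intros) (auto simp: U_def)
  have "open (\<Inter>i. U \<inter> (\<lambda>x. W x i) -` ball (w i) \<delta>)"
    by (intro open_INT finite_class.finite_UNIV ballI continuous_open_preimage contW U open_ball)
  moreover have "x0 \<in> (\<Inter>i. U \<inter> (\<lambda>x. W x i) -` ball (w i) \<delta>)"
    using Im0 \<delta> by (auto simp: U_def w_def)
  ultimately obtain \<eta> where \<eta>: "\<eta> > 0" "ball x0 \<eta> \<subseteq> (\<Inter>i. U \<inter> (\<lambda>x. W x i) -` ball (w i) \<delta>)"
    using openE by blast
  have near: "Im (fst x) > 0" "dist (W x i) (w i) < \<delta>" if "x \<in> ball x0 \<eta>" for x i
    using \<eta>(2) that by (auto simp: U_def dist_commute)
  have in_torelli: "x \<in> torelli o1" if x: "x \<in> ball x0 \<eta>" "snd x $ o1 = 0" for x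
  proof -
    have "snd x $ i - snd x $ j \<notin> lattice (fst x)" if ij: "i \<noteq> j" for i j
    proof
      assume "snd x $ i - snd x $ j \<in> lattice (fst x)"
      then have g: "W x i - W x j \<in> gauss_ints"
        using near(1)[OF x(1)] by (simp add: W_def coords_in_gauss_ints_iff flip: coords_diff)
      have "infdist (w i) (gauss_orbit (w j)) \<le> dist (w i) (w j + (W x i - W x j))"
        using g by (intro infdist_le) (simp add: gauss_orbit_iff)
      also have "\<dots> = norm ((w i - W x i) + (W x j - w j))" by (simp add: dist_norm algebra_simps)
      also have "\<dots> \<le> dist (W x i) (w i) + dist (W x j) (w j)"
        by (metis dist_norm norm_minus_commute norm_triangle_ineq)
      also have "\<dots> < r + r" using near(2)[OF x(1), of i] near(2)[OF x(1), of j] \<delta> by linarith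
      finally show False using sep[OF ij] r by linarith
    qed
    then show ?thesis using near(1)[OF x(1)] x(2) by (simp add: torelli_def case_prod_unfold)
  qed
  show ?thesis
  proof (intro exI[of _ "torelli o1 \<inter> ball x0 \<eta>"] conjI ballI impI)
    fix x y assume x: "x \<in> torelli o1 \<inter> ball x0 \<eta>" and y: "y \<in> torelli o1 \<inter> ball x0 \<eta>"
      and "\<exists>\<Gamma>. marked_loop o1 per x \<Gamma>"
    then obtain \<Gamma> where loop: "marked_loop o1 per x \<Gamma>" by blast
    note \<Gamma> = marked_loopD[OF loop]
    have Imx: "Im (fst x) > 0" using near x by auto
    define c where "c = linepath x y"
    have cball: "c s \<in> ball x0 \<eta>" if "s \<in> {0..1}" for s
    proof -
      have "c s \<in> closed_segment x y" using that by (auto simp: c_def linepath_in_path)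
      then show ?thesis using closed_segment_subset[of x "ball x0 \<eta>" y] x y by auto
    qed
    have ctor: "c s \<in> torelli o1" if "s \<in> {0..1}" for s
    proof (rule in_torelli[OF cball[OF that]])
      have "snd x $ o1 = 0" "snd y $ o1 = 0" using x y by (auto simp: torelli_def)
      then show "snd (c s) $ o1 = 0" by (simp add: c_def linepath_def)
    qed
    define d where "d s j = W (c s) j - W x j" for s j
    define G where "G = (\<lambda>a. from_coords (fst (c (fst a))) (push r w (d (fst a)) (coords (fst x) (\<Gamma> (snd a)))))"
    have sum_d: "(\<Sum>j\<in>UNIV. norm (d s j)) \<le> r / 2" if s: "s \<in> {0..1}" for s
    proof -
      have "norm (d s j) \<le> 2 * \<delta>" for j
      proof -
        have "norm (d s j) \<le> dist (W (c s) j) (w j) + dist (W x j) (w j)"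
          unfolding d_def using dist_triangle2[of "W (c s) j" "W x j" "w j"] by (simp add: dist_norm)
        then show ?thesis using near(2)[OF cball[OF s], of j] near(2)[of x j] x by auto
      qed
      then have "(\<Sum>j\<in>UNIV. norm (d s j)) \<le> (\<Sum>j\<in>(UNIV :: 'n set). 2 * \<delta>)" by (intro sum_mono)
      also have "\<dots> = r / 2" using N by (simp add: \<delta>_def N_def)
      finally show ?thesis .
    qed
    have cont_c: "continuous_on S c" for S unfolding c_def by (rule continuous_on_linepath)
    have "c ` {0..1} \<subseteq> U"
      unfolding U_def by (rule image_subsetI, rule CollectI, rule near(1), rule cball)
    then have cont_d: "continuous_on {0..1} (\<lambda>s. d s j)" for j
      unfolding d_def by (intro continuous_intros continuous_on_compose2[OF contW cont_c])
    have "marked_loop o1 per (pathfinish c) (\<lambda>t. G (1, t))"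
    proof (rule marked_loop_extend[OF loop])
      show "path c" "pathstart c = x" by (simp_all add: c_def)
      show "path_image c \<subseteq> torelli o1" using ctor by (auto simp: path_image_def)
      have "continuous_on ({0..1} \<times> {0..1}) (\<lambda>a. \<Gamma> (snd a))"
        by (intro continuous_intros continuous_on_compose2[OF \<Gamma>(1)]) auto
      moreover have "continuous_on ({0..1} \<times> {0..1}) (\<lambda>a. d (fst a) j)" for j
        by (intro continuous_on_compose2[OF cont_d] continuous_intros) auto
      ultimately show "continuous_on ({0..1} \<times> {0..1}) G"
        unfolding G_def push_def using r Imx
        by (intro continuous_intros continuous_on_compose2[OF cont_c]) auto
      show "G (0, t) = \<Gamma> t" for t
        using Imx by (simp add: G_def c_def linepath_def d_def push_def)
      show "G (s, 1) = G (s, 0) + per (fst (c s))" for s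
        using Imx p by (simp add: G_def \<Gamma>(2) per coords_add push_periodic from_coords_add)
      show "G (s, t) \<notin> punctures (c s)" if s: "s \<in> {0..1}" and t: "t \<in> {0..1}" for s t
      proof
        have Ims: "Im (fst (c s)) > 0" using near(1)[OF cball[OF s]] .
        assume "G (s, t) \<in> punctures (c s)"
        then obtain i where "G (s, t) - snd (c s) $ i \<in> lattice (fst (c s))" by (auto simp: punctures_iff)
        then have "coords (fst (c s)) (G (s, t) - snd (c s) $ i) \<in> gauss_ints"
          using Ims by (simp add: coords_in_gauss_ints_iff)
        then have g: "push r w (d s) (coords (fst x) (\<Gamma> t)) - W (c s) i \<in> gauss_ints" (is "?g \<in> _")
          using Ims by (simp add: coords_diff G_def W_def)
        \<comment> \<open>A collision would give two points with the same image under
          \<open>push\<close>: the point of the loop and a translate of the marked point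
          \<open>i\<close> at \<open>x\<close>. By injectivity the original loop would already meet
          a puncture.\<close>
        have "push r w (d s) (W x i) = W x i + d s i"
          using near(2)[of x i] x \<delta>(2) by (intro push_marked[OF r] sep) auto
        then have "push r w (d s) (W x i + ?g) = push r w (d s) (coords (fst x) (\<Gamma> t))"
          using g by (simp add: push_periodic d_def)
        then have "W x i + ?g = coords (fst x) (\<Gamma> t)"
          by (rule injD[OF inj_push[OF r sum_d[OF s]]])
        then have "coords (fst x) (\<Gamma> t - snd x $ i) = ?g"
          unfolding coords_diff W_def by (metis add_diff_cancel_left')
        then have "\<Gamma> t - snd x $ i \<in> lattice (fst x)"
          using g Imx by (metis coords_in_gauss_ints_iff less_irrefl)
        then show False using \<Gamma>(3)[OF t] by (auto simp: punctures_iff)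
      qed
    qed
    then show "\<exists>\<Gamma>. marked_loop o1 per y \<Gamma>" by (auto simp: c_def)
  qed (use x0 \<eta> in auto)
qed

lemma ex_normalized_marked_loop:
  assumes per: "\<And>\<tau>. per \<tau> = from_coords \<tau> p" and p: "p \<in> {1, \<i>}"
  shows "\<exists>x\<in>torelli (o1 :: 'n::finite). \<exists>\<Gamma>. marked_loop o1 per x \<Gamma>"
proof -
  \<comment> \<open>Points on the diagonal have equal coordinates, so one configuration serves both
    directions \<open>p\<close>. The values are distinct and at most 1/2; with an offset
    \<open>e\<close> of at most 1/4, the number \<open>- e - s i\<close> lies strictly between -1
    and 0 and is never an integer.\<close>
  define s where "s i = (if i = o1 then 0 else 1 / (2 + real (to_nat i)))" for i
  define x :: "'n config" where "x = (\<i>, \<chi> i. of_real (s i) + of_real (s i) * \<i>)"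
  have s: "0 \<le> s i" "s i \<le> 1 / 2" for i by (auto simp: s_def field_simps)
  have inj: "s i \<noteq> s j" if "i \<noteq> j" for i j
    using that inj_to_nat[where 'a = 'n] by (auto simp: s_def frac_eq_eq inj_eq add_nonneg_eq_0_iff)
  have not_int: "y \<notin> \<int>" if "-1 < y" "y < 1" "y \<noteq> 0" for y :: real
    using that by (auto elim!: Ints_cases)
  have x: "x \<in> torelli o1"
  proof -
    have "of_real (s i) + of_real (s i) * \<i> - (of_real (s j) + of_real (s j) * \<i>) \<notin> gauss_ints" if "i \<noteq> j" for i j
    proof -
      have "s i - s j \<notin> \<int>"
        using inj[OF that] s[of i] s[of j] by (intro not_int) auto
      then show ?thesis by (simp add: gauss_ints_iff)
    qed
    moreover have "s o1 = 0" by (simp add: s_def)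
    ultimately show ?thesis by (simp add: torelli_def x_def)
  qed
  have "s i \<in> {0..<1}" for i using s[of i] by auto
  then have xn: "x \<in> normalized_configs o1"
    using x unfolding normalized_configs_def x_def by (auto simp del: atLeastLessThan_iff)
  have np: "straight_loop e p t \<notin> punctures x" if e: "0 < e" "e \<le> 1/4" for e t
  proof -
    have "- e - s i \<notin> \<int>" for i using s[of i] e by (intro not_int) auto
    then have "straight_loop e p t - snd x $ i \<notin> gauss_ints" for i
      using p by (auto simp: gauss_ints_iff straight_loop_def base_point_def x_def)
    then show ?thesis by (simp add: punctures_iff) (simp add: x_def)
  qed
  have fx: "fst x = \<i>" by (simp add: x_def)
  have pi: "per \<i> = p" by (simp add: per from_coords_def complex_eq_iff)
  have "marked_loop o1 per x (straight_loop (1/4) p)"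
    unfolding marked_loop_def
  proof (intro exI[of _ "\<lambda>_. x"] exI[of _ "\<lambda>a. straight_loop (1/4) p (snd a)"] exI[of _ "1/4"] conjI)
    show "path (\<lambda>_. x)" by (simp add: path_def)
    show "continuous_on ({0..1} \<times> {0..1}) (\<lambda>a. straight_loop (1/4) p (snd a))"
      unfolding straight_loop_def by (intro continuous_intros)
    show "small_for x (per (fst x)) (1/4)"
      using np by (simp add: small_for_def fx pi)
    show "\<forall>s\<in>{0..1}. \<forall>t\<in>{0..1}. straight_loop (1/4) p (snd (s, t)) \<notin> punctures x"
      using np by simp
  qed (use x xn in \<open>auto simp: path_image_def pathstart_def pathfinish_def fx pi straight_loop_def\<close>)
  then show ?thesis using x by blast
qed

text \<open>The points with a marked loop form a nonempty set, and local transport in both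
  directions makes it open and closed in the connected Torelli space.\<close>

lemma ex_marked_loop:
  assumes x: "x \<in> torelli o1" and per: "\<And>\<tau>. per \<tau> = from_coords \<tau> p" and p: "p \<in> {1, \<i>}"
  shows "\<exists>\<Gamma>. marked_loop o1 per x \<Gamma>"
proof -
  obtain x1 \<Gamma>1 where x1: "x1 \<in> torelli o1" and \<Gamma>1: "marked_loop o1 per x1 \<Gamma>1"
    using ex_normalized_marked_loop[where per = per and p = p, OF per p] by blast
  have "p \<in> gauss_ints" using p by auto
  then show ?thesis
    using connected_induction_simple[OF connected_torelli x1 x, of "\<lambda>x. \<exists>\<Gamma>. marked_loop o1 per x \<Gamma>"]
      \<Gamma>1 marked_loop_locally_transportable[where per = per and p = p, OF _ per] by blast
qed


section \<open>The holonomy map and Veech's foliation\<close>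

lemma admissible_weighted_config:
  assumes "admissible \<alpha> o1" "(\<tau>, z) \<in> torelli o1"
  shows "weighted_config \<alpha> \<tau> z"
proof
  show "\<alpha> $ i > -1" for i
    using assms(1) by (cases "i = o1") (auto simp: admissible_def)
qed (use assms in \<open>auto simp: admissible_def torelli_def\<close>)

text \<open>By \<open>marked_loop_log_increments\<close> the increments are the multipliers plus a
  common \<kappa>, and the weights, of sum 0, annihilate \<kappa>. Every metric and every loop thus
  yields the same value, while the theta metric and a transported loop show that a value exists.
  Hypothesis \<open>m_sum\<close> expresses that the weighted multiplier does not depend on the base
  point.\<close>

lemma holonomy_along_eq:
  fixes \<alpha> :: "real ^ 'n::finite"
  assumes \<alpha>: "admissible \<alpha> o1" and x: "(\<tau>, z) \<in> torelli o1"
    and per: "\<And>\<tau>. per \<tau> = from_coords \<tau> p" and p: "p \<in> {1, \<i>}"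
    and m: "continuous_on UNIV m" "\<And>u. theta \<tau> (u + per \<tau>) = exp (m u) * theta \<tau> u"
    and m_sum: "\<And>u. (\<Sum>i\<in>UNIV. of_real (\<alpha> $ i) * m (u - z $ i)) = S"
  shows "holonomy_along \<alpha> o1 per (\<tau>, z) = exp (S + 2 * pi * \<i> * a_zero \<alpha> (\<tau>, z) * per \<tau>)"
proof -
  interpret weighted_config \<alpha> \<tau> z by (rule admissible_weighted_config[OF \<alpha> x])
  have unique: "\<rho> = exp (S + slope * per \<tau>)"
    if lam: "flat_cone_metric \<alpha> (\<tau>, z) lam" and loop: "marked_loop o1 per (\<tau>, z) \<Gamma>"
      and hol: "linear_holonomy lam \<Gamma> (per \<tau>) \<rho>" for lam \<Gamma> \<rho>
  proof -
    note \<Gamma> = marked_loopD[OF loop]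
    have "\<exists>L. continuous_on {0..1} L \<and> (\<forall>t\<in>{0..1}. exp (L t) = theta \<tau> (\<Gamma> t - z $ i))" for i
    proof -
      have "continuous_on {0..1} (\<lambda>t. theta \<tau> (\<Gamma> t - z $ i))"
        by (intro continuous_on_compose2[OF holomorphic_on_imp_continuous_on[OF theta_shift_holomorphic[of i UNIV]] \<Gamma>(1)]) auto
      moreover have "theta \<tau> (\<Gamma> t - z $ i) \<noteq> 0" if "t \<in> {0..1}" for t
        using theta_nonzero[OF \<Gamma>(3)[OF that]] .
      ultimately show ?thesis by (rule ex_path_log) auto
    qed
    then obtain L where L: "\<And>i. continuous_on {0..1} (L i)" "\<And>i t. t \<in> {0..1} \<Longrightarrow> exp (L i t) = theta \<tau> (\<Gamma> t - z $ i)"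
      by metis
    obtain \<kappa> where \<kappa>: "\<And>i. L i 1 - L i 0 = m (\<Gamma> 0 - z $ i) + \<kappa>"
      using marked_loop_log_increments[where per = per and p = p and L = L, OF x loop per p m L] by blast
    have "(\<Sum>i\<in>UNIV. of_real (\<alpha> $ i) * (L i 1 - L i 0)) = S + (\<Sum>i\<in>UNIV. of_real (\<alpha> $ i)) * \<kappa>"
      by (simp add: \<kappa> distrib_left sum.distrib m_sum sum_distrib_right)
    also have "(\<Sum>i\<in>UNIV. of_real (\<alpha> $ i)) = (0 :: complex)"
      using sum_weights by (simp flip: of_real_sum)
    finally have "(\<Sum>i\<in>UNIV. of_real (\<alpha> $ i) * (L i 1 - L i 0)) = S" by simp
    moreover have "\<Gamma> 1 = \<Gamma> 0 + per \<tau>" using \<Gamma>(2) by simp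
    ultimately show ?thesis
      using linear_holonomy_formula[OF lam \<Gamma>(1,3) _ L hol] by simp
  qed
  obtain \<Gamma> where loop: "marked_loop o1 per (\<tau>, z) \<Gamma>"
    using ex_marked_loop[where per = per and p = p, OF x per p] by blast
  note \<Gamma> = marked_loopD[OF loop]
  have "per \<tau> \<in> lattice \<tau>" using p by (auto simp: per)
  then obtain \<rho> where \<rho>: "linear_holonomy theta_metric \<Gamma> (per \<tau>) \<rho>"
    using ex_linear_holonomy[OF flat_cone_metric_theta_metric \<Gamma>(1,3)] \<Gamma>(2) by fastforce
  have "holonomy_along \<alpha> o1 per (\<tau>, z) = exp (S + slope * per \<tau>)"
    unfolding holonomy_along_def
  proof (rule the_equality)
    have "\<rho> = exp (S + slope * per \<tau>)"
      by (rule unique[OF flat_cone_metric_theta_metric loop \<rho>])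
    then show "\<exists>lam \<Gamma>. flat_cone_metric \<alpha> (\<tau>, z) lam \<and> marked_loop o1 per (\<tau>, z) \<Gamma> \<and>
        linear_holonomy lam \<Gamma> (per (fst (\<tau>, z))) (exp (S + slope * per \<tau>))"
      using flat_cone_metric_theta_metric loop \<rho> by auto
  qed (use unique in auto)
  then show ?thesis by (simp only: slope_def)
qed

lemma holonomy_map_eq:
  fixes \<alpha> :: "real ^ 'n::finite"
  assumes \<alpha>: "admissible \<alpha> o1" and x: "x \<in> torelli o1"
  shows "holonomy_map \<alpha> o1 x = (exp (2 * pi * \<i> * fst (xi \<alpha> x)), exp (2 * pi * \<i> * snd (xi \<alpha> x)))"
proof -
  obtain \<tau> z where [simp]: "x = (\<tau>, z)" by force
  have x': "(\<tau>, z) \<in> torelli o1" and \<tau>: "Im \<tau> > 0" using x by (auto simp: torelli_def)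
  have sum0: "(\<Sum>i\<in>UNIV. of_real (\<alpha> $ i)) = (0 :: complex)"
    using \<alpha> by (simp add: admissible_def flip: of_real_sum)
  have 1: "holonomy_along \<alpha> o1 (\<lambda>_. 1) (\<tau>, z) = exp (0 + 2 * pi * \<i> * a_zero \<alpha> (\<tau>, z) * 1)"
    by (rule holonomy_along_eq[OF \<alpha> x', where p = 1 and m = "\<lambda>_. 0"]) (auto simp: theta_add_1)
  have 2: "holonomy_along \<alpha> o1 (\<lambda>\<tau>. \<tau>) (\<tau>, z) =
      exp (2 * pi * \<i> * weighted_sum \<alpha> z + 2 * pi * \<i> * a_zero \<alpha> (\<tau>, z) * \<tau>)"
  \<comment> \<open>The minus sign in the multiplier of theta is absorbed as exp (pi \<i>). Both pi
    \<i> and the term in \<open>u\<close> are common to all indices and cancel against the weights;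
    only the z_i survive.\<close>
  proof (rule holonomy_along_eq[OF \<alpha> x', where p = \<i> and m = "\<lambda>u. pi * \<i> - 2 * pi * \<i> * u"])
    show "theta \<tau> (u + \<tau>) = exp (pi * \<i> - 2 * pi * \<i> * u) * theta \<tau> u" for u
      by (subst theta_add_tau[OF \<tau>]) (simp add: exp_diff exp_minus field_simps)
    show "(\<Sum>i\<in>UNIV. of_real (\<alpha> $ i) * (pi * \<i> - 2 * pi * \<i> * (u - z $ i))) = 2 * pi * \<i> * weighted_sum \<alpha> z" for u
    proof -
      have "(\<Sum>i\<in>UNIV. of_real (\<alpha> $ i) * (pi * \<i> - 2 * pi * \<i> * (u - z $ i))) =
          (\<Sum>i\<in>UNIV. of_real (\<alpha> $ i) * (pi * \<i> - 2 * pi * \<i> * u) + 2 * pi * \<i> * (of_real (\<alpha> $ i) * z $ i))"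
        by (intro sum.cong) (simp_all add: algebra_simps)
      also have "\<dots> = (\<Sum>i\<in>UNIV. of_real (\<alpha> $ i)) * (pi * \<i> - 2 * pi * \<i> * u) + 2 * pi * \<i> * weighted_sum \<alpha> z"
        by (simp add: sum.distrib sum_distrib_right sum_distrib_left weighted_sum_def)
      finally show ?thesis by (simp add: sum0)
    qed
  qed (auto intro!: continuous_intros)
  have "2 * pi * \<i> * weighted_sum \<alpha> z + 2 * pi * \<i> * a_zero \<alpha> (\<tau>, z) * \<tau> = 2 * pi * \<i> * a_infty \<alpha> x"
    by (simp add: a_infty_def algebra_simps)
  also have "a_infty \<alpha> x = of_real (Re (a_infty \<alpha> x))"
    using a_infty_real[of x \<alpha>] \<tau> by (simp add: complex_is_Real_iff complex_eq_iff)
  finally show ?thesis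
    using 1 2 by (simp add: holonomy_map_def xi_def)
qed

lemma exp_2pi_i_constant:
  fixes g :: "'a::topological_space \<Rightarrow> real"
  assumes S: "connected S" and g: "continuous_on S g"
    and k: "\<And>x. x \<in> S \<Longrightarrow> exp (2 * pi * \<i> * of_real (g x)) = k" and xy: "x \<in> S" "y \<in> S"
  shows "g x = g y"
proof -
  have "\<exists>e>0. \<forall>y. y \<in> S \<and> g y \<noteq> g x \<longrightarrow> e \<le> norm (g y - g x)" if x: "x \<in> S" for x
  proof (intro exI[of _ 1] conjI allI impI)
    fix y assume y: "y \<in> S \<and> g y \<noteq> g x"
    have "exp (2 * pi * \<i> * of_real (g y - g x)) = 1"
    proof -
      have "exp (2 * pi * \<i> * of_real (g y)) = exp (2 * pi * \<i> * of_real (g x))"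
        using k[of x] k[of y] x y by simp
      then show ?thesis by (simp add: exp_diff right_diff_distrib)
    qed
    then obtain n :: int where "complex_of_real (g y - g x) = of_int n"
      unfolding exp_2pi_i_eq_1_iff by (auto elim: Ints_cases)
    then have "g y - g x = of_int n" by (metis of_real_eq_iff of_real_of_int_eq)
    moreover have "n \<noteq> 0" using y \<open>g y - g x = of_int n\<close> by auto
    then have "1 \<le> \<bar>n\<bar>" by linarith
    ultimately show "1 \<le> norm (g y - g x)" by simp
  qed simp
  then have "g constant_on S"
    by (intro continuous_discrete_range_constant[OF S g]) blast
  then show ?thesis using xy unfolding constant_on_def by metis
qed

lemma xi_constant_on_connected_leaf:
  assumes \<alpha>: "admissible \<alpha> o1" and D: "connected D" "D \<subseteq> {x \<in> torelli o1. holonomy_map \<alpha> o1 x = h}"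
    and xy: "x \<in> D" "y \<in> D"
  shows "xi \<alpha> x = xi \<alpha> y"
proof -
  have cont: "continuous_on D (xi \<alpha>)"
    using continuous_on_subset[OF continuous_on_xi] D(2) by blast
  have h: "exp (2 * pi * \<i> * fst (xi \<alpha> x)) = fst h" "exp (2 * pi * \<i> * snd (xi \<alpha> x)) = snd h"
    if "x \<in> D" for x
  proof -
    have "x \<in> torelli o1" "holonomy_map \<alpha> o1 x = h" using that D(2) by auto
    then show "exp (2 * pi * \<i> * fst (xi \<alpha> x)) = fst h" "exp (2 * pi * \<i> * snd (xi \<alpha> x)) = snd h"
      using holonomy_map_eq[OF \<alpha>, of x] by auto
  qed
  show ?thesis
  proof (rule prod_eqI)
    show "fst (xi \<alpha> x) = fst (xi \<alpha> y)"
      by (rule exp_2pi_i_constant[OF D(1) continuous_on_fst[OF cont] h(1) xy])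
    show "snd (xi \<alpha> x) = snd (xi \<alpha> y)"
      by (rule exp_2pi_i_constant[OF D(1) continuous_on_snd[OF cont] h(2) xy])
  qed
qed

text \<open>A level set of \<xi> is connected and, \<xi> being constant on connected parts of a
  holonomy fibre, maximal with this property. An arbitrary component meets the level set through any
  of its points, and components that meet coincide.\<close>

lemma veech_foliation_eq:
  fixes \<alpha> :: "real ^ 'n::finite"
  assumes n: "CARD('n) \<ge> 2" and \<alpha>: "admissible \<alpha> o1"
  shows "veech_foliation \<alpha> o1 = (\<lambda>a. {x \<in> torelli o1. xi \<alpha> x = a}) ` (xi \<alpha> ` torelli o1)"
proof -
  have level: "{y \<in> torelli o1. xi \<alpha> y = xi \<alpha> x} \<in> components {y \<in> torelli o1. holonomy_map \<alpha> o1 y = holonomy_map \<alpha> o1 x}"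
    if x: "x \<in> torelli o1" for x
    unfolding in_components_maximal
  proof (intro conjI allI impI)
    show "{y \<in> torelli o1. xi \<alpha> y = xi \<alpha> x} \<noteq> {}" using x by blast
    show "{y \<in> torelli o1. xi \<alpha> y = xi \<alpha> x} \<subseteq> {y \<in> torelli o1. holonomy_map \<alpha> o1 y = holonomy_map \<alpha> o1 x}"
      using x by (auto simp: holonomy_map_eq[OF \<alpha>])
    show "connected {y \<in> torelli o1. xi \<alpha> y = xi \<alpha> x}" by (rule connected_xi_level[OF n \<alpha>])
    fix D assume D: "D \<noteq> {} \<and> {y \<in> torelli o1. xi \<alpha> y = xi \<alpha> x} \<subseteq> D \<and>
      D \<subseteq> {y \<in> torelli o1. holonomy_map \<alpha> o1 y = holonomy_map \<alpha> o1 x} \<and> connected D"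
    then have "x \<in> D" using x by auto
    then have "xi \<alpha> y = xi \<alpha> x" if "y \<in> D" for y
      using xi_constant_on_connected_leaf[OF \<alpha>, of D] D that by blast
    then show "D = {y \<in> torelli o1. xi \<alpha> y = xi \<alpha> x}" using D by blast
  qed
  show ?thesis
  proof (intro equalityI subsetI)
    fix C assume "C \<in> veech_foliation \<alpha> o1"
    then obtain h where C: "C \<in> components {x \<in> torelli o1. holonomy_map \<alpha> o1 x = h}"
      by (auto simp: veech_foliation_def)
    then obtain x where xC: "x \<in> C" using in_components_nonempty by blast
    then have x: "x \<in> torelli o1" "holonomy_map \<alpha> o1 x = h" using in_components_subset[OF C] by auto
    have "C = {y \<in> torelli o1. xi \<alpha> y = xi \<alpha> x}"
      using components_eq[OF C level[OF x(1), unfolded x(2)]] xC x(1) by auto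
    then show "C \<in> (\<lambda>a. {x \<in> torelli o1. xi \<alpha> x = a}) ` (xi \<alpha> ` torelli o1)" using x(1) by blast
  next
    fix C assume "C \<in> (\<lambda>a. {x \<in> torelli o1. xi \<alpha> x = a}) ` (xi \<alpha> ` torelli o1)"
    then obtain x where "x \<in> torelli o1" "C = {y \<in> torelli o1. xi \<alpha> y = xi \<alpha> x}" by blast
    then show "C \<in> veech_foliation \<alpha> o1"
      unfolding veech_foliation_def using level by blast
  qed
qed

text \<open>Holonomy fibres of \<alpha> and c \<alpha> differ in general, since multiplication by c
  does not respect congruence modulo the integers. The leaves nevertheless agree: they are level
  sets of \<xi>, and scaling by a nonzero c merely relabels these.\<close>

lemma xi_scaleR: "xi (c *\<^sub>R \<alpha>) x = c *\<^sub>R xi \<alpha> x"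
proof -
  have "weighted_sum (c *\<^sub>R \<alpha>) z = of_real c * weighted_sum \<alpha> z" for z
    by (simp add: weighted_sum_def sum_distrib_left mult.assoc)
  then show ?thesis
    by (simp add: xi_def a_infty_def a_zero_def algebra_simps)
qed

theorem proposition1p3:
  fixes \<alpha> :: "real ^ 'n::finite" and o1 :: 'n
  assumes "CARD('n) \<ge> 2"
    and "admissible \<alpha> o1"
  shows "(\<forall>x\<in>torelli o1. a_infty \<alpha> x \<in> \<real>)
    \<and> primitive_first_integral (xi \<alpha>) (torelli o1) (veech_foliation \<alpha> o1)
    \<and> (CARD('n) \<ge> 3 \<longrightarrow> xi \<alpha> ` torelli o1 = UNIV)
    \<and> (CARD('n) = 2 \<longrightarrow> xi \<alpha> ` torelli o1 =
         UNIV - {(\<alpha> $ o1 * of_int k, \<alpha> $ o1 * of_int l) | k l. True})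
    \<and> (\<forall>a0 ainf. (a0, ainf) \<in> xi \<alpha> ` torelli o1 \<longrightarrow>
         {x \<in> torelli o1. xi \<alpha> x = (a0, ainf)} \<in> veech_foliation \<alpha> o1 \<and>
         {x \<in> torelli o1. xi \<alpha> x = (a0, ainf)} =
         {(\<tau>, z) \<in> torelli o1. of_real a0 * \<tau> + weighted_sum \<alpha> z = of_real ainf})
    \<and> (\<forall>\<beta>. admissible \<beta> o1 \<and> same_projective_class \<alpha> \<beta> \<longrightarrow>
         veech_foliation \<beta> o1 = veech_foliation \<alpha> o1)"
proof (intro conjI ballI allI impI)
  note foliation = veech_foliation_eq[OF assms(1)]
  show "a_infty \<alpha> x \<in> \<real>" if "x \<in> torelli o1" for x
    using that by (intro a_infty_real) (auto simp: torelli_def)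
  show "primitive_first_integral (xi \<alpha>) (torelli o1) (veech_foliation \<alpha> o1)"
    unfolding primitive_first_integral_def foliation[OF assms(2)]
    using connected_xi_level[OF assms] by blast
  show "xi \<alpha> ` torelli o1 = UNIV" if "CARD('n) \<ge> 3"
    by (rule xi_image_ge_3[OF that assms(2)])
  show "xi \<alpha> ` torelli o1 = UNIV - {(\<alpha> $ o1 * of_int k, \<alpha> $ o1 * of_int l) | k l. True}" if "CARD('n) = 2"
    by (rule xi_image_2[OF that assms(2)])
  show "{x \<in> torelli o1. xi \<alpha> x = (a0, ainf)} \<in> veech_foliation \<alpha> o1"
    if "(a0, ainf) \<in> xi \<alpha> ` torelli o1" for a0 ainf
    unfolding foliation[OF assms(2)] using that by (rule imageI)
  show "{x \<in> torelli o1. xi \<alpha> x = (a0, ainf)} =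
      {(\<tau>, z) \<in> torelli o1. of_real a0 * \<tau> + weighted_sum \<alpha> z = of_real ainf}" for a0 ainf
  proof -
    have "Im (fst x) > 0" if "x \<in> torelli o1" for x using that by (auto simp: torelli_def)
    then have "{x \<in> torelli o1. xi \<alpha> x = (a0, ainf)} =
        {x \<in> torelli o1. of_real a0 * fst x + weighted_sum \<alpha> (snd x) = of_real ainf}"
      using xi_eq_iff by blast
    then show ?thesis by (simp add: case_prod_unfold)
  qed
  fix \<beta> assume \<beta>: "admissible \<beta> o1 \<and> same_projective_class \<alpha> \<beta>"
  then obtain c where c: "c \<noteq> 0" "\<beta> = c *\<^sub>R \<alpha>" by (auto simp: same_projective_class_def)
  have "xi \<beta> x = xi \<beta> y \<longleftrightarrow> xi \<alpha> x = xi \<alpha> y" for x y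
    using c by (simp add: xi_scaleR)
  then have "(\<lambda>a. {x \<in> torelli o1. xi \<beta> x = a}) ` (xi \<beta> ` torelli o1) =
      (\<lambda>a. {x \<in> torelli o1. xi \<alpha> x = a}) ` (xi \<alpha> ` torelli o1)"
    by (simp add: image_image)
  then show "veech_foliation \<beta> o1 = veech_foliation \<alpha> o1"
    using foliation[OF assms(2)] foliation[of \<beta> o1] \<beta> by simp
qed

end
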